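(* Let $\Omega\subset\mathbb{R}^N$ be open, let $\mathbf F\in\mathcal{DM}^\infty_{loc}(\Omega)$, and let $E\Subset\Omega$ be a bounded set of finite perimeter. Then for every $\varphi\in C_c^\infty(\Omega)$, $$\int_{E^1}\varphi\,d(\operatorname{div}\mathbf F)+\int_{E^1}\mathbf F\cdot\nabla\varphi\,dy=-\int_{\partial^*E}\varphi\,(\mathscr F_i\cdot\nu)\,d\mathcal H^{N-1},$$ where $\nu$ is the measure-theoretic interior unit normal to $E$ on $\partial^*E$ and $\mathscr F_i\cdot\nu$ is the interior normal trace of $\mathbf F$ relative to $E$.
   Context: $D(E,y)=\lim_{r\to0}|E\cap B(y,r)|/|B(y,r)|$, $E^\alpha=\{D(E,\cdot)=\alpha\}$, $\partial^mE=\mathbb{R}^N\setminus(E^0\cup E^1)$; $\partial^*E$ is the reduced boundary and $\nabla\chi_E=\nu\,\mathcal H^{N-1}\llcorner\partial^*E$; convention $E=E^1\cup\partial^mE$. $\mathcal{DM}^\infty_{loc}(\Omega)$: fields in $L^\infty_{loc}(\Omega;\mathbb{R}^N)$ whose distributional divergence is a signed Radon measure on $\Omega$. Let $\rho$ be a standard nonnegative symmetric mollifier supported in the unit ball with integral 1, $u_k=\chi_E*\rho_{1/k}$, $A_{k;s}=\{u_k>s\}$, and for a.e. $s$ let $\sigma_{k;s}(B)=\int_{B\cap u_k^{-1}(s)}\mathbf F\cdot\frac{\nabla u_k}{|\nabla u_k|}\,d\mathcal H^{N-1}$ (the normal trace of $\mathbf F$ on the smooth surface $u_k^{-1}(s)$).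 For a.e. $s\in(\frac12,1)$ the measures $\sigma_{k;s}$ converge weak* as $k\to\infty$ to a signed measure $\sigma_i$ independent of $s$, with $\sigma_i\ll\mathcal H^{N-1}\llcorner\partial^*E$ (equivalently, $\sigma_i$ is the weak* limit of $2\chi_E(\mathbf F\cdot\nabla u_k)\mathcal L^N$); $\mathscr F_i\cdot\nu$ denotes the density of $\sigma_i$ with respect to $\mathcal H^{N-1}\llcorner\partial^*E$. *)

theory Defs
  imports "HOL-Analysis.Analysis"
begin

fun pderivs :: "'a list \<Rightarrow> ('a::euclidean_space \<Rightarrow> real) \<Rightarrow> 'a \<Rightarrow> real" where
  "pderivs [] f = f"
| "pderivs (b # bs) f = (\<lambda>x. frechet_derivative (pderivs bs f) (at x) b)"

definition smooth :: "('a::euclidean_space \<Rightarrow> real) \<Rightarrow> bool" where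
  "smooth f \<longleftrightarrow> (\<forall>bs. set bs \<subseteq> Basis \<longrightarrow> (\<forall>x. pderivs bs f differentiable (at x)))"

definition tsupport :: "('a::topological_space \<Rightarrow> 'b::zero) \<Rightarrow> 'a set" where
  "tsupport f = closure {x. f x \<noteq> 0}"

definition grad :: "('a::euclidean_space \<Rightarrow> real) \<Rightarrow> 'a \<Rightarrow> 'a" where
  "grad f x = (\<Sum>b\<in>Basis. frechet_derivative f (at x) b *\<^sub>R b)"

definition vdiv :: "('a::euclidean_space \<Rightarrow> 'a) \<Rightarrow> 'a \<Rightarrow> real" where
  "vdiv \<phi> x = (\<Sum>b\<in>Basis. frechet_derivative (\<lambda>y. \<phi> y \<bullet> b) (at x) b)"

definition test_fun :: "'a::euclidean_space set \<Rightarrow> ('a \<Rightarrow> real) \<Rightarrow> bool" where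
  "test_fun \<Omega> \<phi> \<longleftrightarrow> smooth \<phi> \<and> compact (tsupport \<phi>) \<and> tsupport \<phi> \<subseteq> \<Omega>"

definition vtest_field :: "('a::euclidean_space \<Rightarrow> 'a) \<Rightarrow> bool" where
  "vtest_field \<phi> \<longleftrightarrow> (\<forall>b\<in>Basis. smooth (\<lambda>x. \<phi> x \<bullet> b)) \<and> compact (tsupport \<phi>)"

definition cc_fun :: "'a::euclidean_space set \<Rightarrow> ('a \<Rightarrow> real) \<Rightarrow> bool" where
  "cc_fun \<Omega> \<psi> \<longleftrightarrow> continuous_on UNIV \<psi> \<and> compact (tsupport \<psi>) \<and> tsupport \<psi> \<subseteq> \<Omega>"

definition dens_set :: "'a::euclidean_space set \<Rightarrow> real \<Rightarrow> 'a set" where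
  "dens_set E \<alpha> = {y. ((\<lambda>r. measure lebesgue (E \<inter> ball y r) / measure lebesgue (ball y r))
                       \<longlongrightarrow> \<alpha>) (at_right 0)}"

definition meas_boundary :: "'a::euclidean_space set \<Rightarrow> 'a set" where
  "meas_boundary E = UNIV - (dens_set E 0 \<union> dens_set E 1)"

definition finite_perimeter :: "'a::euclidean_space set \<Rightarrow> bool" where
  "finite_perimeter E \<longleftrightarrow> E \<in> sets lebesgue \<and>
     (\<exists>C::real. \<forall>\<phi>. vtest_field \<phi> \<and> (\<forall>x. norm (\<phi> x) \<le> 1) \<longrightarrow>
          (LINT x:E|lebesgue. vdiv \<phi> x) \<le> C)"

text \<open>\<open>\<mu>\<close> and \<open>\<sigma>\<close> give the polar decomposition of the Gauss--Green measure
  \<open>\<nabla>\<chi>_E = \<sigma> |\<nabla>\<chi>_E|\<close>, \<open>\<mu> = |\<nabla>\<chi>_E|\<close>, i.e.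
  \<open>\<integral>_E div \<phi> = - \<integral> \<phi>\<cdot>\<sigma> d\<mu>\<close> for all smooth compactly supported vector fields.\<close>
definition gauss_green :: "'a::euclidean_space set \<Rightarrow> 'a measure \<Rightarrow> ('a \<Rightarrow> 'a) \<Rightarrow> bool" where
  "gauss_green E \<mu> \<sigma> \<longleftrightarrow> sets \<mu> = sets borel \<and> emeasure \<mu> UNIV < \<infinity> \<and>
     \<sigma> \<in> borel_measurable borel \<and> (\<forall>x. norm (\<sigma> x) = 1) \<and>
     (\<forall>\<phi>. vtest_field \<phi> \<longrightarrow>
        (LINT x:E|lebesgue. vdiv \<phi> x) = - (LINT x|\<mu>. \<phi> x \<bullet> \<sigma> x))"

definition reduced_boundary :: "'a::euclidean_space measure \<Rightarrow> ('a \<Rightarrow> 'a) \<Rightarrow> 'a set" where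
  "reduced_boundary \<mu> \<sigma> = {x. (\<forall>r>0. emeasure \<mu> (ball x r) > 0) \<and>
     (\<exists>v. norm v = 1 \<and>
        ((\<lambda>r. (1 / measure \<mu> (ball x r)) *\<^sub>R (LINT y:ball x r|\<mu>. \<sigma> y)) \<longlongrightarrow> v) (at_right 0))}"

definition haus_omega :: "real \<Rightarrow> real" where
  "haus_omega s = pi powr (s / 2) / Gamma (s / 2 + 1)"

definition haus_term :: "real \<Rightarrow> 'a::euclidean_space set \<Rightarrow> real" where
  "haus_term s C = (if C = {} then 0 else if s = 0 then 1 else (diameter C / 2) powr s)"

definition haus_pre :: "real \<Rightarrow> real \<Rightarrow> 'a::euclidean_space set \<Rightarrow> ennreal" where
  "haus_pre s \<delta> A = (INF C \<in> {C :: nat \<Rightarrow> 'a set. A \<subseteq> (\<Union>i. C i) \<and>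
        (\<forall>i. bounded (C i) \<and> diameter (C i) \<le> \<delta>)}.
       (\<Sum>i. ennreal (haus_omega s * haus_term s (C i))))"

definition haus_outer :: "real \<Rightarrow> 'a::euclidean_space set \<Rightarrow> ennreal" where
  "haus_outer s A = (SUP \<delta> \<in> {0<..}. haus_pre s \<delta> A)"

definition hausdorff :: "real \<Rightarrow> 'a::euclidean_space measure" where
  "hausdorff s = measure_of UNIV (sets borel) (haus_outer s)"

text \<open>\<open>F \<in> \<D>\<M>^\<infinity>_loc(\<Omega>)\<close> with \<open>div F = \<mu>p - \<mu>m\<close> (a signed Radon measure on \<Omega>,
  written as a difference of two locally finite Borel measures).\<close>
definition DM_loc :: "'a::euclidean_space set \<Rightarrow> ('a \<Rightarrow> 'a) \<Rightarrow> 'a measure \<Rightarrow> 'a measure \<Rightarrow> bool" where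
  "DM_loc \<Omega> F \<mu>p \<mu>m \<longleftrightarrow>
     F \<in> borel_measurable (lebesgue_on \<Omega>) \<and>
     (\<forall>K. compact K \<and> K \<subseteq> \<Omega> \<longrightarrow> (\<exists>C. AE x in lebesgue. x \<in> K \<longrightarrow> norm (F x) \<le> C)) \<and>
     sets \<mu>p = sets borel \<and> sets \<mu>m = sets borel \<and>
     (\<forall>K. compact K \<and> K \<subseteq> \<Omega> \<longrightarrow> emeasure \<mu>p K < \<infinity> \<and> emeasure \<mu>m K < \<infinity>) \<and>
     (\<forall>\<phi>. test_fun \<Omega> \<phi> \<longrightarrow>
        (LINT x|lebesgue. F x \<bullet> grad \<phi> x) = - ((LINT x|\<mu>p. \<phi> x) - (LINT x|\<mu>m. \<phi> x)))"

definition mollifier :: "('a::euclidean_space \<Rightarrow> real) \<Rightarrow> bool" where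
  "mollifier \<rho> \<longleftrightarrow> smooth \<rho> \<and> (\<forall>x. \<rho> x \<ge> 0) \<and> (\<forall>x. norm x \<ge> 1 \<longrightarrow> \<rho> x = 0) \<and>
     (\<forall>x. \<rho> (- x) = \<rho> x) \<and> integrable lebesgue \<rho> \<and> (LINT x|lebesgue. \<rho> x) = 1"

definition moll_eps :: "('a::euclidean_space \<Rightarrow> real) \<Rightarrow> real \<Rightarrow> 'a \<Rightarrow> real" where
  "moll_eps \<rho> \<epsilon> x = (1 / \<epsilon>) ^ DIM('a) * \<rho> ((1 / \<epsilon>) *\<^sub>R x)"

definition moll_char :: "('a::euclidean_space \<Rightarrow> real) \<Rightarrow> 'a set \<Rightarrow> nat \<Rightarrow> 'a \<Rightarrow> real" where
  "moll_char \<rho> E k x = (LINT y|lebesgue. indicator E y * moll_eps \<rho> (1 / real k) (x - y))"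

text \<open>\<open>g\<close> is the interior normal trace \<open>\<F>_i\<cdot>\<nu>\<close>: the density with respect to
  \<open>\<H>^{N-1}\<llcorner>\<partial>^*E\<close> of \<open>\<sigma>_i\<close>, the weak* limit (tested against \<open>C_c(\<Omega>)\<close>) of the
  measures \<open>2 \<chi>_E (F\<cdot>\<nabla>u_k) \<L>^N\<close> as \<open>k \<rightarrow> \<infinity>\<close>.\<close>
definition interior_normal_trace ::
  "'a::euclidean_space set \<Rightarrow> 'a set \<Rightarrow> ('a \<Rightarrow> 'a) \<Rightarrow> ('a \<Rightarrow> real) \<Rightarrow> 'a measure \<Rightarrow> ('a \<Rightarrow> 'a)
     \<Rightarrow> ('a \<Rightarrow> real) \<Rightarrow> bool" where
  "interior_normal_trace \<Omega> E F \<rho> \<mu> \<sigma> g \<longleftrightarrow>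
     g \<in> borel_measurable borel \<and>
     set_integrable (hausdorff (real DIM('a) - 1)) (reduced_boundary \<mu> \<sigma>) g \<and>
     (\<forall>\<psi>. cc_fun \<Omega> \<psi> \<longrightarrow>
        (\<lambda>k. LINT x|lebesgue. \<psi> x * (2 * indicator E x * (F x \<bullet> grad (moll_char \<rho> E (Suc k)) x)))
        \<longlonglongrightarrow> (LINT y:reduced_boundary \<mu> \<sigma>|hausdorff (real DIM('a) - 1). \<psi> y * g y))"

end

theory Submission
  imports Defs
begin

text \<open>Write \<open>D\<close> for \<open>div F\<close>, \<open>u_k\<close> for the mollified characteristic function and \<open>B\<close> for the
  measure-theoretic boundary. Since the kernel is even, \<open>u_k \<nabla>\<chi>_E\<close> and \<open>\<chi>_E \<nabla>u_k\<close> have the same limit,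
  so both tend to half of \<open>\<nabla>\<chi>_E\<close> and \<open>u_k\<close> tends to \<open>1/2\<close> weakly with respect to the
  perimeter measure \<open>\<mu>\<close>. No blow-up is needed. Every point of \<open>B\<close> is the centre of small balls that \<open>E\<close>
  fills neither almost completely nor almost not at all, so the relative isoperimetric inequality and
  a Vitali covering show that \<open>B\<close> is Lebesgue null and that \<open>D\<close> restricted to \<open>B\<close> is absolutely
  continuous with respect to \<open>\<mu>\<close>. Hence \<open>\<integral> f u_k dD\<close> tends to
  \<open>R f = \<integral>_{E^1} f dD + 1/2 \<integral>_B f dD\<close>, and, testing \<open>D\<close> with \<open>\<psi> u_k\<close>, \<open>\<integral> \<psi> F\<cdot>\<nabla>u_k\<close> tends to
  \<open>M \<psi> = - \<integral>_E F\<cdot>\<nabla>\<psi> - R \<psi>\<close>, where \<open>|M \<psi>|\<close> is at most a constant times \<open>\<integral> |\<psi>| d\<mu>\<close>. With \<open>\<psi> = \<phi> u_k\<close> this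
  gives \<open>\<integral>_E \<phi> F\<cdot>\<nabla>u_k = - M (\<phi> u_k) - \<integral>_E u_k F\<cdot>\<nabla>\<phi> - R (\<phi> u_k)\<close>; since \<open>M (\<phi> u_k)\<close> tends to
  \<open>M \<phi> / 2\<close>, the contributions of \<open>B\<close> cancel in the limit.\<close>

section \<open>Smooth functions\<close>

text \<open>Convergence of \<open>u_k\<close> to 1/2 at boundary points would rest on De Giorgi's
  structure theory. Evenness of the kernel gives convergence tested against
  \<open>L^1(\<mu>)\<close>, which can be used under \<open>div F\<close> only where that measure
  has a density with respect to \<open>\<mu>\<close>. This is why absolute continuity has to be
  proved. Its mechanism is capacitary: compact \<open>\<mu>\<close>-null pieces of the boundary
  admit cutoffs equal to 1 on them with gradients arbitrarily small in \<open>L^1\<close>, and a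
  bounded field turns small gradients into small divergence. The other obstacle is the term
  \<open>M (\<phi> u_k)\<close>: its argument varies with \<open>k\<close>, and
  \<open>\<phi> u_k\<close> is only known to converge weakly, not in the norm of
  \<open>L^1(\<mu>)\<close>. The bound by that norm still makes \<open>M\<close>, being linear,
  continuous along the sequence. The trace enters as the limit of doubled integrals over
  \<open>E\<close>, so that the theorem becomes the computation of this limit.\<close>

definition pd :: "'a \<Rightarrow> ('a::euclidean_space \<Rightarrow> real) \<Rightarrow> 'a \<Rightarrow> real" where
  "pd b f = (\<lambda>x. frechet_derivative f (at x) b)"

lemma pderivs_append: "pderivs (bs @ cs) f = pderivs bs (pderivs cs f)"
  by (induction bs) auto

text \<open>Smoothness is the largest property that entails differentiability and passes to partial
  derivatives along the basis. Closure proofs then only have to name an invariant class of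
  functions.\<close>

lemma smooth_coinduct:
  assumes "X f"
    and "\<And>f x. X f \<Longrightarrow> f differentiable (at x)"
    and "\<And>f b. X f \<Longrightarrow> b \<in> Basis \<Longrightarrow> X (pd b f)"
  shows "smooth f"
proof -
  have "X (pderivs bs f)" if "set bs \<subseteq> Basis" for bs
    using that by (induction bs) (use assms(1) assms(3)[unfolded pd_def] in auto)
  then show ?thesis
    unfolding smooth_def using assms(2) by blast
qed

lemma smooth_differentiable: "smooth f \<Longrightarrow> f differentiable (at x)"
  unfolding smooth_def by (drule spec[of _ "[]"]) simp

lemma smooth_pd:
  assumes "smooth f" "b \<in> Basis" shows "smooth (pd b f)"
  unfolding smooth_def
proof (intro allI impI)
  fix bs :: "'a list" and x assume "set bs \<subseteq> Basis"
  \<comment> \<open>\<open>pderivs\<close> applies the last entry of its list first, so an initial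
    derivative is appended on the right.\<close>
  then have "set (bs @ [b]) \<subseteq> Basis" using assms(2) by simp
  then have "pderivs (bs @ [b]) f differentiable (at x)"
    using assms(1) unfolding smooth_def by blast
  then show "pderivs bs (pd b f) differentiable (at x)"
    by (simp add: pderivs_append pd_def)
qed

lemma smooth_continuous: "smooth f \<Longrightarrow> continuous_on A f"
  by (meson continuous_at_imp_continuous_on differentiable_imp_continuous_within smooth_differentiable)

lemma smooth_borel [measurable]: "smooth f \<Longrightarrow> f \<in> borel_measurable borel"
  by (intro borel_measurable_continuous_onI smooth_continuous)

text \<open>Differentiability of finite order. The derivative of a product is a sum of products, so
  products alone are not an invariant class for \<open>smooth_coinduct\<close>; induction on the
  order avoids describing the class that they generate.\<close>

primrec diffn :: "nat \<Rightarrow> ('a::euclidean_space \<Rightarrow> real) \<Rightarrow> bool" where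
  "diffn 0 f = (\<forall>x. f differentiable (at x))"
| "diffn (Suc n) f = ((\<forall>x. f differentiable (at x)) \<and> (\<forall>b\<in>Basis. diffn n (pd b f)))"

lemma diffn_Suc_D: "diffn (Suc n) f \<Longrightarrow> diffn n f"
  by (induction n arbitrary: f) auto

lemma smooth_iff_diffn: "smooth f \<longleftrightarrow> (\<forall>n. diffn n f)"
proof
  assume "smooth f"
  then have "diffn n f" for n
    by (induction n arbitrary: f) (auto simp: smooth_differentiable smooth_pd)
  then show "\<forall>n. diffn n f" by blast
next
  assume *: "\<forall>n. diffn n f"
  show "smooth f"
  proof (rule smooth_coinduct[where X = "\<lambda>f. \<forall>n. diffn n f", OF *])
    fix f :: "'a \<Rightarrow> real" and b :: 'a assume "\<forall>n. diffn n f" "b \<in> Basis"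
    then show "\<forall>n. diffn n (pd b f)" by (metis diffn.simps(2))
  qed (metis diffn.simps(1))
qed

section \<open>Partial derivatives of sums, products and affine substitutions\<close>

lemma pd_eqI: "(\<And>x. (f has_derivative f' x) (at x)) \<Longrightarrow> pd b f = (\<lambda>x. f' x b)"
  unfolding pd_def by (metis frechet_derivative_at)

lemma pd_const: "pd b (\<lambda>x. c) = (\<lambda>x. 0)"
  by (rule pd_eqI) (auto intro!: derivative_eq_intros)

lemma has_derivative_frechet: "f differentiable (at x) \<Longrightarrow> (f has_derivative frechet_derivative f (at x)) (at x)"
  using frechet_derivative_works by blast

lemma pd_add:
  assumes "\<And>x. f differentiable (at x)" "\<And>x. g differentiable (at x)"
  shows "pd b (\<lambda>x. f x + g x) = (\<lambda>x. pd b f x + pd b g x)"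
  unfolding pd_def[of b f] pd_def[of b g]
  by (rule pd_eqI) (intro has_derivative_add has_derivative_frechet assms)

lemma pd_mult:
  assumes "\<And>x. f differentiable (at x)" "\<And>x. g differentiable (at x)"
  shows "pd b (\<lambda>x. f x * g x) = (\<lambda>x. f x * pd b g x + pd b f x * g x)"
  unfolding pd_def[of b f] pd_def[of b g]
  by (rule pd_eqI) (intro has_derivative_mult has_derivative_frechet assms)

lemma diffn_const: "diffn n (\<lambda>x. c)"
  by (induction n arbitrary: c) (auto simp: pd_const)

lemma diffn_add: "diffn n f \<Longrightarrow> diffn n g \<Longrightarrow> diffn n (\<lambda>x. f x + g x)"
  by (induction n arbitrary: f g) (auto simp: pd_add)

lemma diffn_mult: "diffn n f \<Longrightarrow> diffn n g \<Longrightarrow> diffn n (\<lambda>x. f x * g x)"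
proof (induction n arbitrary: f g)
  case (Suc n)
  then have "diffn n f" "diffn n g" by (blast dest: diffn_Suc_D)+
  with Suc show ?case by (auto simp: pd_mult diffn_add)
qed auto

lemma smooth_const: "smooth (\<lambda>x. c)"
  by (simp add: smooth_iff_diffn diffn_const)

lemma smooth_add: "smooth f \<Longrightarrow> smooth g \<Longrightarrow> smooth (\<lambda>x. f x + g x)"
  by (simp add: smooth_iff_diffn diffn_add)

lemma smooth_mult: "smooth f \<Longrightarrow> smooth g \<Longrightarrow> smooth (\<lambda>x. f x * g x)"
  by (simp add: smooth_iff_diffn diffn_mult)

lemma smooth_diff:
  assumes "smooth f" "smooth g" shows "smooth (\<lambda>x. f x - g x)"
proof -
  have "smooth (\<lambda>x. f x + (-1) * g x)" by (intro smooth_add smooth_mult smooth_const assms)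
  then show ?thesis by simp
qed

lemma pd_affine:
  assumes "\<And>x. f differentiable (at x)"
  shows "pd b (\<lambda>y. c * f (a + s *\<^sub>R y)) = (\<lambda>y. c * s * pd b f (a + s *\<^sub>R y))"
proof -
  have "pd b (\<lambda>y. c * f (a + s *\<^sub>R y)) =
      (\<lambda>y. c * frechet_derivative f (at (a + s *\<^sub>R y)) (s *\<^sub>R b))"
    by (rule pd_eqI, rule has_derivative_mult_right,
        rule has_derivative_compose[OF _ has_derivative_frechet[OF assms], of "\<lambda>y. a + s *\<^sub>R y"])
      (auto intro!: derivative_eq_intros)
  moreover have "linear (frechet_derivative f (at x))" for x
    using assms linear_frechet_derivative by blast
  ultimately show ?thesis
    by (simp add: pd_def linear_scale fun_eq_iff)
qed

text \<open>With \<open>a\<close> and \<open>s\<close> fixed, the chain rule factor \<open>s\<close>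
  is absorbed into the constant, so functions of this shape form an invariant class. The shape
  covers rescaled kernels, reflected kernels and rescaled cutoffs.\<close>

lemma smooth_affine:
  assumes "smooth f" shows "smooth (\<lambda>y. c * f (a + s *\<^sub>R y))"
proof (rule smooth_coinduct[where X = "\<lambda>g. \<exists>f c. smooth f \<and> g = (\<lambda>y. c * f (a + s *\<^sub>R y))"])
  fix g x assume "\<exists>f c. smooth f \<and> g = (\<lambda>y. c * f (a + s *\<^sub>R y))"
  then obtain f c where "smooth f" and g: "g = (\<lambda>y. c * f (a + s *\<^sub>R y))" by blast
  have "(\<lambda>y. f (a + s *\<^sub>R y)) differentiable (at x)"
    using differentiable_chain_at[of "\<lambda>y. a + s *\<^sub>R y" x f] smooth_differentiable[OF \<open>smooth f\<close>]
    by (auto simp: o_def)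
  then show "g differentiable (at x)" unfolding g by simp
next
  fix g and b :: 'a assume "\<exists>f c. smooth f \<and> g = (\<lambda>y. c * f (a + s *\<^sub>R y))" "b \<in> Basis"
  then show "\<exists>f c. smooth f \<and> pd b g = (\<lambda>y. c * f (a + s *\<^sub>R y))"
    by (metis pd_affine smooth_differentiable smooth_pd)
qed (use assms in blast)

section \<open>Gradients of smooth functions\<close>

lemma grad_inner_Basis: "b \<in> Basis \<Longrightarrow> grad f x \<bullet> b = pd b f x"
  by (simp add: grad_def pd_def inner_sum_left inner_Basis if_distrib cong: if_cong)

lemma frechet_derivative_grad:
  assumes "f differentiable (at x)"
  shows "frechet_derivative f (at x) h = grad f x \<bullet> h"
proof -
  interpret linear "frechet_derivative f (at x)"
    using assms linear_frechet_derivative by blast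
  have "frechet_derivative f (at x) h = frechet_derivative f (at x) (\<Sum>b\<in>Basis. (h \<bullet> b) *\<^sub>R b)"
    by (simp add: euclidean_representation)
  also have "\<dots> = grad f x \<bullet> h"
    by (simp add: sum scale grad_def inner_sum_left) (simp add: inner_commute mult.commute)
  finally show ?thesis .
qed

lemma smooth_has_derivative:
  assumes "smooth f" shows "(f has_derivative (\<lambda>h. grad f x \<bullet> h)) (at x)"
proof -
  have "frechet_derivative f (at x) = (\<lambda>h. grad f x \<bullet> h)"
    using frechet_derivative_grad[OF smooth_differentiable[OF assms]] by blast
  then show ?thesis
    using has_derivative_frechet[OF smooth_differentiable[OF assms], of x] by simp
qed

lemma grad_eqI:
  assumes "(f has_derivative (\<lambda>h. v \<bullet> h)) (at x)" shows "grad f x = v"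
proof (rule euclidean_eqI)
  fix b :: 'a assume "b \<in> Basis"
  then show "grad f x \<bullet> b = v \<bullet> b"
    using frechet_derivative_at[OF assms] by (simp add: grad_inner_Basis pd_def flip: fun_eq_iff)
qed

lemma grad_mult:
  assumes "smooth f" "smooth g"
  shows "grad (\<lambda>x. f x * g x) x = f x *\<^sub>R grad g x + g x *\<^sub>R grad f x"
  by (rule grad_eqI, rule has_derivative_eq_rhs,
      rule has_derivative_mult[OF smooth_has_derivative[OF assms(1)] smooth_has_derivative[OF assms(2)]])
    (auto simp: inner_simps)

lemma grad_add:
  assumes "smooth f" "smooth g"
  shows "grad (\<lambda>x. f x + g x) x = grad f x + grad g x"
  by (rule grad_eqI, rule has_derivative_eq_rhs,
      rule has_derivative_add[OF smooth_has_derivative[OF assms(1)] smooth_has_derivative[OF assms(2)]])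
    (auto simp: inner_simps)

lemma grad_diff:
  assumes "smooth f" "smooth g"
  shows "grad (\<lambda>x. f x - g x) x = grad f x - grad g x"
  by (rule grad_eqI, rule has_derivative_eq_rhs,
      rule has_derivative_diff[OF smooth_has_derivative[OF assms(1)] smooth_has_derivative[OF assms(2)]])
    (auto simp: inner_simps)

lemma grad_continuous: "smooth f \<Longrightarrow> continuous_on A (grad f)"
  unfolding continuous_on_componentwise[of A "grad f"]
  by (simp add: grad_inner_Basis smooth_pd smooth_continuous cong: ball_cong)

lemma grad_borel [measurable]: "smooth f \<Longrightarrow> grad f \<in> borel_measurable borel"
  by (intro borel_measurable_continuous_onI grad_continuous)

lemma grad_zero_outside:
  assumes "closed K" "\<And>x. x \<notin> K \<Longrightarrow> f x = 0" "x \<notin> K"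
  shows "grad f x = 0"
proof (rule grad_eqI)
  have "((\<lambda>x. 0::real) has_derivative (\<lambda>h. 0)) (at x)" by simp
  then show "(f has_derivative (\<lambda>h. 0 \<bullet> h)) (at x)"
    using has_derivative_transform_within_open[of "\<lambda>x. 0::real" "\<lambda>h. 0" x UNIV "-K" f] assms
    by (auto simp: open_Compl)
qed

section \<open>Continuous functions with compact support\<close>

lemma compact_support_bounded:
  fixes f :: "'a::euclidean_space \<Rightarrow> 'b::real_normed_vector"
  assumes "continuous_on UNIV f" "compact K" "\<And>x. x \<notin> K \<Longrightarrow> f x = 0"
  obtains B where "B > 0" "\<And>x. norm (f x) \<le> B"
proof -
  have "compact (f ` K)"
    using assms(1,2) compact_continuous_image continuous_on_subset by blast
  then obtain B where "B > 0" "\<And>y. y \<in> f ` K \<Longrightarrow> norm y \<le> B"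
    using bounded_pos compact_imp_bounded by metis
  then show ?thesis
    by (intro that[of B]) (metis assms(3) imageI less_imp_le norm_zero)+
qed

lemma compact_support_uniformly_continuous:
  fixes f :: "'a::euclidean_space \<Rightarrow> 'b::real_normed_vector"
  assumes "continuous_on UNIV f" "compact K" "\<And>x. x \<notin> K \<Longrightarrow> f x = 0" "e > 0"
  obtains d where "d > 0" "\<And>x y. dist x y < d \<Longrightarrow> dist (f x) (f y) < e"
proof -
  obtain R where "K \<subseteq> ball 0 R"
    using bounded_subset_ballD[OF compact_imp_bounded[OF assms(2)], of 0] by blast
  then have R: "K \<subseteq> cball 0 R" using ball_subset_cball by blast
  \<comment> \<open>The margin 1 matches the cap \<open>min d 1\<close> below: two points at
    distance less than 1 that do not both lie in the larger ball both miss the smaller one, hence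
    \<open>K\<close>, and \<open>f\<close> vanishes at both.\<close>
  have "uniformly_continuous_on (cball 0 (R + 1)) f"
    by (intro compact_uniformly_continuous continuous_on_subset[OF assms(1)]) auto
  then obtain d where d: "d > 0" "\<And>x y. x \<in> cball 0 (R + 1) \<Longrightarrow> y \<in> cball 0 (R + 1) \<Longrightarrow>
      dist x y < d \<Longrightarrow> dist (f x) (f y) < e"
    using assms(4) unfolding uniformly_continuous_on_def by (metis dist_commute)
  show ?thesis
  proof (rule that[of "min d 1"])
    fix x y :: 'a assume *: "dist x y < min d 1"
    show "dist (f x) (f y) < e"
    proof (cases "x \<in> cball 0 (R + 1) \<and> y \<in> cball 0 (R + 1)")
      case True then show ?thesis using d * by auto
    next
      case False
      have "norm x \<le> norm y + dist x y" "norm y \<le> norm x + dist x y"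
        unfolding dist_norm by (smt (verit) norm_minus_commute norm_triangle_sub)+
      then have "x \<notin> cball 0 R" "y \<notin> cball 0 R" using * False by auto
      then have "f x = 0" "f y = 0" using R assms(3) by blast+
      then show ?thesis using assms(4) by simp
    qed
  qed (use d in auto)
qed

section \<open>Convolution and density of test functions\<close>

text \<open>Taken over \<open>lborel\<close>, where Fubini and Borel measurability are at hand; for
  Borel integrands the value agrees with the integral over \<open>lebesgue\<close>.\<close>

definition conv :: "('a::euclidean_space \<Rightarrow> real) \<Rightarrow> ('a \<Rightarrow> real) \<Rightarrow> 'a \<Rightarrow> real" where
  "conv f \<psi> x = (LINT y|lborel. f y * \<psi> (x - y))"

lemma nn_integral_affine:
  fixes f :: "'a::euclidean_space \<Rightarrow> ennreal"
  assumes [measurable]: "f \<in> borel_measurable borel" and "c \<noteq> 0"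
  shows "(\<integral>\<^sup>+x. f x \<partial>lborel) = ennreal (\<bar>c\<bar> ^ DIM('a)) * (\<integral>\<^sup>+x. f (t + c *\<^sub>R x) \<partial>lborel)"
  by (subst lborel_affine[OF assms(2), of t])
    (simp add: nn_integral_density nn_integral_distr nn_integral_cmult)

lemma integral_affine:
  fixes f :: "'a::euclidean_space \<Rightarrow> real"
  assumes [measurable]: "f \<in> borel_measurable borel" and "c \<noteq> 0"
  shows "(LINT x|lborel. f x) = \<bar>c\<bar> ^ DIM('a) * (LINT x|lborel. f (t + c *\<^sub>R x))"
    and "integrable lborel f \<longleftrightarrow> integrable lborel (\<lambda>x. f (t + c *\<^sub>R x))"
proof -
  show "(LINT x|lborel. f x) = \<bar>c\<bar> ^ DIM('a) * (LINT x|lborel. f (t + c *\<^sub>R x))"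
    by (subst lborel_affine[OF assms(2), of t]) (simp add: integral_density integral_distr)
  show "integrable lborel f \<longleftrightarrow> integrable lborel (\<lambda>x. f (t + c *\<^sub>R x))"
    using assms(2) by (subst lborel_affine[OF assms(2), of t]) (simp add: integrable_density integrable_distr_eq)
qed

lemma integrable_bounded_support:
  fixes f :: "'a::euclidean_space \<Rightarrow> 'b::{banach,second_countable_topology}"
  assumes [measurable]: "f \<in> borel_measurable borel" and "compact K"
    and "\<And>x. x \<notin> K \<Longrightarrow> f x = 0" and "\<And>x. norm (f x) \<le> B"
  shows "integrable lborel f"
proof -
  have [measurable]: "K \<in> sets borel" using assms(2) by (simp add: borel_compact)
  have "integrable lborel (\<lambda>x. indicat_real K x * B)"
    using emeasure_compact_finite[OF assms(2)] assms(2) by (simp add: borel_compact)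
  then show ?thesis
    by (rule Bochner_Integration.integrable_bound)
      (use assms in \<open>auto simp: indicator_def intro!: AE_I2 order_trans[OF assms(4) abs_ge_self]\<close>)
qed

lemma integrable_mult_bounded:
  fixes g :: "'a \<Rightarrow> 'b::{banach,second_countable_topology}"
  assumes "integrable M f" and [measurable]: "g \<in> borel_measurable M" and "\<And>x. norm (g x) \<le> B"
  shows "integrable M (\<lambda>x. f x *\<^sub>R g x)"
proof (rule Bochner_Integration.integrable_bound[of M "\<lambda>x. B * f x"])
  show "integrable M (\<lambda>x. B * f x)" using assms(1) by simp
  show "(\<lambda>x. f x *\<^sub>R g x) \<in> borel_measurable M" using assms(1) by measurable
  have "\<bar>f x\<bar> * norm (g x) \<le> \<bar>B\<bar> * \<bar>f x\<bar>" for x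
    using mult_left_mono[of "norm (g x)" "\<bar>B\<bar>" "\<bar>f x\<bar>"] assms(3)[of x] by (simp add: mult.commute)
  then show "AE x in M. norm (f x *\<^sub>R g x) \<le> norm (B * f x)"
    by (simp add: abs_mult)
qed

text \<open>The gradient is uniformly continuous by compactness of the support, so one
  \<open>d\<close> serves all base points \<open>z\<close>. This uniformity is what lets a
  derivative pass under the convolution integral.\<close>

lemma smooth_linearization:
  assumes "smooth \<psi>" "compact K" "\<And>x. x \<notin> K \<Longrightarrow> \<psi> x = 0" "e > 0"
  obtains d where "d > 0" "\<And>z h. norm h < d \<Longrightarrow> \<bar>\<psi> (z + h) - \<psi> z - grad \<psi> z \<bullet> h\<bar> \<le> e * norm h"
proof -
  have "\<And>x. x \<notin> K \<Longrightarrow> grad \<psi> x = 0"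
    using grad_zero_outside[OF compact_imp_closed] assms(2,3) by blast
  from compact_support_uniformly_continuous[OF grad_continuous[OF assms(1)] assms(2) this assms(4)]
  obtain d where d: "d > 0" "\<And>x y. dist x y < d \<Longrightarrow> dist (grad \<psi> x) (grad \<psi> y) < e" by blast
  show ?thesis
  proof (rule that[OF d(1)])
    fix z h :: 'a assume h: "norm h < d"
    have "norm (\<psi> (z + h) - \<psi> z - grad \<psi> z \<bullet> (z + h - z)) \<le> norm (z + h - z) * e"
    proof (rule differentiable_bound_linearization[where S = "ball z d" and f' = "\<lambda>x h. grad \<psi> x \<bullet> h"])
      fix t :: real assume "t \<in> {0..1}"
      then have "\<bar>t\<bar> * norm h \<le> 1 * norm h" by (intro mult_right_mono) auto
      then show "z + t *\<^sub>R (z + h - z) \<in> ball z d" using h by (simp add: dist_norm)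
    next
      fix x show "(\<psi> has_derivative (\<lambda>h. grad \<psi> x \<bullet> h)) (at x within ball z d)"
        using smooth_has_derivative[OF assms(1)] has_derivative_at_withinI by blast
    next
      fix x assume "x \<in> ball z d"
      then have "norm (grad \<psi> x - grad \<psi> z) \<le> e"
        using d(2)[of x z] by (simp add: dist_norm norm_minus_commute)
      then show "onorm ((\<lambda>i. grad \<psi> x \<bullet> i) - (\<lambda>i. grad \<psi> z \<bullet> i)) \<le> e"
        unfolding fun_diff_def
        by (intro onorm_le) (metis Cauchy_Schwarz_ineq2 inner_diff_left mult_right_mono norm_ge_zero
            order_trans real_norm_def)
    qed (use d in auto)
    then show "\<bar>\<psi> (z + h) - \<psi> z - grad \<psi> z \<bullet> h\<bar> \<le> e * norm h" by (simp add: mult.commute)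
  qed
qed

lemma conv_has_derivative:
  assumes f: "integrable lborel f" and "smooth \<psi>" "compact K" "\<And>x. x \<notin> K \<Longrightarrow> \<psi> x = 0"
  shows "(conv f \<psi> has_derivative (\<lambda>h. (LINT y|lborel. f y *\<^sub>R grad \<psi> (x - y)) \<bullet> h)) (at x)"
proof -
  note [measurable] = smooth_borel[OF assms(2)] grad_borel[OF assms(2)]
  have g0: "\<And>x. x \<notin> K \<Longrightarrow> grad \<psi> x = 0"
    using grad_zero_outside[OF compact_imp_closed] assms(3,4) by blast
  obtain B where B: "\<And>x. norm (\<psi> x) \<le> B"
    using compact_support_bounded[OF smooth_continuous[OF assms(2)] assms(3,4)] by blast
  obtain B' where B': "\<And>x. norm (grad \<psi> x) \<le> B'"
    using compact_support_bounded[OF grad_continuous[OF assms(2)] assms(3) g0] by blast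
  have i1: "integrable lborel (\<lambda>y. f y * \<psi> (x - y))" for x
    using integrable_mult_bounded[OF f, of "\<lambda>y. \<psi> (x - y)" B] B by simp
  have i2: "integrable lborel (\<lambda>y. f y *\<^sub>R grad \<psi> (x - y))" for x
    using integrable_mult_bounded[OF f, of "\<lambda>y. grad \<psi> (x - y)" B'] B' by simp
  have i3: "(LINT y|lborel. f y *\<^sub>R grad \<psi> (x - y)) \<bullet> h = (LINT y|lborel. f y * (grad \<psi> (x - y) \<bullet> h))"
    "integrable lborel (\<lambda>y. f y * (grad \<psi> (x - y) \<bullet> h))" for h
    using integral_inner_left[OF i2, of x h] integrable_inner_left[OF i2, of x h] by auto
  show ?thesis
    unfolding has_derivative_at_alt
  proof (intro conjI allI impI)
    show "bounded_linear (\<lambda>h. (LINT y|lborel. f y *\<^sub>R grad \<psi> (x - y)) \<bullet> h)"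
      by (rule bounded_linear_inner_right)
    fix e :: real assume "e > 0"
    \<comment> \<open>The tolerance is divided by \<open>I + 1\<close> rather than \<open>I\<close>,
      so that a null function \<open>f\<close> is covered as well.\<close>
    define I where "I = (LINT y|lborel. \<bar>f y\<bar>)"
    have "I \<ge> 0" unfolding I_def by simp
    then have "e / (I + 1) > 0" using \<open>e > 0\<close> by simp
    from smooth_linearization[OF assms(2-4) this]
    obtain d where d: "d > 0" "\<And>z h. norm h < d \<Longrightarrow>
        \<bar>\<psi> (z + h) - \<psi> z - grad \<psi> z \<bullet> h\<bar> \<le> e / (I + 1) * norm h" by blast
    show "\<exists>d>0. \<forall>y. norm (y - x) < d \<longrightarrow>
      norm (conv f \<psi> y - conv f \<psi> x - (LINT y|lborel. f y *\<^sub>R grad \<psi> (x - y)) \<bullet> (y - x)) \<le> e * norm (y - x)"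
    proof (intro exI conjI allI impI, rule d(1))
      fix y assume y: "norm (y - x) < d"
      define h where "h = y - x"
      have "conv f \<psi> y - conv f \<psi> x - (LINT y|lborel. f y *\<^sub>R grad \<psi> (x - y)) \<bullet> (y - x)
        = (LINT z|lborel. f z * (\<psi> (y - z) - \<psi> (x - z) - grad \<psi> (x - z) \<bullet> h))"
        unfolding conv_def i3 h_def[symmetric]
        by (simp add: right_diff_distrib i1 i3)
      also have "norm \<dots> \<le> (LINT z|lborel. \<bar>f z\<bar> * (e / (I + 1) * norm h))"
      proof (rule Bochner_Integration.integral_norm_bound_integral)
        show "integrable lborel (\<lambda>z. f z * (\<psi> (y - z) - \<psi> (x - z) - grad \<psi> (x - z) \<bullet> h))"
          using i1[of y] i1[of x] i3(2)[of h] by (simp add: right_diff_distrib)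
        show "integrable lborel (\<lambda>z. \<bar>f z\<bar> * (e / (I + 1) * norm h))" using f by simp
        fix z :: 'a
        have "\<bar>\<psi> (x - z + h) - \<psi> (x - z) - grad \<psi> (x - z) \<bullet> h\<bar> \<le> e / (I + 1) * norm h"
          using d(2) y unfolding h_def by blast
        moreover have "x - z + h = y - z" unfolding h_def by simp
        ultimately have le: "\<bar>\<psi> (y - z) - \<psi> (x - z) - grad \<psi> (x - z) \<bullet> h\<bar> \<le> e / (I + 1) * norm h" by simp
        show "norm (f z * (\<psi> (y - z) - \<psi> (x - z) - grad \<psi> (x - z) \<bullet> h))
            \<le> \<bar>f z\<bar> * (e / (I + 1) * norm h)"
          unfolding real_norm_def abs_mult by (rule mult_left_mono[OF le abs_ge_zero])
      qed
      also have "\<dots> = I * (e / (I + 1) * norm h)" unfolding I_def by simp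
      also have "\<dots> = (I / (I + 1)) * (e * norm h)" by simp
      also have "\<dots> \<le> 1 * (e * norm h)"
        using \<open>I \<ge> 0\<close> \<open>e > 0\<close> by (intro mult_right_mono) (auto simp: field_simps)
      finally show "norm (conv f \<psi> y - conv f \<psi> x - (LINT y|lborel. f y *\<^sub>R grad \<psi> (x - y)) \<bullet> (y - x))
          \<le> e * norm (y - x)" by (simp add: h_def)
    qed
  qed
qed

lemma grad_conv:
  assumes f: "integrable lborel f" and "smooth \<psi>" "compact K" "\<And>x. x \<notin> K \<Longrightarrow> \<psi> x = 0"
  shows "grad (conv f \<psi>) x = (LINT y|lborel. f y *\<^sub>R grad \<psi> (x - y))"
  by (rule grad_eqI[OF conv_has_derivative[OF assms]])

lemma integrable_conv_grad:
  assumes f: "integrable lborel f" and "smooth \<psi>" "compact K" "\<And>x. x \<notin> K \<Longrightarrow> \<psi> x = 0"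
  shows "integrable lborel (\<lambda>y. f y *\<^sub>R grad \<psi> (x - y))"
proof -
  note [measurable] = grad_borel[OF assms(2)]
  have g0: "\<And>x. x \<notin> K \<Longrightarrow> grad \<psi> x = 0"
    using grad_zero_outside[OF compact_imp_closed] assms(3,4) by blast
  obtain B' where B': "\<And>x. norm (grad \<psi> x) \<le> B'"
    using compact_support_bounded[OF grad_continuous[OF assms(2)] assms(3) g0] by blast
  show ?thesis
    using integrable_mult_bounded[OF f, of "\<lambda>y. grad \<psi> (x - y)" B'] B' by simp
qed

lemma pd_conv:
  assumes "integrable lborel f" "smooth \<psi>" "compact K" "\<And>x. x \<notin> K \<Longrightarrow> \<psi> x = 0" "b \<in> Basis"
  shows "pd b (conv f \<psi>) = conv f (pd b \<psi>)"
proof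
  fix x
  have "pd b (conv f \<psi>) x = (LINT y|lborel. f y *\<^sub>R grad \<psi> (x - y)) \<bullet> b"
    using grad_conv[OF assms(1-4)] grad_inner_Basis[OF assms(5)] by metis
  also have "\<dots> = conv f (pd b \<psi>) x"
    unfolding conv_def
    using integral_inner_left[OF integrable_conv_grad[OF assms(1-4)], of b x] assms(5)
    by (simp add: grad_inner_Basis)
  finally show "pd b (conv f \<psi>) x = conv f (pd b \<psi>) x" .
qed

text \<open>Derivatives fall on the kernel. The invariant class therefore keeps \<open>f\<close> and
  the set \<open>K\<close> and lets the kernel range over all smooth functions vanishing off
  \<open>K\<close>.\<close>

lemma smooth_conv:
  assumes f: "integrable lborel f" and "smooth \<psi>" "compact K" "\<And>x. x \<notin> K \<Longrightarrow> \<psi> x = 0"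
  shows "smooth (conv f \<psi>)"
proof (rule smooth_coinduct[where X = "\<lambda>g. \<exists>\<psi>. smooth \<psi> \<and> (\<forall>x. x \<notin> K \<longrightarrow> \<psi> x = 0) \<and> g = conv f \<psi>"])
  fix g x assume "\<exists>\<psi>. smooth \<psi> \<and> (\<forall>x. x \<notin> K \<longrightarrow> \<psi> x = 0) \<and> g = conv f \<psi>"
  then show "g differentiable (at x)"
    using conv_has_derivative[OF f _ assms(3)] unfolding differentiable_def by blast
next
  fix g and b :: 'a assume "\<exists>\<psi>. smooth \<psi> \<and> (\<forall>x. x \<notin> K \<longrightarrow> \<psi> x = 0) \<and> g = conv f \<psi>" and b: "b \<in> Basis"
  then obtain \<psi> where \<psi>: "smooth \<psi>" "\<And>x. x \<notin> K \<Longrightarrow> \<psi> x = 0" "g = conv f \<psi>" by blast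
  have "pd b \<psi> x = 0" if "x \<notin> K" for x
    using grad_zero_outside[OF compact_imp_closed[OF assms(3)] \<psi>(2) that] grad_inner_Basis[OF b, of \<psi> x]
    by simp
  then show "\<exists>\<psi>. smooth \<psi> \<and> (\<forall>x. x \<notin> K \<longrightarrow> \<psi> x = 0) \<and> pd b g = conv f \<psi>"
    using pd_conv[OF f \<psi>(1) assms(3) \<psi>(2) b] \<psi> b smooth_pd by metis
qed (use assms in blast)

section \<open>Test functions\<close>

lemma test_funI:
  assumes "smooth \<psi>" "compact K" "K \<subseteq> A" "\<And>x. x \<notin> K \<Longrightarrow> \<psi> x = 0"
  shows "test_fun A \<psi>"
proof -
  have "tsupport \<psi> \<subseteq> K"
    unfolding tsupport_def using assms(2,4) by (intro closure_minimal) (auto intro: compact_imp_closed)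
  moreover have "closed (tsupport \<psi>)" by (simp add: tsupport_def)
  ultimately show ?thesis
    unfolding test_fun_def using assms compact_Int_closed[of K "tsupport \<psi>"]
    by (auto simp: inf_absorb2)
qed

lemma tsupport_zero: "x \<notin> tsupport \<psi> \<Longrightarrow> \<psi> x = 0"
  using closure_subset[of "{x. \<psi> x \<noteq> 0}"] unfolding tsupport_def by blast

lemma test_fun_smooth: "test_fun A \<psi> \<Longrightarrow> smooth \<psi>"
  by (simp add: test_fun_def)

lemma test_fun_grad_zero: "x \<notin> tsupport \<psi> \<Longrightarrow> grad \<psi> x = 0"
  by (rule grad_zero_outside[of "tsupport \<psi>"]) (auto simp: tsupport_zero, simp add: tsupport_def)

lemma test_fun_bounded: 
  assumes "test_fun A \<psi>" obtains B where "B > 0" "\<And>x. \<bar>\<psi> x\<bar> \<le> B"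
proof -
  have "compact (tsupport \<psi>)" using assms by (simp add: test_fun_def)
  then obtain B where "B > 0" "\<And>x. norm (\<psi> x) \<le> B"
    using compact_support_bounded[of \<psi> "tsupport \<psi>"] smooth_continuous[OF test_fun_smooth[OF assms]]
      tsupport_zero by metis
  then show ?thesis by (intro that[of B]) auto
qed

lemma test_fun_mult_smooth:
  assumes "test_fun A \<psi>" "smooth f" shows "test_fun A (\<lambda>x. \<psi> x * f x)"
  by (rule test_funI[of _ "tsupport \<psi>"])
    (use assms in \<open>simp_all add: test_fun_def smooth_mult tsupport_zero\<close>)

lemma test_fun_integrable:
  assumes "test_fun A \<psi>" "finite_measure M" "sets M = sets borel"
  shows "integrable M \<psi>"
proof -
  obtain B where B: "\<And>x. \<bar>\<psi> x\<bar> \<le> B" using test_fun_bounded[OF assms(1)] by blast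
  have [measurable]: "\<psi> \<in> borel_measurable M"
    using smooth_borel[OF test_fun_smooth[OF assms(1)]] assms(3) by (simp cong: measurable_cong_sets)
  interpret finite_measure M by fact
  show ?thesis by (rule integrable_const_bound[of _ B]) (use B in auto)
qed

section \<open>Averages against the mollifier\<close>

locale mollifier_kernel =
  fixes \<rho> :: "'a::euclidean_space \<Rightarrow> real"
  assumes moll: "mollifier \<rho>"
begin

lemma rho_smooth: "smooth \<rho>" using moll by (simp add: mollifier_def)

lemma eps_smooth: "smooth (moll_eps \<rho> e)"
  using smooth_affine[OF rho_smooth, of "(1 / e) ^ DIM('a)" 0 "1 / e"] unfolding moll_eps_def by simp

lemma eps_borel [measurable]: "moll_eps \<rho> e \<in> borel_measurable borel"
  by (rule smooth_borel[OF eps_smooth])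

lemma eps_nonneg: "e > 0 \<Longrightarrow> moll_eps \<rho> e x \<ge> 0"
  using moll by (simp add: mollifier_def moll_eps_def)

lemma eps_even: "moll_eps \<rho> e (x - y) = moll_eps \<rho> e (y - x)"
proof -
  have "(1 / e) *\<^sub>R (x - y) = - ((1 / e) *\<^sub>R (y - x))" by (simp add: scaleR_diff_right)
  then show ?thesis using moll unfolding mollifier_def moll_eps_def by metis
qed

lemma eps_zero: "e > 0 \<Longrightarrow> norm x \<ge> e \<Longrightarrow> moll_eps \<rho> e x = 0"
  using moll by (simp add: mollifier_def moll_eps_def)

lemma eps_zero_cball: "e > 0 \<Longrightarrow> x \<notin> cball 0 e \<Longrightarrow> moll_eps \<rho> e x = 0"
  by (rule eps_zero) auto

lemma rho_bounded: obtains B where "B > 0" "\<And>x. \<rho> x \<le> B"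
proof -
  obtain B where "B > 0" "\<And>x. norm (\<rho> x) \<le> B"
    using compact_support_bounded[OF smooth_continuous[OF rho_smooth], of "cball 0 1"] moll
    unfolding mollifier_def by auto
  then show ?thesis by (intro that[of B]) (auto simp: abs_le_iff)
qed

lemma eps_bound:
  assumes "\<And>x. \<rho> x \<le> B" "e > 0" shows "moll_eps \<rho> e x \<le> (1 / e) ^ DIM('a) * B"
  unfolding moll_eps_def using assms by (intro mult_left_mono) auto

lemma eps_integral:
  assumes "e > 0"
  shows "(LINT y|lborel. moll_eps \<rho> e (x - y)) = 1" "integrable lborel (\<lambda>y. moll_eps \<rho> e (x - y))"
proof -
  have [measurable]: "\<rho> \<in> borel_measurable borel" by (rule smooth_borel[OF rho_smooth])
  have r: "integrable lborel \<rho>" "(LINT y|lborel. \<rho> y) = 1"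
    using moll unfolding mollifier_def by (auto simp: integrable_completion integral_completion)
  have eq: "(1 / e) *\<^sub>R (x - y) = (1 / e) *\<^sub>R x + (- 1 / e) *\<^sub>R y" for y
    by (simp add: scaleR_diff_right)
  have *: "moll_eps \<rho> e (x - y) = (1 / e) ^ DIM('a) * \<rho> ((1 / e) *\<^sub>R x + (- 1 / e) *\<^sub>R y)" for y
    unfolding moll_eps_def eq ..
  show "(LINT y|lborel. moll_eps \<rho> e (x - y)) = 1"
    using integral_affine(1)[of \<rho> "- 1 / e" "(1 / e) *\<^sub>R x"] assms r by (simp add: *)
  show "integrable lborel (\<lambda>y. moll_eps \<rho> e (x - y))"
    using integral_affine(2)[of \<rho> "- 1 / e" "(1 / e) *\<^sub>R x"] assms r unfolding * by simp
qed

text \<open>The kernel vanishes off the ball, so a local bound on \<open>f\<close> suffices. This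
  admits functions that are not integrable themselves, such as the indicator of the complement of a
  bounded set.\<close>

lemma conv_eps_integrable:
  assumes e: "e > 0" and [measurable]: "f \<in> borel_measurable borel" and b: "\<And>y. y \<in> ball x e \<Longrightarrow> \<bar>f y\<bar> \<le> B"
  shows "integrable lborel (\<lambda>y. f y * moll_eps \<rho> e (x - y))"
proof (rule Bochner_Integration.integrable_bound[of _ "\<lambda>y. B * moll_eps \<rho> e (x - y)"])
  show "integrable lborel (\<lambda>y. B * moll_eps \<rho> e (x - y))" using eps_integral[OF e] by simp
  have "\<bar>f y\<bar> * moll_eps \<rho> e (x - y) \<le> \<bar>B\<bar> * moll_eps \<rho> e (x - y)" for y
  proof (cases "y \<in> ball x e")
    case True then show ?thesis using b[OF True] eps_nonneg[OF e] by (intro mult_right_mono) auto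
  next
    case False then show ?thesis using eps_zero[OF e, of "x - y"] by (simp add: dist_norm)
  qed
  then show "AE y in lborel. norm (f y * moll_eps \<rho> e (x - y)) \<le> norm (B * moll_eps \<rho> e (x - y))"
    using eps_nonneg[OF e] by (simp add: abs_mult)
qed measurable

text \<open>The kernel is a probability density supported in the ball, so the convolution is an
  average of the values of \<open>f\<close> there. Constancy on balls, closeness to \<open>f\<close>
  and all cutoff properties are instances.\<close>

lemma conv_eps_bounds:
  assumes e: "e > 0" and [measurable]: "f \<in> borel_measurable borel"
    and b: "\<And>y. y \<in> ball x e \<Longrightarrow> m \<le> f y" "\<And>y. y \<in> ball x e \<Longrightarrow> f y \<le> M"
  shows "m \<le> conv f (moll_eps \<rho> e) x" "conv f (moll_eps \<rho> e) x \<le> M"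
proof -
  have bd: "\<bar>f y\<bar> \<le> \<bar>m\<bar> + \<bar>M\<bar>" if "y \<in> ball x e" for y using b[OF that] by linarith
  note int = conv_eps_integrable[OF e assms(2) bd] eps_integral[OF e]
  have 1: "m * moll_eps \<rho> e (x - y) \<le> f y * moll_eps \<rho> e (x - y) \<and> f y * moll_eps \<rho> e (x - y) \<le> M * moll_eps \<rho> e (x - y)" for y
  proof (cases "y \<in> ball x e")
    case True then show ?thesis using b[OF True] eps_nonneg[OF e] by (auto intro!: mult_right_mono)
  next
    case False then show ?thesis using eps_zero[OF e, of "x - y"] by (simp add: dist_norm)
  qed
  have "(LINT y|lborel. m * moll_eps \<rho> e (x - y)) \<le> conv f (moll_eps \<rho> e) x"
    unfolding conv_def using int 1 by (intro integral_mono) auto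
  then show "m \<le> conv f (moll_eps \<rho> e) x" using eps_integral[OF e] by simp
  have "conv f (moll_eps \<rho> e) x \<le> (LINT y|lborel. M * moll_eps \<rho> e (x - y))"
    unfolding conv_def using int 1 by (intro integral_mono) auto
  then show "conv f (moll_eps \<rho> e) x \<le> M" using eps_integral[OF e] by simp
qed

lemma conv_eps_const:
  assumes e: "e > 0" and "f \<in> borel_measurable borel" and b: "\<And>y. y \<in> ball x e \<Longrightarrow> f y = c"
  shows "conv f (moll_eps \<rho> e) x = c"
  using conv_eps_bounds[OF assms(1,2), of x c c] b by (simp add: order_antisym)

lemma conv_eps_close:
  assumes e: "e > 0" and "f \<in> borel_measurable borel" and b: "\<And>y. y \<in> ball x e \<Longrightarrow> \<bar>f y - f x\<bar> \<le> d"
  shows "\<bar>conv f (moll_eps \<rho> e) x - f x\<bar> \<le> d"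
proof -
  have "f x - d \<le> f y" "f y \<le> f x + d" if "y \<in> ball x e" for y using b[OF that] by linarith+
  then show ?thesis
    using conv_eps_bounds[OF assms(1,2), of x "f x - d" "f x + d"] by (simp add: abs_le_iff)
qed

lemma smooth_conv_eps:
  "e > 0 \<Longrightarrow> integrable lborel f \<Longrightarrow> smooth (conv f (moll_eps \<rho> e))"
  by (rule smooth_conv[of _ _ "cball 0 e"]) (auto simp: eps_smooth eps_zero)

section \<open>Density of test functions in \<open>L^1\<close> of a finite Borel measure\<close>

lemma integrable_indicator_bounded:
  fixes A :: "'c::euclidean_space set"
  assumes "A \<in> sets borel" "bounded A" shows "integrable lborel (indicat_real A)"
  using assms emeasure_bounded_finite[OF assms(2)] by simp

lemma test_cutoff_open:
  fixes U :: "'a set"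
  assumes "open U"
  obtains \<psi> where "\<And>n. test_fun UNIV (\<psi> n)" "\<And>n x. 0 \<le> \<psi> n x" "\<And>n x. \<psi> n x \<le> 1"
    "\<And>x. (\<lambda>n. \<psi> n x) \<longlonglongrightarrow> indicator U x"
proof -
  define r where "r n = 1 / real (Suc n)" for n
  have r: "r n > 0" for n by (simp add: r_def)
  \<comment> \<open>Removing the \<open>r n\<close>-neighbourhood of the complement makes the
    mollification at scale \<open>r n\<close> vanish off \<open>U\<close>; intersecting with a
    growing ball makes its support compact.\<close>
  define V where "V n = ball 0 (real n) - (\<Union>y\<in>-U. ball y (r n))" for n
  define \<psi> where "\<psi> n = conv (indicator (V n)) (moll_eps \<rho> (r n))" for n
  have Vb [measurable]: "V n \<in> sets borel" for n
    unfolding V_def by (intro sets.Diff borel_open) auto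
  have Vbd: "bounded (V n)" for n
    unfolding V_def by (rule bounded_subset[of "ball 0 (real n)"]) auto
  show ?thesis
  proof (rule that)
    fix n
    show "test_fun UNIV (\<psi> n)"
    proof (rule test_funI[of _ "cball 0 (real n + r n)"])
      show "smooth (\<psi> n)" unfolding \<psi>_def
        by (intro smooth_conv_eps r integrable_indicator_bounded Vb Vbd)
      fix x :: 'a assume x: "x \<notin> cball 0 (real n + r n)"
      have "indicat_real (V n) y = 0" if "y \<in> ball x (r n)" for y
      proof -
        have "norm x \<le> norm y + dist x y" unfolding dist_norm by (rule norm_triangle_sub)
        then have "norm y > real n" using x that by auto
        then show ?thesis by (simp add: V_def)
      qed
      then show "\<psi> n x = 0" unfolding \<psi>_def by (intro conv_eps_const r) auto
    qed auto
    fix x show "0 \<le> \<psi> n x" "\<psi> n x \<le> 1"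
      unfolding \<psi>_def using conv_eps_bounds[OF r[of n], of "indicator (V n)" x 0 1] by auto
  next
    fix x
    show "(\<lambda>n. \<psi> n x) \<longlonglongrightarrow> indicator U x"
    proof (cases "x \<in> U")
      case False
      have "\<psi> n x = 0" for n
        unfolding \<psi>_def
      proof (intro conv_eps_const r)
        fix y assume "y \<in> ball x (r n)"
        then show "indicat_real (V n) y = 0" using False by (auto simp: V_def indicator_def)
      qed measurable
      then show ?thesis using False by simp
    next
      case True
      then obtain d where d: "d > 0" "ball x d \<subseteq> U" using assms open_contains_ball by blast
      have "r \<longlonglongrightarrow> 0" unfolding r_def by (rule LIMSEQ_Suc[OF lim_const_over_n[of 1, simplified]])
      then have "\<forall>\<^sub>F n in sequentially. r n < d / 2" using d by (intro order_tendstoD(2)) auto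
      moreover have "\<forall>\<^sub>F n in sequentially. real n > norm x + 1"
        using filterlim_real_sequentially filterlim_at_top_dense by blast
      ultimately have "\<forall>\<^sub>F n in sequentially. \<psi> n x = 1"
      proof eventually_elim
        case (elim n)
        have "indicat_real (V n) y = 1" if y: "y \<in> ball x (r n)" for y
        proof -
          have "r n \<le> 1" by (simp add: r_def)
          have "norm y \<le> norm x + dist x y" unfolding dist_norm by (metis norm_minus_commute norm_triangle_sub)
          then have "norm y < real n" using elim y \<open>r n \<le> 1\<close> by auto
          moreover have "dist z y \<ge> r n" if "z \<notin> U" for z
          proof -
            have "dist x z \<ge> d" using that d by (auto simp: subset_iff not_less)
            moreover have "dist x z \<le> dist x y + dist z y" by (metis dist_commute dist_triangle)
            ultimately show ?thesis using y elim by auto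
          qed
          ultimately show ?thesis by (auto simp: V_def indicator_def not_less)
        qed
        then show ?case unfolding \<psi>_def by (intro conv_eps_const r) auto
      qed
      then show ?thesis using True by (simp add: tendsto_eventually)
    qed
  qed
qed

text \<open>The approximable sets form a Dynkin system containing the open sets.\<close>

lemma test_fun_dense:
  fixes f :: "'a \<Rightarrow> real"
  assumes fin: "finite_measure M" and sets: "sets M = sets borel" and f: "integrable M f" and "d > 0"
  obtains \<psi> where "test_fun UNIV \<psi>" "(LINT x|M. \<bar>f x - \<psi> x\<bar>) < d"
proof -
  interpret finite_measure M by fact
  note ti = test_fun_integrable[OF _ fin sets]
  \<comment> \<open>Closedness of this class under sums, multiples and dominated pointwise limits
    serves both inductions, over Borel sets and then over integrable functions.\<close>
  define P where "P f \<longleftrightarrow> integrable M f \<and> (\<forall>e>0. \<exists>\<psi>. test_fun UNIV \<psi> \<and> (LINT x|M. \<bar>f x - \<psi> x\<bar>) < e)" for f :: "'a \<Rightarrow> real"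
  have close: "P f" if if1: "integrable M f" and if2: "\<And>n. P (s n)" and if3: "(\<lambda>n. LINT x|M. \<bar>f x - s n x\<bar>) \<longlonglongrightarrow> 0" for f s
    unfolding P_def
  proof (intro conjI allI impI if1)
    fix e :: real assume "e > 0"
    then have "\<forall>\<^sub>F n in sequentially. (LINT x|M. \<bar>f x - s n x\<bar>) < e / 2"
      using if3 by (intro order_tendstoD) auto
    then obtain n where n: "(LINT x|M. \<bar>f x - s n x\<bar>) < e / 2"
      using eventually_happens'[OF sequentially_bot] by blast
    obtain \<psi> where \<psi>: "test_fun UNIV \<psi>" "(LINT x|M. \<bar>s n x - \<psi> x\<bar>) < e / 2" and s: "integrable M (s n)"
      using if2[of n] \<open>e > 0\<close> unfolding P_def by (meson half_gt_zero)
    have "(LINT x|M. \<bar>f x - \<psi> x\<bar>) \<le> (LINT x|M. \<bar>f x - s n x\<bar> + \<bar>s n x - \<psi> x\<bar>)"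
      using if1 s ti[OF \<psi>(1)] by (intro integral_mono) auto
    also have "\<dots> = (LINT x|M. \<bar>f x - s n x\<bar>) + (LINT x|M. \<bar>s n x - \<psi> x\<bar>)"
      using if1 s ti[OF \<psi>(1)] by (intro Bochner_Integration.integral_add) auto
    finally show "\<exists>\<psi>. test_fun UNIV \<psi> \<and> (LINT x|M. \<bar>f x - \<psi> x\<bar>) < e"
      using n \<psi> by (intro exI[of _ \<psi>]) auto
  qed
  have dct: "P f" if "integrable M f" "\<And>n. P (s n)" "\<And>x. (\<lambda>n. s n x) \<longlonglongrightarrow> f x"
    "integrable M w" "\<And>n x. \<bar>s n x\<bar> \<le> w x" for f s w
  proof (rule close[OF that(1,2)])
    have [measurable]: "f \<in> borel_measurable M" "\<And>n. s n \<in> borel_measurable M"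
      using that(1,2) unfolding P_def by auto
    have "(\<lambda>n. LINT x|M. \<bar>f x - s n x\<bar>) \<longlonglongrightarrow> (LINT x|M. 0)"
    proof (rule integral_dominated_convergence[where w = "\<lambda>x. \<bar>f x\<bar> + w x"])
      show "integrable M (\<lambda>x. \<bar>f x\<bar> + w x)" using that(1,4) by auto
      have "(\<lambda>n. \<bar>f x - s n x\<bar>) \<longlonglongrightarrow> \<bar>f x - f x\<bar>" for x
        by (intro tendsto_intros that)
      then show "AE x in M. (\<lambda>n. \<bar>f x - s n x\<bar>) \<longlonglongrightarrow> 0" by simp
      show "AE x in M. norm \<bar>f x - s n x\<bar> \<le> \<bar>f x\<bar> + w x" for n
        using that(5)[of n] by (auto intro!: AE_I2 order_trans[OF abs_triangle_ineq4] add_left_mono)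
    qed auto
    then show "(\<lambda>n. LINT x|M. \<bar>f x - s n x\<bar>) \<longlonglongrightarrow> 0" by simp
  qed
  have Ptest: "P \<psi>" if "test_fun UNIV \<psi>" for \<psi>
    unfolding P_def using that ti by (auto intro!: exI[of _ \<psi>])
  have Padd: "P (\<lambda>x. f x + g x)" if Pf: "P f" and Pg: "P g" for f g
    unfolding P_def
  proof (intro conjI allI impI)
    show "integrable M (\<lambda>x. f x + g x)" using Pf Pg unfolding P_def by auto
    fix e :: real assume "e > 0"
    obtain p where p: "test_fun UNIV p" "(LINT x|M. \<bar>f x - p x\<bar>) < e / 2"
      using Pf \<open>e > 0\<close> unfolding P_def by (meson half_gt_zero)
    obtain q where q: "test_fun UNIV q" "(LINT x|M. \<bar>g x - q x\<bar>) < e / 2"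
      using Pg \<open>e > 0\<close> unfolding P_def by (meson half_gt_zero)
    have fg: "integrable M f" "integrable M g" using Pf Pg unfolding P_def by auto
    have t: "test_fun UNIV (\<lambda>x. p x + q x)"
    proof (rule test_funI[of _ "tsupport p \<union> tsupport q"])
      show "smooth (\<lambda>x. p x + q x)" using p q by (auto simp: test_fun_def intro: smooth_add)
      show "compact (tsupport p \<union> tsupport q)" using p q by (auto simp: test_fun_def)
    qed (auto simp: tsupport_zero)
    have "(LINT x|M. \<bar>f x + g x - (p x + q x)\<bar>) \<le> (LINT x|M. \<bar>f x - p x\<bar> + \<bar>g x - q x\<bar>)"
      using fg ti[OF p(1)] ti[OF q(1)] by (intro integral_mono) auto
    also have "\<dots> = (LINT x|M. \<bar>f x - p x\<bar>) + (LINT x|M. \<bar>g x - q x\<bar>)"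
      using fg ti[OF p(1)] ti[OF q(1)] by (intro Bochner_Integration.integral_add) auto
    finally show "\<exists>\<psi>. test_fun UNIV \<psi> \<and> (LINT x|M. \<bar>f x + g x - \<psi> x\<bar>) < e"
      using p q t by (intro exI[of _ "\<lambda>x. p x + q x"]) auto
  qed
  have Pscale: "P (\<lambda>x. c * f x)" if Pf: "P f" for f c
    unfolding P_def
  proof (intro conjI allI impI)
    show "integrable M (\<lambda>x. c * f x)" using that unfolding P_def by auto
    fix e :: real assume "e > 0"
    then have "e / (\<bar>c\<bar> + 1) > 0" by simp
    then obtain p where p: "test_fun UNIV p" "(LINT x|M. \<bar>f x - p x\<bar>) < e / (\<bar>c\<bar> + 1)"
      using Pf unfolding P_def by meson
    have t: "test_fun UNIV (\<lambda>x. p x * c)" by (rule test_fun_mult_smooth[OF p(1) smooth_const])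
    have "(LINT x|M. \<bar>c * f x - p x * c\<bar>) = \<bar>c\<bar> * (LINT x|M. \<bar>f x - p x\<bar>)"
      by (simp add: abs_mult mult.commute[of _ c] flip: right_diff_distrib)
    also have "\<dots> \<le> (\<bar>c\<bar> + 1) * (LINT x|M. \<bar>f x - p x\<bar>)"
      by (intro mult_right_mono) auto
    also have "\<dots> < e" using p(2) by (simp add: field_simps add_pos_nonneg)
    finally show "\<exists>\<psi>. test_fun UNIV \<psi> \<and> (LINT x|M. \<bar>c * f x - \<psi> x\<bar>) < e"
      using t by blast
  qed
  have Popen: "P (indicat_real U)" if U: "open U" for U
  proof -
    obtain \<psi> where \<psi>: "\<And>n. test_fun UNIV (\<psi> n)" "\<And>n x. 0 \<le> \<psi> n x" "\<And>n x. \<psi> n x \<le> 1"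
      "\<And>x. (\<lambda>n. \<psi> n x) \<longlonglongrightarrow> indicator U x"
      using test_cutoff_open[OF U] by blast
    show ?thesis
      by (rule dct[of _ \<psi> "\<lambda>x. 1"]) (use \<psi> Ptest U sets in \<open>auto simp: emeasure_finite less_top[symmetric]\<close>)
  qed
  have Pset: "P (indicat_real A)" if "A \<in> sets borel" for A
  proof -
    have "A \<in> sigma_sets UNIV {S. open S}" using that by (simp add: borel_def)
    then show ?thesis
    proof (induction rule: sigma_sets_induct_disjoint[rotated 2, consumes 1, case_names basic empty compl union])
      case (basic A) then show ?case using Popen by simp
    next
      case empty then show ?case by (rule Popen) simp
    next
      case (compl A)
      have "P (\<lambda>x. indicator UNIV x + (-1) * indicator A x)"
        by (intro Padd Pscale compl Popen) auto
      moreover have "(\<lambda>x. indicator UNIV x + (-1) * indicator A x) = indicat_real (UNIV - A)"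
        by (auto simp: indicator_def)
      ultimately show ?case by simp
    next
      case (union A)
      have A: "A n \<in> sets M" for n
        using union(2) sets by (auto simp: borel_def)
      have fin: "P (indicat_real (\<Union>i<n. A i))" for n
      proof (induction n)
        case 0
        have "(\<Union>i<0. A i) = {}" by simp
        then show ?case by (metis Popen open_empty)
      next
        case (Suc n)
        have "P (\<lambda>x. indicator (\<Union>i<n. A i) x + indicator (A n) x)" by (intro Padd Suc union)
        moreover have "(\<lambda>x. indicator (\<Union>i<n. A i) x + indicator (A n) x) = indicat_real (\<Union>i<Suc n. A i)"
        proof
          fix x
          have "(\<Union>i<n. A i) \<inter> A n = {}"
          proof -
            have "A i \<inter> A n = {}" if "i < n" for i
              using disjoint_family_onD[OF union(1), of i n] that by simp
            then show ?thesis by blast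
          qed
          moreover have "(\<Union>i<Suc n. A i) = (\<Union>i<n. A i) \<union> A n" by (auto simp: lessThan_Suc)
          ultimately show "indicator (\<Union>i<n. A i) x + indicator (A n) x = indicat_real (\<Union>i<Suc n. A i) x"
            by (simp only: indicator_add)
        qed
        ultimately show ?case by simp
      qed
      show ?case
      proof (rule dct[where s = "\<lambda>n. indicat_real (\<Union>i<n. A i)" and w = "\<lambda>x. 1"])
        show "integrable M (indicat_real (\<Union> (range A)))"
          using A by (auto simp: emeasure_finite less_top[symmetric])
        show "(\<lambda>n. indicat_real (\<Union>i<n. A i) x) \<longlonglongrightarrow> indicat_real (\<Union> (range A)) x" for x
          by (rule LIMSEQ_indicator_UN)
      qed (use fin in auto)
    qed (auto simp: Int_stable_def)
  qed
  have "P f" using f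
  proof (induction rule: integrable_induct)
    case (base A c)
    then show ?case using Pscale[OF Pset, of A c] sets by (simp add: mult.commute)
  next
    case (add f g) then show ?case by (intro Padd)
  next
    case (lim f s)
    have sp: "space M = UNIV" using sets_eq_imp_space_eq[OF sets] by simp
    show ?case
      by (rule dct[of f s "\<lambda>x. 2 * norm (f x)"]) (use lim sp in auto)
  qed
  then show ?thesis using \<open>d > 0\<close> that unfolding P_def by blast
qed

end

section \<open>Mollified sets of finite perimeter\<close>

text \<open>\<open>E\<close> is taken Borel and not merely Lebesgue measurable: under the convention
  that \<open>E\<close> consists of its points of density one and its measure-theoretic boundary it
  is a union of two Borel sets.\<close>

locale fp_set = mollifier_kernel \<rho> for \<rho> :: "'a::euclidean_space \<Rightarrow> real" +
  fixes E :: "'a set" and \<mu> :: "'a measure" and \<sigma> :: "'a \<Rightarrow> 'a"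
  assumes gg: "gauss_green E \<mu> \<sigma>" and E_borel [measurable]: "E \<in> sets borel" and E_bounded: "bounded E"
begin

lemma sets_mu [measurable_cong, simp]: "sets \<mu> = sets borel"
  using gg by (simp add: gauss_green_def)

lemma space_mu [simp]: "space \<mu> = UNIV"
  using sets_eq_imp_space_eq[OF sets_mu] by simp

lemma sigma_borel [measurable]: "\<sigma> \<in> borel_measurable borel"
  using gg by (simp add: gauss_green_def)

lemma norm_sigma [simp]: "norm (\<sigma> x) = 1"
  using gg by (simp add: gauss_green_def)

sublocale finite_measure \<mu>
  using gg by (intro finite_measureI) (auto simp: gauss_green_def)

lemma sigma_inner_le: "\<bar>\<sigma> x \<bullet> b\<bar> \<le> norm b"
  using Cauchy_Schwarz_ineq2[of "\<sigma> x" b] by simp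

lemma integrable_bounded_mu:
  fixes f :: "'a \<Rightarrow> 'b::{banach,second_countable_topology}"
  assumes "f \<in> borel_measurable borel" "\<And>x. norm (f x) \<le> B" shows "integrable \<mu> f"
  by (rule integrable_const_bound[of _ B]) (use assms in auto)

section \<open>The mollified characteristic function and its gradient\<close>

definition u :: "real \<Rightarrow> 'a \<Rightarrow> real" where
  "u e = conv (indicator E) (moll_eps \<rho> e)"

lemma integrable_E: "integrable lborel (indicat_real E)"
  by (rule integrable_indicator_bounded[OF E_borel E_bounded])

lemma u_smooth: "e > 0 \<Longrightarrow> smooth (u e)"
  unfolding u_def by (rule smooth_conv_eps[OF _ integrable_E])

lemma u_bounds:
  assumes "e > 0" shows "0 \<le> u e x" "u e x \<le> 1"
  unfolding u_def using conv_eps_bounds[OF assms, of "indicator E" x 0 1] by auto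

lemma u_abs_le: "e > 0 \<Longrightarrow> \<bar>u e x\<bar> \<le> 1"
  using u_bounds[of e x] by simp

lemma u_zero:
  assumes "e > 0" "E \<inter> ball x e = {}" shows "u e x = 0"
  unfolding u_def by (rule conv_eps_const) (use assms in \<open>auto simp: indicator_def\<close>)

lemma moll_char_eq_u: "moll_char \<rho> E k = u (1 / real k)"
  unfolding moll_char_def u_def conv_def by (intro ext integral_completion) measurable

lemma gg_scalar:
  assumes "test_fun UNIV \<phi>" "b \<in> Basis"
  shows "(LINT x|lborel. indicator E x * pd b \<phi> x) = - (LINT x|\<mu>. \<phi> x * (\<sigma> x \<bullet> b))"
proof -
  define \<Phi> where "\<Phi> x = \<phi> x *\<^sub>R b" for x
  have sm: "smooth \<phi>" using assms(1) by (rule test_fun_smooth)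
  have [measurable]: "pd b \<phi> \<in> borel_measurable borel" by (rule smooth_borel[OF smooth_pd[OF sm assms(2)]])
  have "tsupport \<Phi> = tsupport \<phi>"
    unfolding tsupport_def \<Phi>_def using assms(2) by (auto simp: nonzero_Basis)
  then have vt: "vtest_field \<Phi>"
    unfolding vtest_field_def using assms(1)
    by (auto simp: \<Phi>_def test_fun_def intro!: smooth_mult smooth_const)
  have "vdiv \<Phi> x = pd b \<phi> x" for x
  proof -
    have "frechet_derivative (\<lambda>y. \<Phi> y \<bullet> c) (at x) c = (if c = b then pd b \<phi> x else 0)" if "c \<in> Basis" for c
    proof (cases "c = b")
      case True
      then have "(\<lambda>y. \<Phi> y \<bullet> c) = \<phi>" using assms(2) by (auto simp: \<Phi>_def)
      then show ?thesis using True by (simp add: pd_def)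
    next
      case False
      then have "(\<lambda>y. \<Phi> y \<bullet> c) = (\<lambda>y. 0)" using assms(2) that by (auto simp: \<Phi>_def inner_Basis)
      then show ?thesis using False by simp
    qed
    then show ?thesis using assms(2) by (simp add: vdiv_def)
  qed
  then have "(LINT x:E|lebesgue. vdiv \<Phi> x) = (LINT x|lborel. indicator E x * pd b \<phi> x)"
    unfolding set_lebesgue_integral_def by (simp add: integral_completion)
  moreover have "(LINT x:E|lebesgue. vdiv \<Phi> x) = - (LINT x|\<mu>. \<Phi> x \<bullet> \<sigma> x)"
    using gg vt unfolding gauss_green_def by blast
  ultimately show ?thesis by (simp add: \<Phi>_def inner_commute)
qed

lemma integrable_kernel_mu:
  assumes "e > 0"
  shows "integrable \<mu> (\<lambda>y. moll_eps \<rho> e (x - y))" "integrable \<mu> (\<lambda>y. moll_eps \<rho> e (x - y) *\<^sub>R \<sigma> y)"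
proof -
  obtain B where B: "B > 0" "\<And>x. \<rho> x \<le> B" using rho_bounded by blast
  have "norm (moll_eps \<rho> e (x - y)) \<le> (1 / e) ^ DIM('a) * B" for y
    using eps_bound[OF B(2) assms, of "x - y"] eps_nonneg[OF assms, of "x - y"] by simp
  then show "integrable \<mu> (\<lambda>y. moll_eps \<rho> e (x - y))" "integrable \<mu> (\<lambda>y. moll_eps \<rho> e (x - y) *\<^sub>R \<sigma> y)"
    by (auto intro!: integrable_bounded_mu)
qed

text \<open>Seen as a function of \<open>y\<close>, the kernel changes sign under differentiation,
  which cancels the minus sign of the Gauss-Green formula. The gradient of \<open>u e\<close> is
  thus the mollification of the vector measure \<open>\<sigma> \<mu>\<close>.\<close>

lemma pd_u:
  assumes e: "e > 0" and b: "b \<in> Basis"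
  shows "pd b (u e) x = (LINT y|\<mu>. moll_eps \<rho> e (x - y) * (\<sigma> y \<bullet> b))"
proof -
  define \<phi> where "\<phi> y = moll_eps \<rho> e (x - y)" for y
  have \<phi>: "\<phi> = (\<lambda>y. 1 * moll_eps \<rho> e (x + (-1) *\<^sub>R y))" by (auto simp: \<phi>_def)
  have "pd b \<phi> = (\<lambda>y. - pd b (moll_eps \<rho> e) (x - y))"
    unfolding \<phi> by (subst pd_affine) (auto intro: smooth_differentiable eps_smooth)
  moreover have "test_fun UNIV \<phi>"
  proof (rule test_funI[of _ "cball x e"])
    show "smooth \<phi>" unfolding \<phi> by (intro smooth_affine eps_smooth)
    show "\<phi> y = 0" if "y \<notin> cball x e" for y
      using that e eps_zero[of e "x - y"] by (auto simp: \<phi>_def dist_norm)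
  qed auto
  ultimately have "(LINT y|lborel. indicator E y * - pd b (moll_eps \<rho> e) (x - y)) = - (LINT y|\<mu>. \<phi> y * (\<sigma> y \<bullet> b))"
    using gg_scalar[OF _ b] by metis
  moreover have "pd b (u e) = conv (indicator E) (pd b (moll_eps \<rho> e))"
    unfolding u_def by (rule pd_conv[OF integrable_E eps_smooth compact_cball[of 0 e] eps_zero_cball[OF e] b])
  ultimately show ?thesis by (simp add: conv_def \<phi>_def)
qed

lemma grad_u:
  assumes "e > 0"
  shows "grad (u e) x = (LINT y|\<mu>. moll_eps \<rho> e (x - y) *\<^sub>R \<sigma> y)"
proof (rule euclidean_eqI)
  fix b :: 'a assume b: "b \<in> Basis"
  show "grad (u e) x \<bullet> b = (LINT y|\<mu>. moll_eps \<rho> e (x - y) *\<^sub>R \<sigma> y) \<bullet> b"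
    using integral_inner_left[OF integrable_kernel_mu(2)[OF assms], of x b] pd_u[OF assms b]
    by (simp add: grad_inner_Basis b)
qed

lemma norm_grad_u_le:
  assumes "e > 0"
  shows "ennreal (norm (grad (u e) x)) \<le> (\<integral>\<^sup>+y. ennreal (moll_eps \<rho> e (x - y)) \<partial>\<mu>)"
proof -
  have "norm (grad (u e) x) \<le> (LINT y|\<mu>. norm (moll_eps \<rho> e (x - y) *\<^sub>R \<sigma> y))"
    unfolding grad_u[OF assms] by (rule integral_norm_bound)
  also have "\<dots> = (LINT y|\<mu>. moll_eps \<rho> e (x - y))"
    using eps_nonneg[OF assms] by simp
  finally have "ennreal (norm (grad (u e) x)) \<le> ennreal (LINT y|\<mu>. moll_eps \<rho> e (x - y))"
    by (rule ennreal_leI)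
  also have "\<dots> = (\<integral>\<^sup>+y. ennreal (moll_eps \<rho> e (x - y)) \<partial>\<mu>)"
    using eps_nonneg[OF assms] integrable_kernel_mu(1)[OF assms]
    by (intro nn_integral_eq_integral[symmetric]) auto
  finally show ?thesis .
qed

lemma pair_sigma_finite_lborel_mu: "pair_sigma_finite (lborel :: 'a measure) \<mu>"
  by unfold_locales

text \<open>By Tonelli the measure \<open>|\<nabla>u| dx\<close> is dominated by a mollification of
  \<open>\<mu>\<close>, which displaces mass by less than \<open>e\<close>. A weight
  \<open>h\<close> may therefore be exchanged for any \<open>H\<close> that dominates it at distance
  less than \<open>e\<close>: the indicator of a larger ball, or \<open>|\<psi>| + d\<close> for a
  uniformly continuous \<open>\<psi>\<close>.\<close>

lemma grad_mass:
  assumes e: "e > 0" and [measurable]: "h \<in> borel_measurable borel" "H \<in> borel_measurable borel"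
    and le: "\<And>x y. dist x y < e \<Longrightarrow> h x \<le> (H y :: ennreal)"
  shows "(\<integral>\<^sup>+x. h x * ennreal (norm (grad (u e) x)) \<partial>lborel) \<le> (\<integral>\<^sup>+y. H y \<partial>\<mu>)"
proof -
  interpret P: pair_sigma_finite "lborel :: 'a measure" \<mu> by (rule pair_sigma_finite_lborel_mu)
  have "(\<integral>\<^sup>+x. h x * ennreal (norm (grad (u e) x)) \<partial>lborel)
      \<le> (\<integral>\<^sup>+x. h x * (\<integral>\<^sup>+y. ennreal (moll_eps \<rho> e (x - y)) \<partial>\<mu>) \<partial>lborel)"
    by (intro nn_integral_mono mult_left_mono norm_grad_u_le e) auto
  also have "\<dots> = (\<integral>\<^sup>+x. (\<integral>\<^sup>+y. h x * ennreal (moll_eps \<rho> e (x - y)) \<partial>\<mu>) \<partial>lborel)"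
    by (simp add: nn_integral_cmult)
  also have "\<dots> = (\<integral>\<^sup>+y. (\<integral>\<^sup>+x. h x * ennreal (moll_eps \<rho> e (x - y)) \<partial>lborel) \<partial>\<mu>)"
    by (rule P.Fubini'[symmetric]) measurable
  also have "\<dots> \<le> (\<integral>\<^sup>+y. H y \<partial>\<mu>)"
  proof (rule nn_integral_mono)
    fix y
    have "(\<integral>\<^sup>+x. h x * ennreal (moll_eps \<rho> e (x - y)) \<partial>lborel) \<le> (\<integral>\<^sup>+x. H y * ennreal (moll_eps \<rho> e (y - x)) \<partial>lborel)"
    proof (rule nn_integral_mono)
      fix x show "h x * ennreal (moll_eps \<rho> e (x - y)) \<le> H y * ennreal (moll_eps \<rho> e (y - x))"
      proof (cases "dist x y < e")
        case True then show ?thesis using le by (simp add: eps_even[of e x y] mult_right_mono)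
      next
        case False then show ?thesis using eps_zero[OF e, of "x - y"] by (simp add: dist_norm)
      qed
    qed
    also have "\<dots> = H y * ennreal (LINT x|lborel. moll_eps \<rho> e (y - x))"
      using eps_integral[OF e, of y] eps_nonneg[OF e] by (simp add: nn_integral_cmult nn_integral_eq_integral)
    finally show "(\<integral>\<^sup>+x. h x * ennreal (moll_eps \<rho> e (x - y)) \<partial>lborel) \<le> H y"
      using eps_integral[OF e, of y] by simp
  qed
  finally show ?thesis .
qed

text \<open>The shift of the index is the one in \<open>interior_normal_trace\<close> and keeps the
  scale finite and positive.\<close>

definition U :: "nat \<Rightarrow> 'a \<Rightarrow> real" where
  "U k = u (1 / real (Suc k))"

lemma U_smooth: "smooth (U k)" unfolding U_def by (rule u_smooth) simp
lemma U_borel [measurable]: "U k \<in> borel_measurable borel" by (rule smooth_borel[OF U_smooth])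
lemma U_abs_le: "\<bar>U k x\<bar> \<le> 1" unfolding U_def by (rule u_abs_le) simp

lemma inverse_Suc_tendsto: "(\<lambda>k. 1 / real (Suc k)) \<longlonglongrightarrow> 0"
  by (rule LIMSEQ_Suc[OF lim_const_over_n[of 1, simplified]])

lemma eventually_inverse_Suc: "d > 0 \<Longrightarrow> \<forall>\<^sub>F k in sequentially. 1 / real (Suc k) < d"
  using inverse_Suc_tendsto by (rule order_tendstoD(2))

section \<open>Convergence of the mollified functions in \<open>L^1\<close>\<close>

lemma conv_eps_test_close:
  assumes "continuous_on UNIV \<psi>" "compact K" "\<And>x. x \<notin> K \<Longrightarrow> \<psi> x = 0" "d > 0"
  shows "\<forall>\<^sub>F k in sequentially. \<forall>x. \<bar>conv \<psi> (moll_eps \<rho> (1 / real (Suc k))) x - \<psi> x\<bar> \<le> d"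
proof -
  obtain r where r: "r > 0" "\<And>x y. dist x y < r \<Longrightarrow> dist (\<psi> x) (\<psi> y) < d"
    using compact_support_uniformly_continuous[OF assms] by blast
  show ?thesis
    using eventually_inverse_Suc[OF r(1)]
  proof eventually_elim
    case (elim k)
    have "\<bar>\<psi> y - \<psi> x\<bar> \<le> d" if "y \<in> ball x (1 / real (Suc k))" for x y
      using r(2)[of y x] that elim by (simp add: dist_commute dist_real_def del: of_nat_Suc)
    then show ?case
      by (intro allI conv_eps_close borel_measurable_continuous_onI assms) auto
  qed
qed

text \<open>Young's inequality for a kernel of mass one, stated with nonnegative integrals so that
  Tonelli applies before the convolution is known to be integrable. If the integrand at some
  \<open>x\<close> were not integrable, \<open>conv\<close> would be 0 there by convention, so the
  pointwise bound holds everywhere.\<close>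

lemma conv_eps_L1:
  assumes e: "e > 0" and g: "integrable lborel g" and [measurable]: "g \<in> borel_measurable borel"
  shows "(\<integral>\<^sup>+x. ennreal \<bar>conv g (moll_eps \<rho> e) x\<bar> \<partial>lborel) \<le> ennreal (LINT x|lborel. \<bar>g x\<bar>)"
proof -
  have "ennreal \<bar>conv g (moll_eps \<rho> e) x\<bar> \<le> (\<integral>\<^sup>+y. ennreal \<bar>g y\<bar> * ennreal (moll_eps \<rho> e (y - x)) \<partial>lborel)" for x
  proof -
    have "ennreal \<bar>conv g (moll_eps \<rho> e) x\<bar> \<le> (\<integral>\<^sup>+y. ennreal (norm (g y * moll_eps \<rho> e (x - y))) \<partial>lborel)"
    proof (cases "integrable lborel (\<lambda>y. g y * moll_eps \<rho> e (x - y))")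
      case True
      then show ?thesis unfolding conv_def using integral_norm_bound_ennreal by fastforce
    qed (simp add: conv_def not_integrable_integral_eq)
    also have "\<dots> = (\<integral>\<^sup>+y. ennreal \<bar>g y\<bar> * ennreal (moll_eps \<rho> e (y - x)) \<partial>lborel)"
      by (intro nn_integral_cong) (simp add: abs_mult ennreal_mult eps_nonneg[OF e] eps_even[of e x])
    finally show ?thesis .
  qed
  then have "(\<integral>\<^sup>+x. ennreal \<bar>conv g (moll_eps \<rho> e) x\<bar> \<partial>lborel) \<le>
      (\<integral>\<^sup>+x. (\<integral>\<^sup>+y. ennreal \<bar>g y\<bar> * ennreal (moll_eps \<rho> e (y - x)) \<partial>lborel) \<partial>lborel)"
    by (intro nn_integral_mono) auto
  also have "\<dots> = (\<integral>\<^sup>+y. (\<integral>\<^sup>+x. ennreal \<bar>g y\<bar> * ennreal (moll_eps \<rho> e (y - x)) \<partial>lborel) \<partial>lborel)"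
    by (rule lborel_pair.Fubini') measurable
  also have "\<dots> = (\<integral>\<^sup>+y. ennreal \<bar>g y\<bar> \<partial>lborel)"
    using eps_integral[OF e] eps_nonneg[OF e] by (simp add: nn_integral_cmult nn_integral_eq_integral)
  also have "\<dots> = ennreal (LINT x|lborel. \<bar>g x\<bar>)"
    using g by (intro nn_integral_eq_integral) auto
  finally show ?thesis .
qed

lemma conv_eps_L1_integral:
  assumes e: "e > 0" and g: "integrable lborel g" and [measurable]: "g \<in> borel_measurable borel"
  shows "integrable lborel (conv g (moll_eps \<rho> e))"
    "(LINT x|lborel. \<bar>conv g (moll_eps \<rho> e) x\<bar>) \<le> (LINT x|lborel. \<bar>g x\<bar>)"
proof -
  have [measurable]: "conv g (moll_eps \<rho> e) \<in> borel_measurable borel"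
    by (rule smooth_borel[OF smooth_conv_eps[OF e g]])
  note le = conv_eps_L1[OF assms]
  show i: "integrable lborel (conv g (moll_eps \<rho> e))"
    by (rule integrableI_bounded) (use le in \<open>auto simp: less_top[symmetric] top_unique\<close>)
  have "ennreal (LINT x|lborel. \<bar>conv g (moll_eps \<rho> e) x\<bar>) = (\<integral>\<^sup>+x. ennreal \<bar>conv g (moll_eps \<rho> e) x\<bar> \<partial>lborel)"
    using i by (intro nn_integral_eq_integral[symmetric]) auto
  then have "ennreal (LINT x|lborel. \<bar>conv g (moll_eps \<rho> e) x\<bar>) \<le> ennreal (LINT x|lborel. \<bar>g x\<bar>)"
    using le by (simp only:)
  then show "(LINT x|lborel. \<bar>conv g (moll_eps \<rho> e) x\<bar>) \<le> (LINT x|lborel. \<bar>g x\<bar>)"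
    by (subst (asm) ennreal_le_iff) auto
qed

lemma U_L1: "(\<lambda>k. LINT x|lborel. \<bar>U k x - indicator E x\<bar>) \<longlonglongrightarrow> 0"
proof (rule LIMSEQ_I)
  fix d :: real assume "d > 0"
  obtain R where R: "E \<subseteq> ball 0 R" "R > 0" using bounded_subset_ballD[OF E_bounded, of 0] by blast
  \<comment> \<open>Density of test functions needs a finite measure, hence the ball
    \<open>B\<close>. From points of the smaller ball \<open>C\<close> a kernel of radius at most 1
    sees only \<open>B\<close>, and off \<open>C\<close> both \<open>u e\<close> and the indicator
    of \<open>E\<close> vanish.\<close>
  define B where "B = cball (0::'a) (R + 2)"
  define C where "C = cball (0::'a) (R + 1)"
  have [measurable]: "B \<in> sets borel" "C \<in> sets borel" by (auto simp: B_def C_def)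
  define M where "M = density (lborel::'a measure) (\<lambda>x. ennreal (indicat_real B x))"
  have emM: "emeasure M UNIV = emeasure lborel B" by (simp add: M_def emeasure_density ennreal_indicator)
  have fM: "emeasure lborel B < \<infinity>" "emeasure lborel C < \<infinity>" unfolding B_def C_def
    using emeasure_bounded_finite[OF bounded_cball] by auto
  have finM: "finite_measure M" using emM fM by (intro finite_measureI) (auto simp: M_def)
  have setsM: "sets M = sets borel" by (simp add: M_def)
  have "integrable M (indicat_real E)"
    using finM setsM by (simp add: finite_measure.emeasure_finite less_top[symmetric])
  from test_fun_dense[OF finM setsM this, of "d / 4"] \<open>d > 0\<close>
  obtain \<psi> where \<psi>: "test_fun UNIV \<psi>" and "(LINT x|M. \<bar>indicator E x - \<psi> x\<bar>) < d / 4" by auto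
  have [measurable]: "\<psi> \<in> borel_measurable borel" using \<psi> smooth_borel test_fun_smooth by blast
  obtain Bd where Bd: "Bd > 0" "\<And>x. \<bar>\<psi> x\<bar> \<le> Bd" using test_fun_bounded[OF \<psi>] by blast
  define g where "g x = indicator B x * (indicator E x - \<psi> x)" for x
  have [measurable]: "g \<in> borel_measurable borel" unfolding g_def by measurable
  have gint: "integrable lborel g"
  proof (rule integrable_bounded_support[of _ B "1 + Bd"])
    show "norm (g x) \<le> 1 + Bd" for x
      using Bd(2)[of x] by (auto simp: g_def indicator_def abs_le_iff)
  qed (auto simp: g_def B_def)
  have "(LINT x|M. \<bar>indicator E x - \<psi> x\<bar>) = (LINT x|lborel. \<bar>g x\<bar>)"
    unfolding M_def by (subst integral_density) (auto simp: g_def abs_mult)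
  then have gd: "(LINT x|lborel. \<bar>g x\<bar>) < d / 4" using \<open>_ < d / 4\<close> by simp
  define m where "m = measure lborel C"
  have m: "m \<ge> 0" by (simp add: m_def)
  define c where "c = d / (4 * (m + 1))"
  have c: "c > 0" "c * m \<le> d / 4" using m \<open>d > 0\<close> by (auto simp: c_def field_simps)
  have ts: "compact (tsupport \<psi>)" using \<psi> by (simp add: test_fun_def)
  have ev: "\<forall>\<^sub>F k in sequentially. \<forall>x. \<bar>conv \<psi> (moll_eps \<rho> (1 / real (Suc k))) x - \<psi> x\<bar> \<le> c"
    by (rule conv_eps_test_close[OF smooth_continuous[OF test_fun_smooth[OF \<psi>]] ts tsupport_zero[of _ \<psi>] c(1)])
  have "\<forall>\<^sub>F k in sequentially. norm ((LINT x|lborel. \<bar>U k x - indicator E x\<bar>) - 0) < d"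
    using ev
  proof eventually_elim
    case (elim k)
    define e where "e = 1 / real (Suc k)"
    have e: "e > 0" "e \<le> 1" by (auto simp: e_def)
    have uint: "integrable lborel (u e)"
      unfolding u_def by (rule conv_eps_L1_integral[OF e(1) integrable_E]) measurable
    have cgi: "integrable lborel (conv g (moll_eps \<rho> e))"
      by (rule conv_eps_L1_integral[OF e(1) gint]) measurable
    have pt: "\<bar>u e x - indicator E x\<bar> \<le> \<bar>conv g (moll_eps \<rho> e) x\<bar> + indicator C x * c + \<bar>g x\<bar>" for x
    proof (cases "x \<in> C")
      case True
      have inB: "y \<in> B" if "y \<in> ball x e" for y
      proof -
        have "norm y \<le> norm x + dist x y" unfolding dist_norm by (metis norm_minus_commute norm_triangle_sub)
        then show ?thesis using that True e by (auto simp: B_def C_def)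
      qed
      have "u e x - conv \<psi> (moll_eps \<rho> e) x = (LINT y|lborel. (indicator E y - \<psi> y) * moll_eps \<rho> e (x - y))"
        unfolding u_def conv_def left_diff_distrib
        by (rule Bochner_Integration.integral_diff[symmetric];
            rule conv_eps_integrable[OF e(1), of _ _ "1 + Bd"])
          (use Bd in \<open>auto simp: indicator_def intro: order_trans[OF Bd(2)]\<close>)
      also have "\<dots> = conv g (moll_eps \<rho> e) x"
        unfolding conv_def
      proof (rule Bochner_Integration.integral_cong[OF refl])
        fix y show "(indicator E y - \<psi> y) * moll_eps \<rho> e (x - y) = g y * moll_eps \<rho> e (x - y)"
          using inB[of y] eps_zero[OF e(1), of "x - y"] by (cases "y \<in> ball x e") (auto simp: g_def dist_norm)
      qed
      finally have 1: "u e x = conv g (moll_eps \<rho> e) x + conv \<psi> (moll_eps \<rho> e) x" by simp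
      have "x \<in> B" using True by (auto simp: B_def C_def)
      then have 2: "g x = indicator E x - \<psi> x" by (simp add: g_def)
      have 3: "\<bar>conv \<psi> (moll_eps \<rho> e) x - \<psi> x\<bar> \<le> c" using elim by (simp add: e_def)
      show ?thesis using 1 2 3 True by simp
    next
      case False
      have "E \<inter> ball x e = {}"
      proof -
        have "y \<notin> E" if y: "y \<in> ball x e" for y
        proof
          assume "y \<in> E"
          then have "norm y < R" using R(1) by auto
          moreover have "norm x \<le> norm y + dist x y" unfolding dist_norm by (rule norm_triangle_sub)
          ultimately show False using y False e by (auto simp: C_def)
        qed
        then show ?thesis by blast
      qed
      moreover have "x \<notin> E" using R(1) False by (auto simp: C_def subset_iff)
      ultimately show ?thesis using u_zero[OF e(1)] c(1) by simp
    qed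
    have "(LINT x|lborel. \<bar>u e x - indicator E x\<bar>)
        \<le> (LINT x|lborel. \<bar>conv g (moll_eps \<rho> e) x\<bar> + indicator C x * c + \<bar>g x\<bar>)"
      using uint integrable_E cgi gint fM pt by (intro integral_mono) auto
    also have "\<dots> = (LINT x|lborel. \<bar>conv g (moll_eps \<rho> e) x\<bar>) + m * c + (LINT x|lborel. \<bar>g x\<bar>)"
      using cgi gint fM by (simp add: m_def)
    also have "\<dots> \<le> d / 4 + d / 4 + d / 4"
      using conv_eps_L1_integral(2)[OF e(1) gint] gd c by (simp add: mult.commute)
    also have "\<dots> < d" using \<open>d > 0\<close> by simp
    finally show ?case by (simp add: e_def U_def)
  qed
  then show "\<exists>no. \<forall>n\<ge>no. norm ((LINT x|lborel. \<bar>U n x - indicator E x\<bar>) - 0) < d"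
    unfolding eventually_sequentially .
qed

text \<open>Convergence in \<open>L^1\<close> tested against an essentially bounded function.
  Lebesgue measurability and a bound almost everywhere are all that the field \<open>F\<close>
  provides.\<close>

lemma U_L1_weak:
  assumes [measurable]: "f \<in> borel_measurable lebesgue" and B: "AE x in lebesgue. \<bar>f x\<bar> \<le> B"
    and fi: "integrable lebesgue f"
  shows "(\<lambda>k. LINT x|lebesgue. f x * U k x) \<longlonglongrightarrow> (LINT x|lebesgue. f x * indicator E x)"
proof -
  have Um [measurable]: "U k \<in> borel_measurable lebesgue" for k
    by (rule measurable_completion) measurable
  have Em [measurable]: "indicat_real E \<in> borel_measurable lebesgue"
    by (rule measurable_completion) measurable
  have iU: "integrable lebesgue (\<lambda>x. f x * U k x)" for k
    using integrable_mult_bounded[OF fi Um[of k], of 1] U_abs_le by simp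
  have iE: "integrable lebesgue (\<lambda>x. f x * indicator E x)"
    using integrable_mult_bounded[OF fi Em, of 1] by (simp add: indicator_def)
  have iUE: "integrable lborel (\<lambda>x. \<bar>U k x - indicator E x\<bar>)" for k
    using integrable_E conv_eps_L1_integral(1)[OF _ integrable_E, of "1 / real (Suc k)"] by (auto simp: u_def U_def)
  have iUE': "integrable lebesgue (\<lambda>x. B * \<bar>U k x - indicator E x\<bar>)" for k
    using iUE by (intro integrable_mult_right) (simp add: integrable_completion)
  have bd: "norm ((LINT x|lebesgue. f x * U k x) - (LINT x|lebesgue. f x * indicator E x))
      \<le> B * (LINT x|lborel. \<bar>U k x - indicator E x\<bar>)" for k
  proof -
    have "(LINT x|lebesgue. f x * U k x) - (LINT x|lebesgue. f x * indicator E x) =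
        (LINT x|lebesgue. f x * (U k x - indicator E x))"
      using iU iE by (simp add: right_diff_distrib)
    also have "norm \<dots> \<le> (LINT x|lebesgue. norm (f x * (U k x - indicator E x)))"
      by (rule integral_norm_bound)
    also have "\<dots> \<le> (LINT x|lebesgue. B * \<bar>U k x - indicator E x\<bar>)"
    proof (rule integral_mono_AE)
      show "integrable lebesgue (\<lambda>x. norm (f x * (U k x - indicator E x)))"
        using iU[of k] iE by (intro integrable_norm) (simp add: right_diff_distrib)
      show "AE x in lebesgue. norm (f x * (U k x - indicator E x)) \<le> B * \<bar>U k x - indicator E x\<bar>"
        using B by eventually_elim (auto simp: abs_mult intro: mult_right_mono)
    qed (rule iUE')
    also have "\<dots> = B * (LINT x|lborel. \<bar>U k x - indicator E x\<bar>)"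
      by (simp add: integral_completion)
    finally show ?thesis .
  qed
  have "(\<lambda>k. (LINT x|lebesgue. f x * U k x) - (LINT x|lebesgue. f x * indicator E x)) \<longlonglongrightarrow> 0"
  proof (rule Lim_null_comparison)
    show "\<forall>\<^sub>F k in sequentially. norm ((LINT x|lebesgue. f x * U k x) - (LINT x|lebesgue. f x * indicator E x))
        \<le> B * (LINT x|lborel. \<bar>U k x - indicator E x\<bar>)" using bd by simp
    show "(\<lambda>k. B * (LINT x|lborel. \<bar>U k x - indicator E x\<bar>)) \<longlonglongrightarrow> 0"
      using tendsto_mult_right_zero[OF U_L1, of B] by simp
  qed
  then show ?thesis by (rule LIM_zero_cancel)
qed

lemma U_L1_weak_lborel:
  assumes [measurable]: "f \<in> borel_measurable borel" and B: "\<And>x. \<bar>f x\<bar> \<le> B" and fi: "integrable lborel f"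
  shows "(\<lambda>k. LINT x|lborel. f x * U k x) \<longlonglongrightarrow> (LINT x|lborel. f x * indicator E x)"
proof -
  have "integrable lebesgue f" using fi by (simp add: integrable_completion)
  moreover have "f \<in> borel_measurable lebesgue" by (rule measurable_completion) measurable
  ultimately show ?thesis
    using U_L1_weak[of f B] B by (simp add: integral_completion)
qed

text \<open>Since the kernel is even, \<open>u_k D\<chi>_E\<close> and \<open>\<chi>_E \<nabla>u_k\<close> differ only by a commutator that
  vanishes in the limit, whereas their sum \<open>D(u_k \<chi>_E)\<close> tends to \<open>D\<chi>_E\<close>.\<close>

lemma U_half_test:
  assumes \<phi>: "test_fun UNIV \<phi>" and b: "b \<in> Basis"
  shows "(\<lambda>k. LINT x|\<mu>. \<phi> x * U k x * (\<sigma> x \<bullet> b)) \<longlonglongrightarrow> (LINT x|\<mu>. \<phi> x * (\<sigma> x \<bullet> b)) / 2"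
proof -
  have sm: "smooth \<phi>" using \<phi> by (rule test_fun_smooth)
  note [measurable] = smooth_borel[OF sm] smooth_borel[OF smooth_pd[OF sm b]]
  have ts: "compact (tsupport \<phi>)" using \<phi> by (simp add: test_fun_def)
  have pd0: "pd b \<phi> x = 0" if "x \<notin> tsupport \<phi>" for x
    using test_fun_grad_zero[OF that] grad_inner_Basis[OF b, of \<phi> x] by simp
  obtain B where B: "B > 0" "\<And>x. \<bar>\<phi> x\<bar> \<le> B" using test_fun_bounded[OF \<phi>] by blast
  obtain B' where B': "B' > 0" "\<And>x. norm (pd b \<phi> x) \<le> B'"
    using compact_support_bounded[OF smooth_continuous[OF smooth_pd[OF sm b]] ts pd0] by blast
  have ipd: "integrable lborel (pd b \<phi>)"
    by (rule integrable_bounded_support[OF _ ts pd0 B'(2)]) measurable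
  have iphi: "integrable lborel \<phi>"
    by (rule integrable_bounded_support[OF _ ts tsupport_zero[of _ \<phi>], where B = B]) (use B in auto)
  \<comment> \<open>This is the integral of \<open>\<phi>\<close> times a partial derivative of
    \<open>U k\<close> over \<open>E\<close>, with the kernel moved from \<open>\<mu>\<close> to the
    function \<open>\<phi> \<chi>_E\<close>.\<close>
  define c where "c k = (LINT x|\<mu>. conv (\<lambda>x. indicator E x * \<phi> x) (moll_eps \<rho> (1 / real (Suc k))) x * (\<sigma> x \<bullet> b))" for k
  have id: "(LINT x|\<mu>. \<phi> x * U k x * (\<sigma> x \<bullet> b)) = - (LINT x|lborel. indicator E x * pd b \<phi> x * U k x) - c k" for k
  proof -
    define e where "e = 1 / real (Suc k)"
    have e: "e > 0" by (simp add: e_def)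
    note [measurable] = smooth_borel[OF u_smooth[OF e]] smooth_borel[OF smooth_pd[OF u_smooth[OF e] b]]
    have t: "test_fun UNIV (\<lambda>x. \<phi> x * u e x)" by (rule test_fun_mult_smooth[OF \<phi> u_smooth[OF e]])
    have p: "pd b (\<lambda>x. \<phi> x * u e x) = (\<lambda>x. \<phi> x * pd b (u e) x + pd b \<phi> x * u e x)"
      by (rule pd_mult) (auto intro: smooth_differentiable sm u_smooth e)
    obtain Bk where Bk: "\<And>x. norm (\<phi> x * pd b (u e) x) \<le> Bk"
      using compact_support_bounded[of "\<lambda>x. \<phi> x * pd b (u e) x" "tsupport \<phi>"]
        smooth_continuous[OF smooth_mult[OF sm smooth_pd[OF u_smooth[OF e] b]]] ts
      by (metis mult_zero_left tsupport_zero)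
    have i1: "integrable lborel (\<lambda>x. indicator E x * (\<phi> x * pd b (u e) x))"
      by (rule integrable_bounded_support[OF _ ts, where B = Bk])
        (use Bk in \<open>auto simp: tsupport_zero indicator_def order_trans[OF abs_ge_zero Bk[unfolded real_norm_def]]\<close>)
    have i2: "integrable lborel (\<lambda>x. indicator E x * (pd b \<phi> x * u e x))"
      by (rule integrable_bounded_support[OF _ ts, where B = B'])
        (use B' u_abs_le[OF e] in \<open>auto simp: pd0 indicator_def abs_mult intro: order_trans[OF mult_mono[OF B'(2)[unfolded real_norm_def] u_abs_le[OF e]]]\<close>)
    have "- (LINT x|\<mu>. \<phi> x * u e x * (\<sigma> x \<bullet> b)) = (LINT x|lborel. indicator E x * pd b (\<lambda>x. \<phi> x * u e x) x)"
      using gg_scalar[OF t b] by simp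
    also have "\<dots> = (LINT x|lborel. indicator E x * (\<phi> x * pd b (u e) x)) + (LINT x|lborel. indicator E x * (pd b \<phi> x * u e x))"
      unfolding p distrib_left by (rule Bochner_Integration.integral_add[OF i1 i2])
    also have "(LINT x|lborel. indicator E x * (\<phi> x * pd b (u e) x)) =
        (LINT x|lborel. (LINT y|\<mu>. indicator E x * \<phi> x * moll_eps \<rho> e (x - y) * (\<sigma> y \<bullet> b)))"
      unfolding pd_u[OF e b] by (simp add: mult.assoc)
    \<comment> \<open>Fubini exchanges the two integrations; evenness of the kernel, used right
      after, makes the inner integral a convolution evaluated at \<open>y\<close>.\<close>
    also have "\<dots> = (LINT y|\<mu>. (LINT x|lborel. indicator E x * \<phi> x * moll_eps \<rho> e (x - y) * (\<sigma> y \<bullet> b)))"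
    proof -
      interpret P: pair_sigma_finite "lborel :: 'a measure" \<mu> by (rule pair_sigma_finite_lborel_mu)
      obtain R where R: "\<And>x. \<rho> x \<le> R" using rho_bounded by blast
      define D where "D = (1 / e) ^ DIM('a) * R"
      have D: "\<bar>moll_eps \<rho> e x\<bar> \<le> D" for x
        unfolding D_def using eps_bound[OF R e, of x] eps_nonneg[OF e, of x] by simp
      have "integrable (lborel \<Otimes>\<^sub>M \<mu>) (\<lambda>(x, y). indicator E x * \<phi> x * moll_eps \<rho> e (x - y) * (\<sigma> y \<bullet> b))"
      proof (rule P.Fubini_integrable)
        have ile: "(LINT y|\<mu>. norm (indicator E x * \<phi> x * moll_eps \<rho> e (x - y) * (\<sigma> y \<bullet> b))) \<le> \<bar>\<phi> x\<bar> * (D * measure \<mu> UNIV)" for x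
        proof -
          have "(LINT y|\<mu>. norm (indicator E x * \<phi> x * moll_eps \<rho> e (x - y) * (\<sigma> y \<bullet> b))) \<le> (LINT y|\<mu>. \<bar>\<phi> x\<bar> * D)"
          proof (rule integral_mono)
            have le: "norm (indicator E x * \<phi> x * moll_eps \<rho> e (x - y) * (\<sigma> y \<bullet> b)) \<le> \<bar>\<phi> x\<bar> * D" for y
            proof -
              have "norm (indicator E x * \<phi> x * moll_eps \<rho> e (x - y) * (\<sigma> y \<bullet> b)) \<le> 1 * \<bar>\<phi> x\<bar> * D * 1"
                unfolding real_norm_def abs_mult
                by (intro mult_mono) (use D sigma_inner_le[of y b] b D[of 0] in \<open>auto simp: indicator_def order_trans[OF abs_ge_zero D[of 0]]\<close>)
              then show ?thesis by simp
            qed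
            then show "norm (indicator E x * \<phi> x * moll_eps \<rho> e (x - y) * (\<sigma> y \<bullet> b)) \<le> \<bar>\<phi> x\<bar> * D" for y .
            show "integrable \<mu> (\<lambda>y. norm (indicator E x * \<phi> x * moll_eps \<rho> e (x - y) * (\<sigma> y \<bullet> b)))"
              by (rule integrable_bounded_mu[of _ "\<bar>\<phi> x\<bar> * D"]) (use le in auto)
          qed simp
          then show ?thesis by (simp add: mult_ac)
        qed
        show "integrable lborel (\<lambda>x. LINT y|\<mu>. norm (case (x, y) of (x, y) \<Rightarrow> indicator E x * \<phi> x * moll_eps \<rho> e (x - y) * (\<sigma> y \<bullet> b)))"
        proof (rule Bochner_Integration.integrable_bound[of _ "\<lambda>x. \<bar>\<phi> x\<bar> * (D * measure \<mu> UNIV)"])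
          show "AE x in lborel. norm (LINT y|\<mu>. norm (case (x, y) of (x, y) \<Rightarrow> indicator E x * \<phi> x * moll_eps \<rho> e (x - y) * (\<sigma> y \<bullet> b)))
            \<le> norm (\<bar>\<phi> x\<bar> * (D * measure \<mu> UNIV))"
          proof (rule AE_I2)
            fix x
            show "norm (LINT y|\<mu>. norm (case (x, y) of (x, y) \<Rightarrow> indicator E x * \<phi> x * moll_eps \<rho> e (x - y) * (\<sigma> y \<bullet> b)))
              \<le> norm (\<bar>\<phi> x\<bar> * (D * measure \<mu> UNIV))"
              using order_trans[OF ile[of x] abs_ge_self] by simp
          qed
        qed (use iphi in auto)
        show "AE x in lborel. integrable \<mu> (\<lambda>y. case (x, y) of (x, y) \<Rightarrow> indicator E x * \<phi> x * moll_eps \<rho> e (x - y) * (\<sigma> y \<bullet> b))"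
        proof (rule AE_I2)
          fix x :: 'a
          have "integrable \<mu> (\<lambda>y. (indicator E x * \<phi> x) * (moll_eps \<rho> e (x - y) * (\<sigma> y \<bullet> b)))"
            using integrable_inner_left[OF integrable_kernel_mu(2)[OF e], of x b]
            by (intro integrable_mult_right) simp
          then show "integrable \<mu> (\<lambda>y. case (x, y) of (x, y) \<Rightarrow> indicator E x * \<phi> x * moll_eps \<rho> e (x - y) * (\<sigma> y \<bullet> b))"
            by (simp add: mult.assoc)
        qed
      qed measurable
      from P.Fubini_integral[OF this] show ?thesis by simp
    qed
    also have "\<dots> = c k"
      unfolding c_def conv_def e_def[symmetric] by (simp add: eps_even[of e])
    finally show ?thesis by (simp add: e_def mult.assoc U_def)
  qed
  have lim1: "(\<lambda>k. LINT x|lborel. indicator E x * pd b \<phi> x * U k x) \<longlonglongrightarrow> - (LINT x|\<mu>. \<phi> x * (\<sigma> x \<bullet> b))"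
  proof -
    have "(\<lambda>k. LINT x|lborel. (indicator E x * pd b \<phi> x) * U k x) \<longlonglongrightarrow> (LINT x|lborel. (indicator E x * pd b \<phi> x) * indicator E x)"
    proof (rule U_L1_weak_lborel[of _ B'])
      show "\<bar>indicator E x * pd b \<phi> x\<bar> \<le> B'" for x using B' by (auto simp: indicator_def less_imp_le)
      show "integrable lborel (\<lambda>x. indicator E x * pd b \<phi> x)"
        by (rule integrable_bounded_support[OF _ ts, where B = B'])
          (use B' in \<open>auto simp: indicator_def less_imp_le pd0\<close>)
    qed measurable
    also have "(LINT x|lborel. (indicator E x * pd b \<phi> x) * indicator E x) = (LINT x|lborel. indicator E x * pd b \<phi> x)"
      by (intro Bochner_Integration.integral_cong) (auto simp: indicator_def)
    finally show ?thesis unfolding gg_scalar[OF \<phi> b] .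
  qed
  \<comment> \<open>The commutator estimate: \<open>\<phi>\<close> is uniformly continuous, so
    pulling it through the kernel costs at most \<open>d'\<close> at every point once the scale is
    below \<open>r\<close>.\<close>
  have lim2: "(\<lambda>k. c k - (LINT x|\<mu>. \<phi> x * U k x * (\<sigma> x \<bullet> b))) \<longlonglongrightarrow> 0"
  proof (rule LIMSEQ_I)
    fix d :: real assume d: "d > 0"
    define d' where "d' = d / (measure \<mu> UNIV + 1)"
    have d': "d' > 0" "d' * measure \<mu> UNIV < d" using d by (auto simp: d'_def field_simps add_pos_nonneg)
    obtain r where r: "r > 0" "\<And>x y. dist x y < r \<Longrightarrow> dist (\<phi> x) (\<phi> y) < d'"
      using compact_support_uniformly_continuous[OF smooth_continuous[OF sm] ts tsupport_zero[of _ \<phi>] d'(1)] by blast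
    have "\<forall>\<^sub>F k in sequentially. norm (c k - (LINT x|\<mu>. \<phi> x * U k x * (\<sigma> x \<bullet> b)) - 0) < d"
      using eventually_inverse_Suc[OF r(1)]
    proof eventually_elim
      case (elim k)
      define e where "e = 1 / real (Suc k)"
      have e: "e > 0" "e < r" using elim by (auto simp: e_def)
      define w where "w = conv (\<lambda>x. indicator E x * \<phi> x) (moll_eps \<rho> e)"
      note [measurable] = smooth_borel[OF u_smooth[OF e(1)]]
      have iE: "integrable lborel (\<lambda>x. indicator E x * \<phi> x)"
        by (rule integrable_bounded_support[OF _ ts, where B = B])
          (use B in \<open>auto simp: indicator_def less_imp_le tsupport_zero\<close>)
      have [measurable]: "w \<in> borel_measurable borel"
        unfolding w_def by (rule smooth_borel[OF smooth_conv_eps[OF e(1) iE]])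
      have close: "\<bar>w x - \<phi> x * u e x\<bar> \<le> d'" for x
      proof -
        have i1: "integrable lborel (\<lambda>y. indicator E y * \<phi> y * moll_eps \<rho> e (x - y))"
          by (rule conv_eps_integrable[OF e(1), of _ _ B]) (use B in \<open>auto simp: indicator_def less_imp_le\<close>)
        have i2: "integrable lborel (\<lambda>y. indicator E y * moll_eps \<rho> e (x - y))"
          by (rule conv_eps_integrable[OF e(1), of _ _ 1]) (auto simp: indicator_def)
        have "w x - \<phi> x * u e x = conv (\<lambda>y. indicator E y * (\<phi> y - \<phi> x)) (moll_eps \<rho> e) x"
          unfolding w_def u_def conv_def
          using Bochner_Integration.integral_diff[OF i1 integrable_mult_right[OF i2, of "\<phi> x"]]
          by (simp add: algebra_simps)
        moreover have "- d' \<le> indicator E y * (\<phi> y - \<phi> x) \<and> indicator E y * (\<phi> y - \<phi> x) \<le> d'" if "y \<in> ball x e" for y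
          using r(2)[of x y] that e d'(1) by (auto simp: indicator_def dist_real_def)
        ultimately show ?thesis
          using conv_eps_bounds[OF e(1), of "\<lambda>y. indicator E y * (\<phi> y - \<phi> x)" x "- d'" d']
          by (simp add: abs_le_iff)
      qed
      have wb: "\<bar>w x\<bar> \<le> B" for x
      proof -
        have "- B \<le> indicator E y * \<phi> y \<and> indicator E y * \<phi> y \<le> B" for y
          using B(2)[of y] B(1) by (auto simp: indicator_def abs_le_iff)
        then show ?thesis
          using conv_eps_bounds[OF e(1), of "\<lambda>y. indicator E y * \<phi> y" x "- B" B]
          unfolding w_def by (simp add: abs_le_iff)
      qed
      have sb: "\<bar>\<sigma> x \<bullet> b\<bar> \<le> 1" for x using sigma_inner_le[of x b] b by simp
      have "\<bar>w x * (\<sigma> x \<bullet> b)\<bar> \<le> B * 1" for x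
        unfolding abs_mult using B(1) by (intro mult_mono wb sb) auto
      then have i1: "integrable \<mu> (\<lambda>x. w x * (\<sigma> x \<bullet> b))"
        by (intro integrable_bounded_mu[of _ "B * 1"]) auto
      have "\<bar>\<phi> x * u e x * (\<sigma> x \<bullet> b)\<bar> \<le> B * 1 * 1" for x
        unfolding abs_mult using B(1) by (intro mult_mono B(2) u_abs_le[OF e(1)] sb) auto
      then have i2: "integrable \<mu> (\<lambda>x. \<phi> x * u e x * (\<sigma> x \<bullet> b))"
        by (intro integrable_bounded_mu[of _ "B * 1 * 1"]) auto
      have "norm ((LINT x|\<mu>. w x * (\<sigma> x \<bullet> b)) - (LINT x|\<mu>. \<phi> x * u e x * (\<sigma> x \<bullet> b)))
         = norm (LINT x|\<mu>. (w x - \<phi> x * u e x) * (\<sigma> x \<bullet> b))"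
        using i1 i2 by (simp add: left_diff_distrib)
      also have "\<dots> \<le> (LINT x|\<mu>. norm ((w x - \<phi> x * u e x) * (\<sigma> x \<bullet> b)))"
        by (rule integral_norm_bound)
      also have "\<dots> \<le> (LINT x|\<mu>. d')"
      proof (rule integral_mono)
        show "integrable \<mu> (\<lambda>x. norm ((w x - \<phi> x * u e x) * (\<sigma> x \<bullet> b)))"
          using i1 i2 by (intro integrable_norm) (simp add: left_diff_distrib)
        show "norm ((w x - \<phi> x * u e x) * (\<sigma> x \<bullet> b)) \<le> d'" for x
          using mult_mono[OF close[of x] order_trans[OF sigma_inner_le[of x b]], of 1] b d'(1) by (simp add: abs_mult)
      qed simp
      also have "\<dots> < d" using d'(2) by (simp add: mult.commute)
      finally show ?case by (simp add: c_def w_def e_def U_def)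
    qed
    then show "\<exists>no. \<forall>n\<ge>no. norm (c n - (LINT x|\<mu>. \<phi> x * U n x * (\<sigma> x \<bullet> b)) - 0) < d"
      unfolding eventually_sequentially .
  qed
  \<comment> \<open>The sought integral \<open>X\<close> satisfies \<open>X = - L - c\<close> by
    \<open>id\<close>, while \<open>c - X\<close> tends to 0. Solving for \<open>X\<close> gives
    \<open>(- L - (c - X)) / 2\<close>, and this is where the factor one half arises.\<close>
  have "(\<lambda>k. (- (LINT x|lborel. indicator E x * pd b \<phi> x * U k x) - (c k - (LINT x|\<mu>. \<phi> x * U k x * (\<sigma> x \<bullet> b)))) / 2)
      \<longlonglongrightarrow> (- (- (LINT x|\<mu>. \<phi> x * (\<sigma> x \<bullet> b))) - 0) / 2"
    by (intro tendsto_intros lim1 lim2) simp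
  moreover have "(- (LINT x|lborel. indicator E x * pd b \<phi> x * U k x) - (c k - (LINT x|\<mu>. \<phi> x * U k x * (\<sigma> x \<bullet> b)))) / 2
      = (LINT x|\<mu>. \<phi> x * U k x * (\<sigma> x \<bullet> b))" for k
    using id[of k] by simp
  ultimately show ?thesis by simp
qed

text \<open>The functions \<open>U k\<close> and the components of \<open>\<sigma>\<close> are
  bounded by 1, so the case of test functions extends by density to all of
  \<open>L^1(\<mu>)\<close>. Applying it to \<open>f\<close> times each component of
  \<open>\<sigma>\<close> and summing over the basis removes the direction, because
  \<open>\<sigma>\<close> has norm one.\<close>

lemma U_half:
  assumes f: "integrable \<mu> f"
  shows "(\<lambda>k. LINT x|\<mu>. f x * U k x) \<longlonglongrightarrow> (LINT x|\<mu>. f x) / 2"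
proof -
  have iU: "integrable \<mu> (\<lambda>x. f x * U k x)" if "integrable \<mu> f" for f k
    using integrable_mult_bounded[OF that, of "U k" 1] U_abs_le by simp
  have isg: "integrable \<mu> (\<lambda>x. f x * (\<sigma> x \<bullet> b))" if "integrable \<mu> f" "b \<in> Basis" for f b
    using integrable_mult_bounded[OF that(1), of "\<lambda>x. \<sigma> x \<bullet> b" 1] sigma_inner_le[of _ b] that(2) by simp
  have 1: "(\<lambda>k. LINT x|\<mu>. f x * U k x * (\<sigma> x \<bullet> b)) \<longlonglongrightarrow> (LINT x|\<mu>. f x * (\<sigma> x \<bullet> b)) / 2"
    if f: "integrable \<mu> f" and b: "b \<in> Basis" for f b
  proof (rule LIMSEQ_I)
    fix d :: real assume d: "d > 0"
    obtain \<psi> where \<psi>: "test_fun UNIV \<psi>" and psid: "(LINT x|\<mu>. \<bar>f x - \<psi> x\<bar>) < d / 3"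
      using test_fun_dense[OF finite_measure_axioms sets_mu f, of "d / 3"] d by auto
    have ps: "integrable \<mu> \<psi>" by (rule test_fun_integrable[OF \<psi> finite_measure_axioms sets_mu])
    have key: "\<bar>(LINT x|\<mu>. f x * g x) - (LINT x|\<mu>. \<psi> x * g x)\<bar> < d / 3"
      if [measurable]: "g \<in> borel_measurable borel" and g: "\<And>x. \<bar>g x\<bar> \<le> 1" for g :: "'a \<Rightarrow> real"
    proof -
      have i: "integrable \<mu> (\<lambda>x. f x * g x)" "integrable \<mu> (\<lambda>x. \<psi> x * g x)"
        using integrable_mult_bounded[OF f, of g 1] integrable_mult_bounded[OF ps, of g 1] g by auto
      have "\<bar>(LINT x|\<mu>. f x * g x) - (LINT x|\<mu>. \<psi> x * g x)\<bar> = norm (LINT x|\<mu>. (f x - \<psi> x) * g x)"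
        using i by (simp add: left_diff_distrib)
      also have "\<dots> \<le> (LINT x|\<mu>. norm ((f x - \<psi> x) * g x))" by (rule integral_norm_bound)
      also have "\<dots> \<le> (LINT x|\<mu>. \<bar>f x - \<psi> x\<bar>)"
      proof (rule integral_mono)
        show "integrable \<mu> (\<lambda>x. norm ((f x - \<psi> x) * g x))"
          using i by (intro integrable_norm) (simp add: left_diff_distrib)
        show "norm ((f x - \<psi> x) * g x) \<le> \<bar>f x - \<psi> x\<bar>" for x
          using mult_left_mono[OF g[of x], of "\<bar>f x - \<psi> x\<bar>"] by (simp add: abs_mult)
      qed (use f ps in auto)
      finally show ?thesis using psid by simp
    qed
    have sb: "\<bar>\<sigma> x \<bullet> b\<bar> \<le> 1" for x using sigma_inner_le[of x b] b by simp
    have k1: "\<bar>(LINT x|\<mu>. f x * U k x * (\<sigma> x \<bullet> b)) - (LINT x|\<mu>. \<psi> x * U k x * (\<sigma> x \<bullet> b))\<bar> < d / 3" for k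
    proof -
      have "\<bar>U k x * (\<sigma> x \<bullet> b)\<bar> \<le> 1" for x
        using mult_mono[OF U_abs_le[of k x] sb[of x]] by (simp add: abs_mult)
      then show ?thesis using key[of "\<lambda>x. U k x * (\<sigma> x \<bullet> b)"] by (simp add: mult.assoc)
    qed
    have k2: "\<bar>(LINT x|\<mu>. f x * (\<sigma> x \<bullet> b)) - (LINT x|\<mu>. \<psi> x * (\<sigma> x \<bullet> b))\<bar> < d / 3"
      using key[of "\<lambda>x. \<sigma> x \<bullet> b"] sb by simp
    have "\<forall>\<^sub>F k in sequentially. dist (LINT x|\<mu>. \<psi> x * U k x * (\<sigma> x \<bullet> b)) ((LINT x|\<mu>. \<psi> x * (\<sigma> x \<bullet> b)) / 2) < d / 3"
      using U_half_test[OF \<psi> b] d by (intro tendstoD) auto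
    then have "\<forall>\<^sub>F k in sequentially. norm ((LINT x|\<mu>. f x * U k x * (\<sigma> x \<bullet> b)) - (LINT x|\<mu>. f x * (\<sigma> x \<bullet> b)) / 2) < d"
    proof eventually_elim
      case (elim k)
      then show ?case using k1[of k] k2 unfolding dist_real_def real_norm_def by linarith
    qed
    then show "\<exists>no. \<forall>n\<ge>no. norm ((LINT x|\<mu>. f x * U n x * (\<sigma> x \<bullet> b)) - (LINT x|\<mu>. f x * (\<sigma> x \<bullet> b)) / 2) < d"
      unfolding eventually_sequentially .
  qed
  have eq1: "(\<Sum>b\<in>Basis. (\<sigma> x \<bullet> b) * (\<sigma> x \<bullet> b)) = 1" for x
    using norm_sigma[of x] by (metis euclidean_inner norm_eq_1)
  have "(\<lambda>k. \<Sum>b\<in>Basis. LINT x|\<mu>. f x * (\<sigma> x \<bullet> b) * U k x * (\<sigma> x \<bullet> b))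
      \<longlonglongrightarrow> (\<Sum>b\<in>Basis. (LINT x|\<mu>. f x * (\<sigma> x \<bullet> b) * (\<sigma> x \<bullet> b)) / 2)"
    by (intro tendsto_sum 1 isg f)
  moreover have "(\<Sum>b\<in>Basis. LINT x|\<mu>. f x * (\<sigma> x \<bullet> b) * U k x * (\<sigma> x \<bullet> b)) = (LINT x|\<mu>. f x * U k x)" for k
  proof -
    have "(\<Sum>b\<in>Basis. LINT x|\<mu>. f x * (\<sigma> x \<bullet> b) * U k x * (\<sigma> x \<bullet> b))
        = (LINT x|\<mu>. (\<Sum>b\<in>Basis. f x * (\<sigma> x \<bullet> b) * U k x * (\<sigma> x \<bullet> b)))"
      by (rule Bochner_Integration.integral_sum[symmetric]) (intro isg iU f)
    also have "\<dots> = (LINT x|\<mu>. f x * U k x * (\<Sum>b\<in>Basis. (\<sigma> x \<bullet> b) * (\<sigma> x \<bullet> b)))"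
      by (simp add: sum_distrib_left mult_ac)
    finally show ?thesis by (simp add: eq1)
  qed
  moreover have "(\<Sum>b\<in>Basis. (LINT x|\<mu>. f x * (\<sigma> x \<bullet> b) * (\<sigma> x \<bullet> b)) / 2) = (LINT x|\<mu>. f x) / 2"
  proof -
    have "(\<Sum>b\<in>Basis. (LINT x|\<mu>. f x * (\<sigma> x \<bullet> b) * (\<sigma> x \<bullet> b)))
        = (LINT x|\<mu>. (\<Sum>b\<in>Basis. f x * (\<sigma> x \<bullet> b) * (\<sigma> x \<bullet> b)))"
      by (rule Bochner_Integration.integral_sum[symmetric]) (intro isg f)
    also have "\<dots> = (LINT x|\<mu>. f x * (\<Sum>b\<in>Basis. (\<sigma> x \<bullet> b) * (\<sigma> x \<bullet> b)))"
      by (simp add: sum_distrib_left mult_ac)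
    finally show ?thesis by (simp add: eq1 flip: sum_divide_distrib)
  qed
  ultimately show ?thesis by simp
qed

end

section \<open>Density at a point, relative isoperimetric inequality and covering\<close>

text \<open>The indicators converge off the limiting sphere, which is null. Convergence in the
  centre yields Borel measurability of density sets; convergence in the radius permits the
  intermediate value theorem.\<close>

lemma measure_Int_ball_tendsto:
  fixes E :: "'a::euclidean_space set"
  assumes [measurable]: "E \<in> sets lebesgue" and X: "X \<longlonglongrightarrow> x" and R: "R \<longlonglongrightarrow> r"
  shows "(\<lambda>n. measure lebesgue (E \<inter> ball (X n) (R n))) \<longlonglongrightarrow> measure lebesgue (E \<inter> ball x r)"
proof -
  have [measurable]: "ball y s \<in> sets lebesgue" for y :: 'a and s by auto
  obtain a where a: "\<And>n. norm (X n) \<le> a"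
    using convergent_imp_Bseq[of X] X unfolding convergent_def Bseq_def by blast
  obtain b where b: "\<And>n. norm (R n) \<le> b"
    using convergent_imp_Bseq[of R] R unfolding convergent_def Bseq_def by blast
  have "(\<lambda>n. LINT z|lebesgue. indicat_real (E \<inter> ball (X n) (R n)) z) \<longlonglongrightarrow> (LINT z|lebesgue. indicator (E \<inter> ball x r) z)"
  proof (rule integral_dominated_convergence[where w = "indicat_real (cball 0 (a + b))"])
    show "integrable lebesgue (indicat_real (cball 0 (a + b) :: 'a set))"
      using emeasure_bounded_finite[OF bounded_cball, of "0::'a" "a + b"] by simp
    show "AE z in lebesgue. norm (indicat_real (E \<inter> ball (X n) (R n)) z) \<le> indicat_real (cball 0 (a + b)) z" for n
    proof (rule AE_I2)
      fix z
      have "norm z \<le> norm (X n) + dist (X n) z" unfolding dist_norm by (metis norm_minus_commute norm_triangle_sub)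
      then show "norm (indicat_real (E \<inter> ball (X n) (R n)) z) \<le> indicat_real (cball 0 (a + b)) z"
        using a[of n] b[of n] by (auto simp: indicator_def)
    qed
    have "sphere x r \<in> null_sets lebesgue"
      using negligible_sphere negligible_iff_null_sets by blast
    then have "AE z in lebesgue. z \<notin> sphere x r" by (rule AE_not_in)
    then show "AE z in lebesgue. (\<lambda>n. indicat_real (E \<inter> ball (X n) (R n)) z) \<longlonglongrightarrow> indicat_real (E \<inter> ball x r) z"
    proof eventually_elim
      case (elim z)
      have lim: "(\<lambda>n. dist (X n) z - R n) \<longlonglongrightarrow> dist x z - r"
        by (intro tendsto_intros X R)
      have "\<forall>\<^sub>F n in sequentially. (dist (X n) z < R n) = (dist x z < r)"
      proof (cases "dist x z < r")
        case True
        then have "\<forall>\<^sub>F n in sequentially. dist (X n) z - R n < 0" using lim by (intro order_tendstoD) auto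
        then show ?thesis by eventually_elim (use True in auto)
      next
        case False
        then have "dist x z - r > 0" using elim by auto
        then have "\<forall>\<^sub>F n in sequentially. dist (X n) z - R n > 0" using lim by (intro order_tendstoD) auto
        then show ?thesis by eventually_elim (use False in auto)
      qed
      then have "\<forall>\<^sub>F n in sequentially. indicat_real (E \<inter> ball (X n) (R n)) z = indicat_real (E \<inter> ball x r) z"
        by eventually_elim (auto simp: indicator_def)
      then show ?case by (rule tendsto_eventually)
    qed
  qed measurable
  then show ?thesis by simp
qed

section \<open>The density ratio as a function of centre and radius\<close>

definition dens :: "'a::euclidean_space set \<Rightarrow> 'a \<Rightarrow> real \<Rightarrow> real" where
  "dens E x r = measure lebesgue (E \<inter> ball x r) / measure lebesgue (ball x r)"

lemma dens_tendsto:
  fixes E :: "'a::euclidean_space set"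
  assumes "E \<in> sets lebesgue" "X \<longlonglongrightarrow> x" "R \<longlonglongrightarrow> r" "r > 0"
  shows "(\<lambda>n. dens E (X n) (R n)) \<longlonglongrightarrow> dens E x r"
  unfolding dens_def
  using measure_Int_ball_tendsto[OF assms(1-3)] measure_Int_ball_tendsto[of UNIV, OF _ assms(2,3)] assms(4)
  by (intro tendsto_divide) auto

lemma dens_continuous_point:
  assumes "E \<in> sets lebesgue" "r > 0" shows "continuous_on UNIV (\<lambda>x. dens E x r)"
  unfolding continuous_on_sequentially o_def using dens_tendsto[OF assms(1) _ tendsto_const assms(2)] by blast

lemma dens_continuous_radius:
  assumes "E \<in> sets lebesgue" "a > 0" shows "continuous_on {a..b} (\<lambda>r. dens E x r)"
  unfolding continuous_on_sequentially o_def
proof (intro allI ballI impI, elim conjE)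
  fix R r assume "r \<in> {a..b}" "R \<longlonglongrightarrow> r"
  then show "(\<lambda>n. dens E x (R n)) \<longlonglongrightarrow> dens E x r"
    using dens_tendsto[OF assms(1) tendsto_const, of R r x] assms(2) by simp
qed

lemma dens_bounds:
  assumes "E \<in> sets lebesgue" shows "0 \<le> dens E x r" "dens E x r \<le> 1"
proof -
  have "measure lebesgue (E \<inter> ball x r) \<le> measure lebesgue (ball x r)"
    using assms by (intro measure_mono_fmeasurable) auto
  then show "0 \<le> dens E x r" "dens E x r \<le> 1"
    by (auto simp: dens_def divide_le_eq_1 zero_less_measure_iff)
qed

text \<open>The limit is recast with countable quantifiers and non-strict inequalities. For fixed
  \<open>r\<close> each condition is closed in \<open>y\<close>, and this survives the uncountable
  intersection over \<open>r\<close>, so only countable operations remain.\<close>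

lemma dens_set_iff:
  "y \<in> dens_set E \<alpha> \<longleftrightarrow> (\<forall>n. \<exists>m. \<forall>r\<in>{0<..<1 / real (Suc m)}. \<bar>dens E y r - \<alpha>\<bar> \<le> 1 / real (Suc n))"
proof -
  have "y \<in> dens_set E \<alpha> \<longleftrightarrow> (\<forall>e>0. \<exists>d>0. \<forall>r. 0 < r \<and> r < d \<longrightarrow> \<bar>dens E y r - \<alpha>\<bar> < e)"
    unfolding dens_set_def tendsto_iff eventually_at_right_field mem_Collect_eq dens_def[symmetric] dist_real_def
    by (auto intro!: all_cong1)
  also have "\<dots> \<longleftrightarrow> (\<forall>n. \<exists>m. \<forall>r\<in>{0<..<1 / real (Suc m)}. \<bar>dens E y r - \<alpha>\<bar> \<le> 1 / real (Suc n))"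
  proof (intro iffI allI impI)
    fix n assume *: "\<forall>e>0. \<exists>d>0. \<forall>r. 0 < r \<and> r < d \<longrightarrow> \<bar>dens E y r - \<alpha>\<bar> < e"
    have "1 / real (Suc n) > 0" by simp
    with * obtain d where d: "d > 0" "\<And>r. 0 < r \<Longrightarrow> r < d \<Longrightarrow> \<bar>dens E y r - \<alpha>\<bar> < 1 / real (Suc n)" by blast
    obtain m where m: "1 / real (Suc m) < d" using reals_Archimedean[OF d(1)] by (auto simp: inverse_eq_divide)
    show "\<exists>m. \<forall>r\<in>{0<..<1 / real (Suc m)}. \<bar>dens E y r - \<alpha>\<bar> \<le> 1 / real (Suc n)"
      by (rule exI[of _ m]) (use d(2) m in \<open>auto intro!: less_imp_le simp del: of_nat_Suc\<close>)
  next
    fix e :: real assume *: "\<forall>n. \<exists>m. \<forall>r\<in>{0<..<1 / real (Suc m)}. \<bar>dens E y r - \<alpha>\<bar> \<le> 1 / real (Suc n)" and "e > 0"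
    obtain n where n: "1 / real (Suc n) < e" using reals_Archimedean[OF \<open>e > 0\<close>] by (auto simp: inverse_eq_divide)
    obtain m where m: "\<And>r. r\<in>{0<..<1 / real (Suc m)} \<Longrightarrow> \<bar>dens E y r - \<alpha>\<bar> \<le> 1 / real (Suc n)" using * by blast
    show "\<exists>d>0. \<forall>r. 0 < r \<and> r < d \<longrightarrow> \<bar>dens E y r - \<alpha>\<bar> < e"
    proof (intro exI[of _ "1 / real (Suc m)"] conjI allI impI)
      fix r assume "0 < r \<and> r < 1 / real (Suc m)"
      then have "\<bar>dens E y r - \<alpha>\<bar> \<le> 1 / real (Suc n)" using m by simp
      then show "\<bar>dens E y r - \<alpha>\<bar> < e" using n by linarith
    qed simp
  qed
  finally show ?thesis .
qed

lemma dens_set_borel: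
  assumes "E \<in> sets lebesgue" shows "dens_set E \<alpha> \<in> sets borel"
proof -
  have "dens_set E \<alpha> = (\<Inter>n. \<Union>m. \<Inter>r\<in>{0<..<1 / real (Suc m)}. {y. \<bar>dens E y r - \<alpha>\<bar> \<le> 1 / real (Suc n)})"
    using dens_set_iff[of _ E \<alpha>] by auto
  moreover have "closed {y. \<bar>dens E y r - \<alpha>\<bar> \<le> c}" if "r > 0" for r c
    by (intro closed_Collect_le continuous_intros dens_continuous_point[OF assms that])
  then have "closed (\<Inter>r\<in>{0<..<1 / real (Suc m)}. {y. \<bar>dens E y r - \<alpha>\<bar> \<le> 1 / real (Suc n)})" for m n
    by (intro closed_INT) auto
  then have "(\<Union>m. \<Inter>r\<in>{0<..<1 / real (Suc m)}. {y. \<bar>dens E y r - \<alpha>\<bar> \<le> 1 / real (Suc n)}) \<in> sets borel" for n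
    by (intro sets.countable_UN) (auto intro: borel_closed)
  ultimately show ?thesis by (simp only:) (intro sets.countable_INT, auto)
qed

lemma meas_boundary_borel:
  assumes "E \<in> sets lebesgue" shows "meas_boundary E \<in> sets borel"
  unfolding meas_boundary_def using dens_set_borel[OF assms] by auto

text \<open>Intermediate density is asked only along some radii tending to 0, which is what
  membership in the measure-theoretic boundary yields. The strict inequalities make each condition
  open in \<open>x\<close>, so the set is a \<open>G_\<delta>\<close>.\<close>

definition mid_dens :: "'a::euclidean_space set \<Rightarrow> real \<Rightarrow> 'a set" where
  "mid_dens E c = {x. \<forall>n. \<exists>r>0. r < 1 / real (Suc n) \<and> c < dens E x r \<and> dens E x r < 1 - c}"

lemma mid_dens_borel:
  assumes "E \<in> sets lebesgue" shows "mid_dens E c \<in> sets borel"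
proof -
  have "mid_dens E c = (\<Inter>n. \<Union>r\<in>{0<..<1 / real (Suc n)}. {x. c < dens E x r} \<inter> {x. dens E x r < 1 - c})"
    unfolding mid_dens_def by (auto simp: Bex_def)
  moreover have "open ({x. c < dens E x r} \<inter> {x. dens E x r < 1 - c})" if "r > 0" for r
    by (intro open_Int open_Collect_less continuous_intros dens_continuous_point[OF assms that])
  then have "open (\<Union>r\<in>{0<..<1 / real (Suc n)}. {x. c < dens E x r} \<inter> {x. dens E x r < 1 - c})" for n
    by (intro open_UN) auto
  ultimately show ?thesis by (simp only:) (intro sets.countable_INT, auto)
qed

text \<open>Failure of density 0 supplies small radii \<open>s\<close> with a ratio that is not
  small, failure of density 1 small radii \<open>t\<close> with a ratio that is not near one. If
  neither ratio is itself intermediate, the ratio passes from at least 3/4 to at most 1/4 between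
  them and equals 1/2 at some radius.\<close>

lemma meas_boundary_subset_mid_dens:
  assumes "E \<in> sets lebesgue"
  shows "meas_boundary E \<subseteq> (\<Union>n. mid_dens E (1 / real (Suc n)))"
proof
  fix x assume "x \<in> meas_boundary E"
  then have "x \<notin> dens_set E 0" "x \<notin> dens_set E 1" by (auto simp: meas_boundary_def)
  then obtain n0 n1 where n0: "\<And>m. \<exists>r\<in>{0<..<1 / real (Suc m)}. \<bar>dens E x r - 0\<bar> > 1 / real (Suc n0)"
    and n1: "\<And>m. \<exists>r\<in>{0<..<1 / real (Suc m)}. \<bar>dens E x r - 1\<bar> > 1 / real (Suc n1)"
    unfolding dens_set_iff by (auto simp: not_le simp del: of_nat_Suc)
  \<comment> \<open>The entry 3 forces \<open>1 / (n + 1) \<le> 1 / 4\<close>, so that ratios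
    outside the window are beyond 3/4 or below 1/4 and the value 1/2 lies inside it.\<close>
  define n where "n = max 3 (max n0 n1)"
  have "1 / real (Suc n) \<le> 1 / real (Suc n0)" "1 / real (Suc n) \<le> 1 / real (Suc n1)" "1 / real (Suc n) \<le> 1 / 4"
    by (auto simp: n_def field_simps)
  note le = this
  have "x \<in> mid_dens E (1 / real (Suc n))"
    unfolding mid_dens_def mem_Collect_eq
  proof
    fix m
    obtain s where s: "0 < s" "s < 1 / real (Suc m)" "1 / real (Suc n) < dens E x s"
      using n0[of m] le(1) dens_bounds[OF assms] by (force simp del: of_nat_Suc)
    obtain t where t: "0 < t" "t < 1 / real (Suc m)" "dens E x t < 1 - 1 / real (Suc n)"
    proof -
      obtain t where t: "t \<in> {0<..<1 / real (Suc m)}" "\<bar>dens E x t - 1\<bar> > 1 / real (Suc n1)" using n1 by blast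
      then have "dens E x t < 1 - 1 / real (Suc n)" using le(2) dens_bounds(2)[OF assms, of x t] by linarith
      then show ?thesis using t that by auto
    qed
    consider "dens E x s < 1 - 1 / real (Suc n)" | "1 / real (Suc n) < dens E x t"
      | "dens E x s \<ge> 3/4" "dens E x t \<le> 1/4"
      using le(3) by linarith
    then show "\<exists>r>0. r < 1 / real (Suc m) \<and> 1 / real (Suc n) < dens E x r \<and> dens E x r < 1 - 1 / real (Suc n)"
    proof cases
      case 3
      have "\<exists>r\<ge>min s t. r \<le> max s t \<and> dens E x r = 1/2"
      proof (cases "s \<le> t")
        case True
        then show ?thesis
          using IVT2'[of "dens E x" t "1/2" s] dens_continuous_radius[OF assms s(1), of t x] 3 by auto
      next
        case False
        then show ?thesis
          using IVT'[of "dens E x" t "1/2" s] dens_continuous_radius[OF assms t(1), of s x] 3 by auto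
      qed
      then obtain r where "r \<ge> min s t" "r \<le> max s t" "dens E x r = 1/2" by blast
      moreover have "min s t > 0" "max s t < 1 / real (Suc m)" using s t by auto
      ultimately show ?thesis using le(3) by (intro exI[of _ r]) linarith
    qed (use s t in blast)+
  qed
  then show "x \<in> (\<Union>n. mid_dens E (1 / real (Suc n)))" by blast
qed

text \<open>The fundamental theorem of calculus along the segment, whose length is at most
  \<open>2 * r\<close>. Convexity keeps the segment in the ball, so the indicator is inserted at no
  cost; it confines the gradient to the ball once integration runs over the whole space.\<close>

lemma segment_difference_bound:
  fixes v :: "'a::euclidean_space \<Rightarrow> real"
  assumes "smooth v" and y: "y \<in> ball x r" and z: "z \<in> ball x r"
  shows "ennreal \<bar>v y - v z\<bar> \<le> (\<integral>\<^sup>+t. indicator {0..1} t *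
      ennreal (2 * r * (indicator (ball x r) (z + t *\<^sub>R (y - z)) * norm (grad v (z + t *\<^sub>R (y - z))))) \<partial>lborel)"
proof -
  note [measurable] = grad_borel[OF assms(1)]
  define f where "f t = grad v (z + t *\<^sub>R (y - z)) \<bullet> (y - z)" for t
  have d: "DERIV (\<lambda>t. v (z + t *\<^sub>R (y - z))) t :> f t" for t
  proof -
    have "((\<lambda>t. v (z + t *\<^sub>R (y - z))) has_derivative (\<lambda>h. grad v (z + t *\<^sub>R (y - z)) \<bullet> (h *\<^sub>R (y - z)))) (at t)"
      by (rule has_derivative_compose[OF _ smooth_has_derivative[OF assms(1)], of "\<lambda>t. z + t *\<^sub>R (y - z)"])
        (auto intro!: derivative_eq_intros)
    then show ?thesis unfolding has_field_derivative_def f_def by (simp add: mult.commute[of _ "_ \<bullet> _"])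
  qed
  have c: "continuous_on UNIV f"
    unfolding f_def by (intro continuous_intros continuous_on_compose2[OF grad_continuous[OF assms(1), of UNIV]]) auto
  have hb: "has_bochner_integral lborel (\<lambda>t. f t * indicator {0..1} t) (v (z + 1 *\<^sub>R (y - z)) - v (z + 0 *\<^sub>R (y - z)))"
    by (rule has_bochner_integral_FTC_Icc_real) (use d c in \<open>auto simp: continuous_on_eq_continuous_at\<close>)
  then have "ennreal \<bar>v y - v z\<bar> = ennreal (norm (LINT t|lborel. f t * indicator {0..1} t))"
    by (simp add: has_bochner_integral_integral_eq)
  also have "\<dots> \<le> (\<integral>\<^sup>+t. ennreal (norm (f t * indicator {0..1} t)) \<partial>lborel)"
    using hb by (intro integral_norm_bound_ennreal) (auto simp: has_bochner_integral_iff)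
  also have "\<dots> \<le> (\<integral>\<^sup>+t. indicator {0..1} t *
      ennreal (2 * r * (indicator (ball x r) (z + t *\<^sub>R (y - z)) * norm (grad v (z + t *\<^sub>R (y - z))))) \<partial>lborel)"
  proof (rule nn_integral_mono)
    fix t :: real
    show "ennreal (norm (f t * indicator {0..1} t)) \<le> indicator {0..1} t *
      ennreal (2 * r * (indicator (ball x r) (z + t *\<^sub>R (y - z)) * norm (grad v (z + t *\<^sub>R (y - z)))))"
    proof (cases "t \<in> {0..1}")
      case True
      have "(1 - t) *\<^sub>R z + t *\<^sub>R y \<in> ball x r"
        using convexD[OF convex_ball z y, of "1 - t" t] True by auto
      then have inB: "z + t *\<^sub>R (y - z) \<in> ball x r" by (simp add: algebra_simps)
      have "norm (y - z) \<le> 2 * r"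
        using y z dist_triangle[of y z x] by (auto simp: dist_norm norm_minus_commute)
      then have "\<bar>f t\<bar> \<le> norm (grad v (z + t *\<^sub>R (y - z))) * (2 * r)"
        unfolding f_def by (intro order_trans[OF Cauchy_Schwarz_ineq2] mult_left_mono) auto
      then show ?thesis using True inB by (auto simp: mult.commute intro: ennreal_leI)
    qed simp
  qed
  finally show ?thesis .
qed

text \<open>For fixed \<open>t\<close> the substitution \<open>w = z + t (y - z)\<close> has
  Jacobian \<open>t^DIM\<close> in \<open>y\<close> and \<open>(1 - t)^DIM\<close> in
  \<open>z\<close>. One of \<open>t\<close> and \<open>1 - t\<close> is at least 1/2, so integrating
  first over the corresponding variable costs at most \<open>2 ^ DIM('a)\<close>, uniformly in
  \<open>t\<close>.\<close>

lemma poincare_ball: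
  fixes v :: "'a::euclidean_space \<Rightarrow> real" and x :: 'a
  assumes sm: "smooth v" and r: "r > 0"
  defines "B \<equiv> ball x r"
  shows "(\<integral>\<^sup>+y. \<integral>\<^sup>+z. indicator B y * (indicator B z * ennreal \<bar>v y - v z\<bar>) \<partial>lborel \<partial>lborel)
     \<le> ennreal (2 * r * 2 ^ DIM('a)) * (emeasure lborel B * (\<integral>\<^sup>+w. indicator B w * ennreal (norm (grad v w)) \<partial>lborel))"
proof -
  note [measurable] = grad_borel[OF sm] smooth_borel[OF sm]
  have [measurable]: "B \<in> sets borel" by (simp add: B_def)
  define H where "H w = ennreal (2 * r) * (indicator B w * ennreal (norm (grad v w)))" for w
  have [measurable]: "H \<in> borel_measurable borel" unfolding H_def by measurable
  define I where "I = (\<integral>\<^sup>+w. H w \<partial>lborel)"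
  define f where "f y z t = indicator B y * (indicator B z * (indicator {0..1::real} t * H (z + t *\<^sub>R (y - z))))" for y z t
  have [measurable]: "(\<lambda>p. f (fst (fst p)) (snd (fst p)) (snd p)) \<in> borel_measurable ((lborel \<Otimes>\<^sub>M lborel) \<Otimes>\<^sub>M lborel)"
    unfolding f_def by measurable
  have sc: "(\<integral>\<^sup>+w. H (a + s *\<^sub>R w) \<partial>lborel) \<le> 2 ^ DIM('a) * I" if "s \<ge> 1/2" for a s
  proof -
    have "I = ennreal (\<bar>s\<bar> ^ DIM('a)) * (\<integral>\<^sup>+w. H (a + s *\<^sub>R w) \<partial>lborel)"
      unfolding I_def using that by (intro nn_integral_affine) auto
    then have "2 ^ DIM('a) * I = ennreal (2 ^ DIM('a) * \<bar>s\<bar> ^ DIM('a)) * (\<integral>\<^sup>+w. H (a + s *\<^sub>R w) \<partial>lborel)"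
      by (simp add: ennreal_mult mult.assoc ennreal_power[symmetric] flip: ennreal_numeral)
    moreover have "1 \<le> 2 ^ DIM('a) * \<bar>s\<bar> ^ DIM('a)"
      using that one_le_power[of "2 * s" "DIM('a)"] by (simp add: power_mult_distrib)
    then have "ennreal 1 * (\<integral>\<^sup>+w. H (a + s *\<^sub>R w) \<partial>lborel) \<le> ennreal (2 ^ DIM('a) * \<bar>s\<bar> ^ DIM('a)) * (\<integral>\<^sup>+w. H (a + s *\<^sub>R w) \<partial>lborel)"
      by (intro mult_right_mono ennreal_leI) auto
    ultimately show ?thesis by simp
  qed
  have step: "(\<integral>\<^sup>+y. \<integral>\<^sup>+z. f y z t \<partial>lborel \<partial>lborel) \<le> indicator {0..1} t * (emeasure lborel B * (2 ^ DIM('a) * I))" for t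
  proof (cases "t \<in> {0..1}")
    case False then show ?thesis by (simp add: f_def)
  next
    case True
    have one: "(\<integral>\<^sup>+y. indicator B y * (2 ^ DIM('a) * I) \<partial>lborel) = emeasure lborel B * (2 ^ DIM('a) * I)"
      by (simp add: nn_integral_multc)
    show ?thesis
    proof (cases "t \<le> 1/2")
      case t: True
      have "(\<integral>\<^sup>+z. f y z t \<partial>lborel) \<le> indicator B y * (2 ^ DIM('a) * I)" for y
      proof -
        have "(\<integral>\<^sup>+z. f y z t \<partial>lborel) \<le> (\<integral>\<^sup>+z. indicator B y * H (t *\<^sub>R y + (1 - t) *\<^sub>R z) \<partial>lborel)"
          by (intro nn_integral_mono) (auto simp: f_def indicator_def algebra_simps)
        also have "\<dots> = indicator B y * (\<integral>\<^sup>+z. H (t *\<^sub>R y + (1 - t) *\<^sub>R z) \<partial>lborel)"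
          by (simp add: nn_integral_cmult)
        also have "\<dots> \<le> indicator B y * (2 ^ DIM('a) * I)" using t by (intro mult_left_mono sc) auto
        finally show ?thesis .
      qed
      then have "(\<integral>\<^sup>+y. \<integral>\<^sup>+z. f y z t \<partial>lborel \<partial>lborel) \<le> (\<integral>\<^sup>+y. indicator B y * (2 ^ DIM('a) * I) \<partial>lborel)"
        by (intro nn_integral_mono)
      then show ?thesis using True one by simp
    next
      case t: False
      have "(\<integral>\<^sup>+y. \<integral>\<^sup>+z. f y z t \<partial>lborel \<partial>lborel) = (\<integral>\<^sup>+z. \<integral>\<^sup>+y. f y z t \<partial>lborel \<partial>lborel)"
        by (rule lborel_pair.Fubini') (simp add: f_def)
      moreover have "(\<integral>\<^sup>+y. f y z t \<partial>lborel) \<le> indicator B z * (2 ^ DIM('a) * I)" for z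
      proof -
        have "(\<integral>\<^sup>+y. f y z t \<partial>lborel) \<le> (\<integral>\<^sup>+y. indicator B z * H ((1 - t) *\<^sub>R z + t *\<^sub>R y) \<partial>lborel)"
          by (intro nn_integral_mono) (auto simp: f_def indicator_def algebra_simps)
        also have "\<dots> = indicator B z * (\<integral>\<^sup>+y. H ((1 - t) *\<^sub>R z + t *\<^sub>R y) \<partial>lborel)"
          by (simp add: nn_integral_cmult)
        also have "\<dots> \<le> indicator B z * (2 ^ DIM('a) * I)" using t by (intro mult_left_mono sc) auto
        finally show ?thesis .
      qed
      then have "(\<integral>\<^sup>+z. \<integral>\<^sup>+y. f y z t \<partial>lborel \<partial>lborel) \<le> (\<integral>\<^sup>+y. indicator B y * (2 ^ DIM('a) * I) \<partial>lborel)"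
        by (intro nn_integral_mono)
      ultimately show ?thesis using True one by simp
    qed
  qed
  have "(\<integral>\<^sup>+y. \<integral>\<^sup>+z. indicator B y * (indicator B z * ennreal \<bar>v y - v z\<bar>) \<partial>lborel \<partial>lborel)
      \<le> (\<integral>\<^sup>+y. \<integral>\<^sup>+z. \<integral>\<^sup>+t. f y z t \<partial>lborel \<partial>lborel \<partial>lborel)"
  proof (intro nn_integral_mono)
    fix y z :: 'a
    show "indicator B y * (indicator B z * ennreal \<bar>v y - v z\<bar>) \<le> (\<integral>\<^sup>+t. f y z t \<partial>lborel)"
    proof (cases "y \<in> B \<and> z \<in> B")
      case True
      then have "ennreal \<bar>v y - v z\<bar> \<le> (\<integral>\<^sup>+t. f y z t \<partial>lborel)"
        using segment_difference_bound[OF sm, of y x r z] r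
        by (auto simp: f_def H_def B_def ennreal_mult ennreal_indicator)
      then show ?thesis using True by simp
    qed auto
  qed
  also have "\<dots> = (\<integral>\<^sup>+y. \<integral>\<^sup>+t. \<integral>\<^sup>+z. f y z t \<partial>lborel \<partial>lborel \<partial>lborel)"
    by (intro nn_integral_cong lborel_pair.Fubini') (simp add: f_def)
  also have "\<dots> = (\<integral>\<^sup>+t. \<integral>\<^sup>+y. \<integral>\<^sup>+z. f y z t \<partial>lborel \<partial>lborel \<partial>lborel)"
    by (rule lborel_pair.Fubini') (simp add: f_def)
  also have "\<dots> \<le> (\<integral>\<^sup>+t. indicator {0..1::real} t * (emeasure lborel B * (2 ^ DIM('a) * I)) \<partial>lborel)"
    by (intro nn_integral_mono step)
  also have "\<dots> = emeasure lborel B * (2 ^ DIM('a) * I)"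
    by (simp add: nn_integral_multc)
  also have "\<dots> = ennreal (2 * r * 2 ^ DIM('a)) * (emeasure lborel B * (\<integral>\<^sup>+w. indicator B w * ennreal (norm (grad v w)) \<partial>lborel))"
  proof -
    have "I = ennreal (2 * r) * (\<integral>\<^sup>+w. indicator B w * ennreal (norm (grad v w)) \<partial>lborel)"
      unfolding I_def H_def by (rule nn_integral_cmult) measurable
    then show ?thesis
      using r by (simp add: ennreal_mult ennreal_power[symmetric] mult_ac flip: ennreal_numeral)
  qed
  finally show ?thesis .
qed

section \<open>Cutoff functions with controlled gradient mass\<close>

context mollifier_kernel begin

text \<open>One fixed profile is rescaled: the gradient gains \<open>1 / s\<close> and the volume
  \<open>s ^ DIM('a)\<close>, which leaves the scaling of a perimeter.\<close>

lemma ball_cutoff: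
  obtains L where "L \<ge> 0" "\<And>(a::'a) s. s > 0 \<Longrightarrow> \<exists>\<eta>. smooth \<eta> \<and> (\<forall>x. 0 \<le> \<eta> x \<and> \<eta> x \<le> 1) \<and>
      (\<forall>x\<in>ball a s. \<eta> x = 1) \<and> (\<forall>x. x \<notin> cball a (3 * s) \<longrightarrow> \<eta> x = 0) \<and>
      (\<integral>\<^sup>+x. ennreal (norm (grad \<eta> x)) \<partial>lborel) \<le> ennreal (L * s ^ (DIM('a) - 1))"
proof -
  \<comment> \<open>Mollifying the indicator of the ball of radius 2 at scale 1 leaves the value 1
    on the unit ball and the value 0 off the ball of radius 3.\<close>
  define h where "h = conv (indicator (ball (0::'a) 2)) (moll_eps \<rho> 1)"
  have sm: "smooth h"
    unfolding h_def by (intro smooth_conv_eps integrable_indicator_bounded) auto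
  note [measurable] = smooth_borel[OF sm] grad_borel[OF sm]
  have h01: "0 \<le> h x" "h x \<le> 1" for x
    unfolding h_def using conv_eps_bounds[of 1 "indicator (ball (0::'a) 2)" x 0 1]
      borel_measurable_indicator[of "ball (0::'a) 2" borel] by auto
  have h1: "h x = 1" if "norm x < 1" for x
    unfolding h_def
  proof (rule conv_eps_const)
    fix y assume "y \<in> ball x 1"
    then have "dist x y < 1" by simp
    moreover have "norm y \<le> norm x + dist x y" unfolding dist_norm by (metis norm_minus_commute norm_triangle_sub)
    ultimately show "indicat_real (ball 0 2) y = 1" using that by simp
  qed (auto intro!: borel_measurable_indicator)
  have h0: "h x = 0" if "x \<notin> cball 0 3" for x
    unfolding h_def
  proof (rule conv_eps_const)
    fix y assume "y \<in> ball x 1"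
    then have "dist x y < 1" by simp
    moreover have "norm x \<le> norm y + dist x y" unfolding dist_norm by (rule norm_triangle_sub)
    ultimately show "indicat_real (ball 0 2) y = 0" using that by simp
  qed (auto intro!: borel_measurable_indicator)
  have g0: "grad h x = 0" if "x \<notin> cball 0 3" for x
    by (rule grad_zero_outside[OF closed_cball h0 that])
  obtain B where B: "\<And>x. norm (grad h x) \<le> B"
    using compact_support_bounded[OF grad_continuous[OF sm] compact_cball g0] by blast
  have ih: "integrable lborel (grad h)"
    by (rule integrable_bounded_support[OF _ compact_cball g0 B]) measurable
  define L where "L = (LINT x|lborel. norm (grad h x))"
  have L: "(\<integral>\<^sup>+x. ennreal (norm (grad h x)) \<partial>lborel) = ennreal L"
    unfolding L_def by (rule nn_integral_eq_integral) (use ih in auto)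
  have L0: "L \<ge> 0" by (simp add: L_def)
  show ?thesis
  proof (rule that[OF L0])
    fix a :: 'a and s :: real assume s: "s > 0"
    define \<eta> where "\<eta> y = 1 * h ((- 1 / s) *\<^sub>R a + (1 / s) *\<^sub>R y)" for y
    have arg: "(- 1 / s) *\<^sub>R a + (1 / s) *\<^sub>R y = (1 / s) *\<^sub>R (y - a)" for y
      by (simp add: scaleR_diff_right)
    have nrm: "norm ((- 1 / s) *\<^sub>R a + (1 / s) *\<^sub>R y) = dist a y / s" for y
      unfolding arg using s by (simp add: dist_norm norm_minus_commute)
    have se: "smooth \<eta>" unfolding \<eta>_def by (rule smooth_affine[OF sm])
    have ge: "grad \<eta> y = (1 / s) *\<^sub>R grad h ((- 1 / s) *\<^sub>R a + (1 / s) *\<^sub>R y)" for y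
    proof (rule euclidean_eqI)
      fix b :: 'a assume "b \<in> Basis"
      then show "grad \<eta> y \<bullet> b = ((1 / s) *\<^sub>R grad h ((- 1 / s) *\<^sub>R a + (1 / s) *\<^sub>R y)) \<bullet> b"
        using pd_affine[OF smooth_differentiable[OF sm], of b 1 "(- 1 / s) *\<^sub>R a" "1 / s"]
        unfolding \<eta>_def by (simp only: grad_inner_Basis inner_scaleR_left mult_1)
    qed
    have "ennreal L = ennreal ((1 / s) ^ DIM('a)) * (\<integral>\<^sup>+y. ennreal (norm (grad h ((- 1 / s) *\<^sub>R a + (1 / s) *\<^sub>R y))) \<partial>lborel)"
      unfolding L[symmetric] using s
      by (subst nn_integral_affine[of "\<lambda>x. ennreal (norm (grad h x))" "1 / s" "(- 1 / s) *\<^sub>R a"]) auto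
    then have "ennreal (s ^ DIM('a)) * ennreal L = ennreal (s ^ DIM('a) * (1 / s) ^ DIM('a)) * (\<integral>\<^sup>+y. ennreal (norm (grad h ((- 1 / s) *\<^sub>R a + (1 / s) *\<^sub>R y))) \<partial>lborel)"
      using s by (simp add: ennreal_mult mult.assoc)
    also have "s ^ DIM('a) * (1 / s) ^ DIM('a) = 1" using s by (simp flip: power_mult_distrib)
    finally have e1: "(\<integral>\<^sup>+y. ennreal (norm (grad h ((- 1 / s) *\<^sub>R a + (1 / s) *\<^sub>R y))) \<partial>lborel) = ennreal (s ^ DIM('a) * L)"
      using s L0 by (simp add: ennreal_mult)
    have "(\<integral>\<^sup>+y. ennreal (norm (grad \<eta> y)) \<partial>lborel) = (\<integral>\<^sup>+y. ennreal (1 / s) * ennreal (norm (grad h ((- 1 / s) *\<^sub>R a + (1 / s) *\<^sub>R y))) \<partial>lborel)"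
      unfolding ge using s by (intro nn_integral_cong) (simp add: ennreal_mult[symmetric])
    also have "\<dots> = ennreal (1 / s) * ennreal (s ^ DIM('a) * L)"
      by (subst nn_integral_cmult) (simp_all only: e1, measurable)
    also have "\<dots> = ennreal (1 / s * (s ^ DIM('a) * L))"
      using s L0 by (simp add: ennreal_mult[symmetric])
    also have "1 / s * (s ^ DIM('a) * L) = L * s ^ (DIM('a) - 1)"
      using s by (simp add: power_eq_if[of s "DIM('a)"])
    finally have int: "(\<integral>\<^sup>+x. ennreal (norm (grad \<eta> x)) \<partial>lborel) \<le> ennreal (L * s ^ (DIM('a) - 1))" by simp
    show "\<exists>\<eta>. smooth \<eta> \<and> (\<forall>x. 0 \<le> \<eta> x \<and> \<eta> x \<le> 1) \<and>
      (\<forall>x\<in>ball a s. \<eta> x = 1) \<and> (\<forall>x. x \<notin> cball a (3 * s) \<longrightarrow> \<eta> x = 0) \<and>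
      (\<integral>\<^sup>+x. ennreal (norm (grad \<eta> x)) \<partial>lborel) \<le> ennreal (L * s ^ (DIM('a) - 1))"
    proof (intro exI[of _ \<eta>] conjI allI ballI impI se int)
      fix y
      show "0 \<le> \<eta> y" "\<eta> y \<le> 1" by (simp_all add: \<eta>_def h01)
      show "\<eta> y = 1" if "y \<in> ball a s"
        unfolding \<eta>_def using h1[of "(- 1 / s) *\<^sub>R a + (1 / s) *\<^sub>R y"] that s unfolding nrm by (simp add: divide_less_eq)
      show "\<eta> y = 0" if "y \<notin> cball a (3 * s)"
      proof -
        have "\<not> dist a y / s \<le> 3" using that s by (simp add: divide_le_eq)
        then have "(- 1 / s) *\<^sub>R a + (1 / s) *\<^sub>R y \<notin> cball 0 3"
          unfolding mem_cball_0 nrm .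
        then have "h ((- 1 / s) *\<^sub>R a + (1 / s) *\<^sub>R y) = 0" by (rule h0)
        then show ?thesis unfolding \<eta>_def by (simp only: mult_1)
      qed
    qed
  qed
qed

text \<open>Cutoffs are merged by \<open>p + q - p q = 1 - (1 - p) (1 - q)\<close>, a smooth
  substitute for the maximum: it stays in the unit interval, is 1 wherever one factor is, and its
  gradient is bounded by the sum of the two gradients.\<close>

lemma union_cutoff:
  obtains L where "L \<ge> 0" "\<And>(I::'a set) s. finite I \<Longrightarrow> (\<And>a. a \<in> I \<Longrightarrow> s a > 0) \<Longrightarrow>
      \<exists>\<psi>. smooth \<psi> \<and> (\<forall>x. 0 \<le> \<psi> x \<and> \<psi> x \<le> 1) \<and>
      (\<forall>a\<in>I. \<forall>x\<in>ball a (s a). \<psi> x = 1) \<and> (\<forall>x. x \<notin> (\<Union>a\<in>I. cball a (3 * s a)) \<longrightarrow> \<psi> x = 0) \<and>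
      (\<integral>\<^sup>+x. ennreal (norm (grad \<psi> x)) \<partial>lborel) \<le> ennreal (L * (\<Sum>a\<in>I. s a ^ (DIM('a) - 1)))"
proof -
  obtain L where L: "L \<ge> 0" "\<And>(a::'a) s. s > 0 \<Longrightarrow> \<exists>\<eta>. smooth \<eta> \<and> (\<forall>x. 0 \<le> \<eta> x \<and> \<eta> x \<le> 1) \<and>
      (\<forall>x\<in>ball a s. \<eta> x = 1) \<and> (\<forall>x. x \<notin> cball a (3 * s) \<longrightarrow> \<eta> x = 0) \<and>
      (\<integral>\<^sup>+x. ennreal (norm (grad \<eta> x)) \<partial>lborel) \<le> ennreal (L * s ^ (DIM('a) - 1))"
    using ball_cutoff by blast
  show ?thesis
  proof (rule that[OF L(1)])
    fix I :: "'a set" and s :: "'a \<Rightarrow> real" assume "finite I" "\<And>a. a \<in> I \<Longrightarrow> s a > 0"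
    then show "\<exists>\<psi>. smooth \<psi> \<and> (\<forall>x. 0 \<le> \<psi> x \<and> \<psi> x \<le> 1) \<and>
      (\<forall>a\<in>I. \<forall>x\<in>ball a (s a). \<psi> x = 1) \<and> (\<forall>x. x \<notin> (\<Union>a\<in>I. cball a (3 * s a)) \<longrightarrow> \<psi> x = 0) \<and>
      (\<integral>\<^sup>+x. ennreal (norm (grad \<psi> x)) \<partial>lborel) \<le> ennreal (L * (\<Sum>a\<in>I. s a ^ (DIM('a) - 1)))"
    proof (induction rule: finite_induct)
      case empty
      have "grad (\<lambda>x::'a. 0) x = 0" for x by (rule grad_eqI) simp
      then show ?case by (intro exI[of _ "\<lambda>x. 0"]) (simp add: smooth_const)
    next
      case (insert b I)
      from insert.IH[OF insert.prems] obtain p where p: "smooth p" "\<And>x. 0 \<le> p x \<and> p x \<le> 1"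
        "\<And>a x. a \<in> I \<Longrightarrow> x \<in> ball a (s a) \<Longrightarrow> p x = 1" "\<And>x. x \<notin> (\<Union>a\<in>I. cball a (3 * s a)) \<Longrightarrow> p x = 0"
        "(\<integral>\<^sup>+x. ennreal (norm (grad p x)) \<partial>lborel) \<le> ennreal (L * (\<Sum>a\<in>I. s a ^ (DIM('a) - 1)))"
        by auto
      have sb: "s b > 0" using insert.prems by simp
      from L(2)[OF this, of b] obtain q where q: "smooth q" "\<And>x. 0 \<le> q x \<and> q x \<le> 1"
        "\<And>x. x \<in> ball b (s b) \<Longrightarrow> q x = 1" "\<And>x. x \<notin> cball b (3 * s b) \<Longrightarrow> q x = 0"
        "(\<integral>\<^sup>+x. ennreal (norm (grad q x)) \<partial>lborel) \<le> ennreal (L * s b ^ (DIM('a) - 1))"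
        by auto
      note [measurable] = grad_borel[OF p(1)] grad_borel[OF q(1)]
      define w where "w x = (p x + q x) - p x * q x" for x
      have ws: "smooth w" unfolding w_def by (intro smooth_diff smooth_add smooth_mult p q)
      have "grad w x = (1 - q x) *\<^sub>R grad p x + (1 - p x) *\<^sub>R grad q x" for x
        unfolding w_def by (subst grad_diff) (auto intro: smooth_add smooth_mult p q simp: grad_add grad_mult p q algebra_simps)
      then have "norm (grad w x) \<le> norm (grad p x) + norm (grad q x)" for x
        using norm_triangle_ineq[of "(1 - q x) *\<^sub>R grad p x" "(1 - p x) *\<^sub>R grad q x"]
          mult_right_mono[of "\<bar>1 - q x\<bar>" 1 "norm (grad p x)"] mult_right_mono[of "\<bar>1 - p x\<bar>" 1 "norm (grad q x)"]
          p(2)[of x] q(2)[of x] by simp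
      then have "(\<integral>\<^sup>+x. ennreal (norm (grad w x)) \<partial>lborel) \<le> (\<integral>\<^sup>+x. ennreal (norm (grad p x)) + ennreal (norm (grad q x)) \<partial>lborel)"
        by (intro nn_integral_mono) (simp add: ennreal_leI flip: ennreal_plus)
      also have "\<dots> = (\<integral>\<^sup>+x. ennreal (norm (grad p x)) \<partial>lborel) + (\<integral>\<^sup>+x. ennreal (norm (grad q x)) \<partial>lborel)"
        by (rule nn_integral_add) measurable
      also have "\<dots> \<le> ennreal (L * (\<Sum>a\<in>I. s a ^ (DIM('a) - 1))) + ennreal (L * s b ^ (DIM('a) - 1))"
        by (intro add_mono p q)
      also have "\<dots> = ennreal (L * (\<Sum>a\<in>I. s a ^ (DIM('a) - 1)) + L * s b ^ (DIM('a) - 1))"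
        using insert.prems L(1) sb by (intro ennreal_plus[symmetric] mult_nonneg_nonneg sum_nonneg) (auto intro: less_imp_le)
      also have "L * (\<Sum>a\<in>I. s a ^ (DIM('a) - 1)) + L * s b ^ (DIM('a) - 1) = L * (\<Sum>a\<in>insert b I. s a ^ (DIM('a) - 1))"
        using insert.hyps by (simp add: distrib_left)
      finally have int: "(\<integral>\<^sup>+x. ennreal (norm (grad w x)) \<partial>lborel) \<le> ennreal (L * (\<Sum>a\<in>insert b I. s a ^ (DIM('a) - 1)))" .
      show ?case
      proof (intro exI[of _ w] conjI allI ballI impI ws int)
        fix x
        have "w x = 1 - (1 - p x) * (1 - q x)" by (simp add: w_def algebra_simps)
        moreover have "0 \<le> (1 - p x) * (1 - q x)" "(1 - p x) * (1 - q x) \<le> 1"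
          using p(2)[of x] q(2)[of x] by (auto intro!: mult_nonneg_nonneg mult_le_one)
        ultimately show "0 \<le> w x" "w x \<le> 1" by auto
        show "w x = 0" if "x \<notin> (\<Union>a\<in>insert b I. cball a (3 * s a))"
          using that p(4)[of x] q(4)[of x] by (simp add: w_def)
        fix a assume "a \<in> insert b I" "x \<in> ball a (s a)"
        then show "w x = 1" using p(3)[of a x] q(3)[of x] by (auto simp: w_def)
      qed
    qed
  qed
qed

end

section \<open>Pointwise limits at density points and lower bounds for the perimeter\<close>

context fp_set begin

lemma E_lebesgue [measurable]: "E \<in> sets lebesgue" using E_borel by simp

lemma measure_lebesgue_eq: "A \<in> sets borel \<Longrightarrow> measure lebesgue A = measure lborel A"
  by (simp add: measure_completion)

definition \<omega> :: real where "\<omega> = measure lborel (ball (0::'a) 1)"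

lemma omega_pos: "\<omega> > 0" by (simp add: \<omega>_def)

lemma content_ball_omega: "r \<ge> 0 \<Longrightarrow> measure lborel (ball (x::'a) r) = r ^ DIM('a) * \<omega>"
  unfolding \<omega>_def by (rule content_ball_conv_unit_ball)

text \<open>At scale \<open>e\<close> the kernel is at most \<open>B / e^DIM\<close>, that is
  \<open>B * \<omega>\<close> divided by the volume of the ball. Applied to \<open>E\<close> this
  gives the limit 0 at points of density zero, applied to \<open>- E\<close> the limit 1 at points
  of density one.\<close>

lemma conv_indicator_le_dens:
  assumes A[measurable]: "A \<in> sets borel" and e: "e > 0" and B: "\<And>x. \<rho> x \<le> B"
  shows "conv (indicator A) (moll_eps \<rho> e) x \<le> B * \<omega> * dens A x e"
proof -
  have em: "emeasure lborel (A \<inter> ball x e) < \<infinity>"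
    using emeasure_bounded_finite[of "A \<inter> ball x e"] by (simp add: bounded_Int)
  have "conv (indicator A) (moll_eps \<rho> e) x \<le> (LINT y|lborel. indicator (A \<inter> ball x e) y * ((1 / e) ^ DIM('a) * B))"
    unfolding conv_def
  proof (rule integral_mono)
    show "integrable lborel (\<lambda>y. indicator A y * moll_eps \<rho> e (x - y))"
      by (rule conv_eps_integrable[OF e, of _ _ 1]) (auto simp: indicator_def)
    show "integrable lborel (\<lambda>y. indicator (A \<inter> ball x e) y * ((1 / e) ^ DIM('a) * B))"
      using em by simp
    fix y
    show "indicator A y * moll_eps \<rho> e (x - y) \<le> indicator (A \<inter> ball x e) y * ((1 / e) ^ DIM('a) * B)"
    proof (cases "y \<in> ball x e")
      case True then show ?thesis using eps_bound[OF B e, of "x - y"] by (auto simp: indicator_def)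
    next
      case False then show ?thesis using eps_zero[OF e, of "x - y"] by (simp add: dist_norm)
    qed
  qed
  also have "\<dots> = measure lborel (A \<inter> ball x e) * ((1 / e) ^ DIM('a) * B)" using em by simp
  also have "\<dots> = B * \<omega> * dens A x e"
    unfolding dens_def using e omega_pos
    by (simp add: measure_lebesgue_eq content_ball_omega power_divide field_simps)
  finally show ?thesis .
qed

lemma dens_Compl: 
  assumes "r > 0" shows "dens (- E) x r = 1 - dens E x r"
proof -
  have f: "E \<inter> ball x r \<in> lmeasurable" "- E \<inter> ball x r \<in> lmeasurable"
    by (auto intro!: bounded_set_imp_lmeasurable simp: bounded_Int)
  have "measure lebesgue ((E \<inter> ball x r) \<union> (- E \<inter> ball x r)) = measure lebesgue (E \<inter> ball x r) + measure lebesgue (- E \<inter> ball x r)"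
    using f by (intro measure_Union) (auto simp: fmeasurable_def less_top)
  moreover have "(E \<inter> ball x r) \<union> (- E \<inter> ball x r) = ball x r" by blast
  ultimately have "dens E x r + dens (- E) x r = measure lebesgue (ball x r) / measure lebesgue (ball x r)"
    unfolding dens_def by (simp only: add_divide_distrib)
  then show ?thesis using assms by simp
qed

lemma dens_tendsto_inverse_Suc:
  assumes "x \<in> dens_set E \<alpha>" shows "(\<lambda>k. dens E x (1 / real (Suc k))) \<longlonglongrightarrow> \<alpha>"
proof -
  have "(dens E x \<longlongrightarrow> \<alpha>) (at_right 0)" using assms unfolding dens_set_def dens_def[abs_def] by simp
  moreover have "filterlim (\<lambda>k. 1 / real (Suc k)) (at_right 0) sequentially"
    using inverse_Suc_tendsto by (intro tendsto_imp_filterlim_at_right) auto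
  ultimately show ?thesis by (rule filterlim_compose)
qed

lemma U_tendsto_zero:
  assumes "x \<in> dens_set E 0" shows "(\<lambda>k. U k x) \<longlonglongrightarrow> 0"
proof -
  obtain B where B: "\<And>x. \<rho> x \<le> B" using rho_bounded by blast
  have "(\<lambda>k. B * \<omega> * dens E x (1 / real (Suc k))) \<longlonglongrightarrow> B * \<omega> * 0"
    by (intro tendsto_intros dens_tendsto_inverse_Suc assms)
  then have "(\<lambda>k. B * \<omega> * dens E x (1 / real (Suc k))) \<longlonglongrightarrow> 0" by simp
  moreover have "0 \<le> U k x" "U k x \<le> B * \<omega> * dens E x (1 / real (Suc k))" for k
    unfolding U_def using u_bounds conv_indicator_le_dens[OF E_borel _ B, of "1 / real (Suc k)" x] by (auto simp: u_def)
  ultimately show ?thesis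
    using tendsto_sandwich[of "\<lambda>k. 0" "\<lambda>k. U k x" sequentially "\<lambda>k. B * \<omega> * dens E x (1 / real (Suc k))" 0]
    by (simp del: of_nat_Suc)
qed

lemma U_tendsto_one:
  assumes "x \<in> dens_set E 1" shows "(\<lambda>k. U k x) \<longlonglongrightarrow> 1"
proof -
  obtain B where B: "\<And>x. \<rho> x \<le> B" using rho_bounded by blast
  have "(\<lambda>k. 1 - B * \<omega> * (1 - dens E x (1 / real (Suc k)))) \<longlonglongrightarrow> 1 - B * \<omega> * (1 - 1)"
    by (intro tendsto_intros dens_tendsto_inverse_Suc assms)
  then have l: "(\<lambda>k. 1 - B * \<omega> * (1 - dens E x (1 / real (Suc k)))) \<longlonglongrightarrow> 1" by simp
  have "U k x \<le> 1" "1 - B * \<omega> * (1 - dens E x (1 / real (Suc k))) \<le> U k x" for k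
  proof -
    define e where "e = 1 / real (Suc k)"
    have e: "e > 0" by (simp add: e_def)
    show "U k x \<le> 1" unfolding U_def by (rule u_bounds) simp
    have i: "integrable lborel (\<lambda>y. indicator A y * moll_eps \<rho> e (x - y))" if "A \<in> sets borel" for A
      by (rule conv_eps_integrable[OF e, of _ _ 1]) (use that in \<open>auto simp: indicator_def\<close>)
    have "u e x + conv (indicator (- E)) (moll_eps \<rho> e) x
       = (LINT y|lborel. indicator E y * moll_eps \<rho> e (x - y) + indicator (- E) y * moll_eps \<rho> e (x - y))"
      unfolding u_def conv_def by (rule Bochner_Integration.integral_add[symmetric, OF i i]) simp_all
    also have "\<dots> = (LINT y|lborel. moll_eps \<rho> e (x - y))"
      by (intro Bochner_Integration.integral_cong) (auto simp: indicator_def)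
    finally have "u e x = 1 - conv (indicator (- E)) (moll_eps \<rho> e) x" using eps_integral[OF e] by simp
    moreover have "conv (indicator (- E)) (moll_eps \<rho> e) x \<le> B * \<omega> * (1 - dens E x e)"
      using conv_indicator_le_dens[of "- E" e B x] e B dens_Compl[OF e, of x] by simp
    ultimately show "1 - B * \<omega> * (1 - dens E x (1 / real (Suc k))) \<le> U k x" by (simp add: U_def e_def)
  qed
  then show ?thesis
    using tendsto_sandwich[OF _ _ l tendsto_const[of 1], of "\<lambda>k. U k x"] by (simp del: of_nat_Suc)
qed

text \<open>The Poincare inequality is applied to \<open>U k\<close> on pairs with one point in
  \<open>E\<close> and one outside, where the differences tend to 1 on average. Mollification
  displaces the perimeter by less than \<open>r\<close> once \<open>1 / (k + 1) < r\<close>, hence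
  the doubled radius.\<close>

lemma relative_isoperimetric:
  assumes r: "r > 0"
  shows "measure lborel (E \<inter> ball x r) * measure lborel (ball x r - E)
     \<le> 2 * r * 2 ^ DIM('a) * (measure lborel (ball x r) * measure \<mu> (cball x (2 * r)))"
proof -
  define A where "A = E \<inter> ball x r"
  define A' where "A' = ball x r - E"
  define B where "B = ball x r"
  define C where "C = 2 * r * 2 ^ DIM('a) * (measure lborel (ball x r) * measure \<mu> (cball x (2 * r)))"
  have C0: "C \<ge> 0" using r by (simp add: C_def)
  have [measurable]: "A \<in> sets borel" "A' \<in> sets borel" "B \<in> sets borel" by (auto simp: A_def A'_def B_def)
  have fin: "emeasure lborel A < \<infinity>" "emeasure lborel A' < \<infinity>" "emeasure lborel B < \<infinity>"
    unfolding A_def A'_def B_def by (rule emeasure_bounded_finite, simp add: bounded_Int bounded_diff)+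
  have iA: "integrable lborel (indicat_real A)" "integrable lborel (indicat_real A')"
    using fin by auto
  have iAU: "integrable lborel (\<lambda>y. indicator A y * U k y)" "integrable lborel (\<lambda>y. indicator A' y * U k y)" for k
    using integrable_mult_bounded[OF iA(1), of "U k" 1] integrable_mult_bounded[OF iA(2), of "U k" 1] U_abs_le by auto
  \<comment> \<open>This is the double integral of \<open>U k y - U k z\<close> over
    \<open>A\<close> and \<open>A'\<close>, written so that \<open>U k\<close> occurs linearly in
    single integrals; the limit in \<open>k\<close> then follows from convergence in
    \<open>L^1\<close>.\<close>
  have le: "measure lborel A' * (LINT y|lborel. indicator A y * U k y) - measure lborel A * (LINT y|lborel. indicator A' y * U k y) \<le> C"
    if k: "1 / real (Suc k) < r" for k
  proof -
    have in1: "(LINT z|lborel. indicator A' z * (U k y - U k z)) = measure lborel A' * U k y - (LINT z|lborel. indicator A' z * U k z)" for y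
      using iAU(2)[of k] iA(2) by (simp add: right_diff_distrib fin)
    have "measure lborel A' * (LINT y|lborel. indicator A y * U k y) - measure lborel A * (LINT y|lborel. indicator A' y * U k y)
      = (LINT y|lborel. indicator A y * (LINT z|lborel. indicator A' z * (U k y - U k z)))"
      unfolding in1 using iAU(1)[of k] iA(1) by (simp add: right_diff_distrib mult.left_commute[of "indicator A _"] fin)
    then have "ennreal (measure lborel A' * (LINT y|lborel. indicator A y * U k y) - measure lborel A * (LINT y|lborel. indicator A' y * U k y))
      \<le> ennreal (norm (LINT y|lborel. indicator A y * (LINT z|lborel. indicator A' z * (U k y - U k z))))"
      by (intro ennreal_leI) simp
    also have "\<dots> \<le> (\<integral>\<^sup>+y. ennreal (norm (indicator A y * (LINT z|lborel. indicator A' z * (U k y - U k z)))) \<partial>lborel)"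
    proof (rule integral_norm_bound_ennreal)
      show "integrable lborel (\<lambda>y. indicator A y * (LINT z|lborel. indicator A' z * (U k y - U k z)))"
        unfolding in1 using iAU(1)[of k] iA(1)
        by (simp add: right_diff_distrib mult.left_commute[of "indicator A _"] fin)
    qed
    also have "\<dots> \<le> (\<integral>\<^sup>+y. \<integral>\<^sup>+z. indicator B y * (indicator B z * ennreal \<bar>U k y - U k z\<bar>) \<partial>lborel \<partial>lborel)"
    proof (rule nn_integral_mono)
      fix y
      have "ennreal (norm (LINT z|lborel. indicator A' z * (U k y - U k z))) \<le> (\<integral>\<^sup>+z. ennreal (norm (indicator A' z * (U k y - U k z))) \<partial>lborel)"
        using iAU(2)[of k] iA(2) by (intro integral_norm_bound_ennreal) (simp add: right_diff_distrib fin)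
      also have "\<dots> \<le> (\<integral>\<^sup>+z. (indicator B z * ennreal \<bar>U k y - U k z\<bar>) \<partial>lborel)"
        by (intro nn_integral_mono) (auto simp: A'_def B_def indicator_def)
      finally have *: "ennreal (norm (LINT z|lborel. indicator A' z * (U k y - U k z))) \<le> (\<integral>\<^sup>+z. (indicator B z * ennreal \<bar>U k y - U k z\<bar>) \<partial>lborel)" .
      show "ennreal (norm (indicator A y * (LINT z|lborel. indicator A' z * (U k y - U k z))))
         \<le> (\<integral>\<^sup>+z. indicator B y * (indicator B z * ennreal \<bar>U k y - U k z\<bar>) \<partial>lborel)"
      proof (cases "y \<in> A")
        case True
        then have "y \<in> B" by (simp add: A_def B_def)
        then show ?thesis using True * by simp
      qed simp
    qed
    also have "\<dots> \<le> ennreal (2 * r * 2 ^ DIM('a)) * (emeasure lborel B * (\<integral>\<^sup>+w. indicator B w * ennreal (norm (grad (U k) w)) \<partial>lborel))"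
      unfolding B_def by (rule poincare_ball[OF U_smooth r])
    also have "(\<integral>\<^sup>+w. indicator B w * ennreal (norm (grad (U k) w)) \<partial>lborel) \<le> (\<integral>\<^sup>+y. indicator (cball x (2 * r)) y \<partial>\<mu>)"
      unfolding U_def
    proof (rule grad_mass)
      fix w y :: 'a assume "dist w y < 1 / real (Suc k)"
      then show "indicator B w \<le> (indicator (cball x (2 * r)) y :: ennreal)"
        using k dist_triangle[of x y w] by (auto simp: B_def indicator_def)
    qed (auto intro!: borel_measurable_indicator)
    also have "(\<integral>\<^sup>+y. indicator (cball x (2 * r)) y \<partial>\<mu>) = ennreal (measure \<mu> (cball x (2 * r)))"
      by (simp add: emeasure_eq_measure)
    also have "ennreal (2 * r * 2 ^ DIM('a)) * (emeasure lborel B * ennreal (measure \<mu> (cball x (2 * r)))) = ennreal C"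
      unfolding C_def using r fin(3) emeasure_eq_ennreal_measure[of lborel B]
      by (simp add: B_def ennreal_mult less_top)
    finally have "ennreal (measure lborel A' * (LINT y|lborel. indicator A y * U k y) - measure lborel A * (LINT y|lborel. indicator A' y * U k y)) \<le> ennreal C"
      by (simp add: mult_left_mono)
    then show ?thesis using C0 by (simp add: ennreal_le_iff)
  qed
  have "(\<lambda>k. measure lborel A' * (LINT y|lborel. indicator A y * U k y) - measure lborel A * (LINT y|lborel. indicator A' y * U k y))
     \<longlonglongrightarrow> measure lborel A' * (LINT y|lborel. indicator A y * indicator E y) - measure lborel A * (LINT y|lborel. indicator A' y * indicator E y)"
    by (intro tendsto_intros U_L1_weak_lborel[of _ 1] iA) (auto simp: indicator_def)
  moreover have "(\<lambda>y. indicator A y * indicator E y) = indicat_real A" "(\<lambda>y. indicator A' y * indicat_real E y) = (\<lambda>y. 0)"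
    by (auto simp: A_def A'_def indicator_def)
  ultimately have "(\<lambda>k. measure lborel A' * (LINT y|lborel. indicator A y * U k y) - measure lborel A * (LINT y|lborel. indicator A' y * U k y))
     \<longlonglongrightarrow> measure lborel A' * measure lborel A" by simp
  moreover have "\<forall>\<^sub>F k in sequentially. measure lborel A' * (LINT y|lborel. indicator A y * U k y) - measure lborel A * (LINT y|lborel. indicator A' y * U k y) \<le> C"
    using eventually_inverse_Suc[OF r] by eventually_elim (rule le)
  ultimately have "measure lborel A' * measure lborel A \<le> C"
    by (intro tendsto_upperbound[OF _ _ sequentially_bot])
  then show ?thesis by (simp add: A_def A'_def C_def mult.commute)
qed

text \<open>With volume fractions between \<open>c\<close> and \<open>1 - c\<close>, the relative
  isoperimetric inequality reads \<open>(c b)^2 \<le> 2 r 2^DIM b \<mu>\<close> for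
  \<open>b = \<omega> r^DIM\<close>; cancelling \<open>b\<close> and one factor \<open>r\<close>
  leaves this constant.\<close>

definition iso_const :: "real \<Rightarrow> real" where
  "iso_const c = 2 ^ (DIM('a) + 1) / (c\<^sup>2 * \<omega>)"

lemma mu_lower_bound:
  assumes r: "r > 0" and c: "c > 0" and d: "c < dens E x r" "dens E x r < 1 - c"
  shows "r ^ (DIM('a) - 1) \<le> iso_const c * measure \<mu> (cball x (2 * r))"
proof -
  define b where "b = measure lborel (ball x r)"
  have b: "b = r ^ DIM('a) * \<omega>" "b > 0"
    using r omega_pos by (auto simp: b_def content_ball_omega)
  have 1: "measure lborel (E \<inter> ball x r) = dens E x r * b"
    unfolding dens_def using b(2) by (simp add: b_def measure_lebesgue_eq)
  have "ball x r - E = - E \<inter> ball x r" by blast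
  then have 2: "measure lborel (ball x r - E) = (1 - dens E x r) * b"
    using dens_Compl[OF r, of x] b(2) unfolding dens_def[of "- E"]
    by (simp add: b_def measure_lebesgue_eq[of "- E \<inter> ball x r"] field_simps)
  have "(c * b) * (c * b) \<le> (dens E x r * b) * ((1 - dens E x r) * b)"
    using c d b(2) by (intro mult_mono mult_nonneg_nonneg) auto
  also have "\<dots> \<le> 2 * r * 2 ^ DIM('a) * (b * measure \<mu> (cball x (2 * r)))"
    using relative_isoperimetric[OF r, of x] unfolding 1 2 b_def[symmetric] by simp
  finally have "b * (c\<^sup>2 * b) \<le> b * (2 ^ (DIM('a) + 1) * r * measure \<mu> (cball x (2 * r)))"
    by (simp add: power2_eq_square mult_ac)
  then have "c\<^sup>2 * b \<le> 2 ^ (DIM('a) + 1) * r * measure \<mu> (cball x (2 * r))"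
    using b(2) by (simp only: mult_le_cancel_left_pos)
  then have "c\<^sup>2 * (r ^ DIM('a) * \<omega>) \<le> 2 ^ (DIM('a) + 1) * r * measure \<mu> (cball x (2 * r))"
    unfolding b(1) .
  moreover have "r ^ DIM('a) = r * r ^ (DIM('a) - 1)" by (simp add: power_eq_if[of r "DIM('a)"])
  ultimately have "r * (c\<^sup>2 * \<omega> * r ^ (DIM('a) - 1)) \<le> r * (2 ^ (DIM('a) + 1) * measure \<mu> (cball x (2 * r)))"
    by (simp add: mult_ac)
  then have "c\<^sup>2 * \<omega> * r ^ (DIM('a) - 1) \<le> 2 ^ (DIM('a) + 1) * measure \<mu> (cball x (2 * r))"
    using r by simp
  moreover have "c\<^sup>2 * \<omega> > 0" using c omega_pos by simp
  ultimately show ?thesis unfolding iso_const_def by (simp add: pos_le_divide_eq mult.commute)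
qed

text \<open>Intermediate density bounds \<open>r ^ (DIM('a) - 1)\<close> by the perimeter in the
  doubled ball. Vitali's lemma picks disjoint doubled balls whose fivefold enlargements still cover,
  so the sum over the chosen radii is bounded by the perimeter in \<open>W\<close> alone, however
  small the balls are.\<close>

lemma cover_mid_dens:
  assumes K: "compact K" "K \<subseteq> mid_dens E c" and c: "c > 0" and W: "open W" "K \<subseteq> W" and "\<delta> > 0"
  obtains I s where "finite I" "\<And>a. a \<in> I \<Longrightarrow> 0 < s a \<and> s a < \<delta> \<and> cball a (3 * s a) \<subseteq> W"
    "K \<subseteq> (\<Union>a\<in>I. ball a (s a))" 
    "(\<Sum>a\<in>I. s a ^ (DIM('a) - 1)) \<le> 10 ^ (DIM('a) - 1) * iso_const c * measure \<mu> W"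
proof -
  have "\<exists>r>0. 10 * r < \<delta> \<and> cball x (30 * r) \<subseteq> W \<and> c < dens E x r \<and> dens E x r < 1 - c" if xK: "x \<in> K" for x
  proof -
    have "x \<in> W" using xK W(2) by blast
    then obtain e where e: "e > 0" "cball x e \<subseteq> W" using W(1) unfolding open_contains_cball by blast
    \<comment> \<open>The covering balls have radius \<open>10 * r\<close>, from the doubling and
      Vitali's factor 5; cutoffs for them live on three times that radius, hence 30.\<close>
    define m where "m = min (\<delta> / 10) (e / 30)"
    have "m > 0" using e \<open>\<delta> > 0\<close> by (simp add: m_def)
    then obtain n where n: "1 / real (Suc n) < m" using reals_Archimedean by (auto simp: inverse_eq_divide)
    obtain r where r: "r > 0" "r < 1 / real (Suc n)" "c < dens E x r" "dens E x r < 1 - c"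
    proof -
      have "x \<in> mid_dens E c" using xK K(2) by blast
      then have "\<exists>r>0. r < 1 / real (Suc n) \<and> c < dens E x r \<and> dens E x r < 1 - c"
        unfolding mid_dens_def mem_Collect_eq by (rule spec)
      then show ?thesis using that by blast
    qed
    have "r < m" using r n by simp
    then have "10 * r < \<delta>" "30 * r < e" by (auto simp: m_def)
    then have "cball x (30 * r) \<subseteq> W" using e(2) by (meson less_imp_le order_trans subset_cball)
    then show ?thesis using r \<open>10 * r < \<delta>\<close> by blast
  qed
  then obtain r where r: "\<And>x. x \<in> K \<Longrightarrow> r x > 0 \<and> 10 * r x < \<delta> \<and> cball x (30 * r x) \<subseteq> W \<and> c < dens E x (r x) \<and> dens E x (r x) < 1 - c"
    by metis
  have cov: "K \<subseteq> (\<Union>x\<in>K. ball x (2 * r x))" using r by fastforce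
  \<comment> \<open>Compactness comes before the selection of disjoint balls, so that the selected
    family is finite and admits a finite product of cutoffs.\<close>
  obtain F where F: "F \<subseteq> K" "finite F" "K \<subseteq> (\<Union>x\<in>F. ball x (2 * r x))"
    by (rule compactE_image[OF K(1) _ cov], simp, (rule that; assumption))
  have rF: "0 < 2 * r i \<and> 2 * r i \<le> \<delta>" if "i \<in> F" for i
  proof -
    have "i \<in> K" using that F(1) by blast
    from r[OF this] show ?thesis by linarith
  qed
  obtain I where I: "I \<subseteq> F" "pairwise (\<lambda>i j. disjnt (cball i (2 * r i)) (cball j (2 * r j))) I"
    "\<And>i. i \<in> F \<Longrightarrow> \<exists>j. j \<in> I \<and> \<not> disjnt (cball i (2 * r i)) (cball j (2 * r j)) \<and> cball i (2 * r i) \<subseteq> ball j (5 * (2 * r j))"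
    by (rule Vitali_covering_lemma_cballs_balls[where a = "\<lambda>x. x" and r = "\<lambda>x. 2 * r x", OF rF], assumption, (rule that; assumption))
  have IK: "i \<in> K" if "i \<in> I" for i using that I F by blast
  have finI: "finite I" using I(1) F(2) finite_subset by blast
  show ?thesis
  proof (rule that[of I "\<lambda>x. 10 * r x"])
    show "0 < 10 * r a \<and> 10 * r a < \<delta> \<and> cball a (3 * (10 * r a)) \<subseteq> W" if "a \<in> I" for a
      using r[OF IK[OF that]] by simp
    show "K \<subseteq> (\<Union>a\<in>I. ball a (10 * r a))"
    proof
      fix x assume "x \<in> K"
      then obtain i where i: "i \<in> F" "x \<in> ball i (2 * r i)" using F(3) by blast
      then obtain j where "j \<in> I" "cball i (2 * r i) \<subseteq> ball j (5 * (2 * r j))" using I(3) by blast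
      then show "x \<in> (\<Union>a\<in>I. ball a (10 * r a))" using i ball_subset_cball[of i "2 * r i"]
        by (intro UN_I[of j]) (auto simp: subset_iff)
    qed
    have ic: "iso_const c \<ge> 0" using omega_pos by (simp add: iso_const_def)
    have "(\<Sum>a\<in>I. (10 * r a) ^ (DIM('a) - 1)) = 10 ^ (DIM('a) - 1) * (\<Sum>a\<in>I. r a ^ (DIM('a) - 1))"
      by (simp add: power_mult_distrib sum_distrib_left)
    also have "(\<Sum>a\<in>I. r a ^ (DIM('a) - 1)) \<le> (\<Sum>a\<in>I. iso_const c * measure \<mu> (cball a (2 * r a)))"
      using r IK c by (intro sum_mono mu_lower_bound) auto
    also have "\<dots> = iso_const c * measure \<mu> (\<Union>a\<in>I. cball a (2 * r a))"
    proof -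
      have "disjoint_family_on (\<lambda>a. cball a (2 * r a)) I"
        using I(2) by (auto simp: disjoint_family_on_def pairwise_def disjnt_def)
      moreover have "(\<lambda>a. cball a (2 * r a)) ` I \<subseteq> sets \<mu>" by auto
      ultimately have "measure \<mu> (\<Union>a\<in>I. cball a (2 * r a)) = (\<Sum>a\<in>I. measure \<mu> (cball a (2 * r a)))"
        using finI by (intro finite_measure_finite_Union)
      then show ?thesis
        by (simp add: sum_distrib_left)
    qed
    also have "measure \<mu> (\<Union>a\<in>I. cball a (2 * r a)) \<le> measure \<mu> W"
    proof (rule finite_measure_mono)
      have "cball a (2 * r a) \<subseteq> W" if "a \<in> I" for a
        using r[OF IK[OF that]] subset_cball[of "2 * r a" "30 * r a" a] by (auto simp: subset_iff)
      then show "(\<Union>a\<in>I. cball a (2 * r a)) \<subseteq> W" by blast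
    qed (use W in simp)
    finally show "(\<Sum>a\<in>I. (10 * r a) ^ (DIM('a) - 1)) \<le> 10 ^ (DIM('a) - 1) * iso_const c * measure \<mu> W"
      using ic by (simp add: mult_left_mono mult.assoc)
  qed (rule finI)
qed

text \<open>In a cover by balls of radius less than \<open>\<delta>\<close> the total volume is at
  most \<open>\<delta>\<close> times the sum of the powers with exponent \<open>DIM('a) - 1\<close>,
  and \<open>cover_mid_dens\<close> bounds that sum independently of
  \<open>\<delta>\<close>.\<close>

lemma mid_dens_null:
  assumes c: "c > 0" shows "mid_dens E c \<in> null_sets lebesgue"
proof -
  have K0: "emeasure lebesgue K = 0" if K: "compact K" "K \<subseteq> mid_dens E c" for K
  proof -
    have [measurable]: "K \<in> sets borel" using K by (simp add: borel_compact)
    define C where "C = \<omega> * (10 ^ (DIM('a) - 1) * iso_const c * measure \<mu> UNIV)"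
    have "iso_const c \<ge> 0" using omega_pos by (simp add: iso_const_def)
    then have C0: "C \<ge> 0" unfolding C_def using omega_pos by simp
    have le: "measure lebesgue K \<le> \<delta> * C" if \<delta>: "\<delta> > 0" for \<delta>
    proof -
      obtain I s where I: "finite I" "\<And>a. a \<in> I \<Longrightarrow> 0 < s a \<and> s a < \<delta> \<and> cball a (3 * s a) \<subseteq> UNIV"
        "K \<subseteq> (\<Union>a\<in>I. ball a (s a))" "(\<Sum>a\<in>I. s a ^ (DIM('a) - 1)) \<le> 10 ^ (DIM('a) - 1) * iso_const c * measure \<mu> UNIV"
        by (rule cover_mid_dens[OF K c open_UNIV subset_UNIV \<delta>], (rule that; assumption))
      have "measure lebesgue K \<le> measure lebesgue (\<Union>a\<in>I. ball a (s a))"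
        using I by (intro measure_mono_fmeasurable) (auto intro: fmeasurable.finite_UN)
      also have "\<dots> \<le> (\<Sum>a\<in>I. measure lebesgue (ball a (s a)))"
        using I(1) by (intro measure_UNION_le) auto
      also have "\<dots> \<le> (\<Sum>a\<in>I. \<delta> * (\<omega> * s a ^ (DIM('a) - 1)))"
      proof (rule sum_mono)
        fix a assume a: "a \<in> I"
        have "measure lebesgue (ball a (s a)) = s a * (\<omega> * s a ^ (DIM('a) - 1))"
          using I(2)[OF a] by (simp add: content_ball_omega power_eq_if[of "s a" "DIM('a)"])
        also have "\<dots> \<le> \<delta> * (\<omega> * s a ^ (DIM('a) - 1))"
          using I(2)[OF a] omega_pos by (intro mult_right_mono) auto
        finally show "measure lebesgue (ball a (s a)) \<le> \<delta> * (\<omega> * s a ^ (DIM('a) - 1))" .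
      qed
      also have "\<dots> = \<delta> * (\<omega> * (\<Sum>a\<in>I. s a ^ (DIM('a) - 1)))" by (simp add: sum_distrib_left)
      also have "\<dots> \<le> \<delta> * C" unfolding C_def using \<delta> omega_pos I(4) by (intro mult_left_mono) auto
      finally show ?thesis .
    qed
    have "measure lebesgue K \<le> 0"
    proof (rule field_le_epsilon)
      fix e :: real assume "e > 0"
      then have "e / (C + 1) > 0" using C0 by simp
      from le[OF this] have "measure lebesgue K \<le> e * (C / (C + 1))" by simp
      also have "\<dots> \<le> e * 1" using \<open>e > 0\<close> C0 by (intro mult_left_mono) auto
      finally show "measure lebesgue K \<le> 0 + e" by simp
    qed
    then have "measure lebesgue K = 0" by (simp add: measure_le_0_iff)
    moreover have "emeasure lebesgue K \<noteq> \<infinity>"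
      using emeasure_bounded_finite[OF compact_imp_bounded[OF K(1)]] by simp
    ultimately show ?thesis by (simp add: emeasure_eq_ennreal_measure)
  qed
  have mb: "mid_dens E c \<in> sets lebesgue" using mid_dens_borel[OF E_lebesgue] by simp
  \<comment> \<open>The estimate on compact subsets is carried over by inner regularity: a closed
    subset is a countable union of compact ones, hence null, and what it leaves out has measure less
    than \<open>e\<close>.\<close>
  have "emeasure lebesgue (mid_dens E c) \<le> ennreal e" if e: "e > 0" for e
  proof -
    obtain T where T: "closed T" "T \<subseteq> mid_dens E c" "mid_dens E c - T \<in> lmeasurable" "emeasure lebesgue (mid_dens E c - T) < ennreal e"
      by (rule sets_lebesgue_inner_closed[OF mb e])
    have "T = (\<Union>n. T \<inter> cball 0 (real n))"
      using real_arch_simple by (auto simp: )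
    moreover have "T \<inter> cball 0 (real n) \<in> null_sets lebesgue" for n
    proof (rule null_setsI)
      show "emeasure lebesgue (T \<inter> cball 0 (real n)) = 0"
        by (rule K0) (use T(1,2) in \<open>auto simp: closed_Int_compact\<close>)
    qed (use T(1) in auto)
    ultimately have "T \<in> null_sets lebesgue"
      by (metis null_sets_UN)
    then have "emeasure lebesgue (mid_dens E c) = emeasure lebesgue (mid_dens E c - T)"
      using mb by (simp add: emeasure_Diff_null_set)
    then show ?thesis using T(4) by simp
  qed
  then have "emeasure lebesgue (mid_dens E c) = 0"
    by (metis ennreal_le_epsilon le_zero_eq add_0 ennreal_zero_less_top)
  then show ?thesis using mb by auto
qed

lemma meas_boundary_null: "meas_boundary E \<in> null_sets lebesgue"
proof (rule null_sets_subset[OF _ _ meas_boundary_subset_mid_dens[OF E_lebesgue]])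
  show "(\<Union>n. mid_dens E (1 / real (Suc n))) \<in> null_sets lebesgue"
    by (intro null_sets_UN mid_dens_null) simp
qed (use meas_boundary_borel[OF E_lebesgue] in simp)

end

section \<open>The divergence on the measure-theoretic boundary\<close>

text \<open>The two parts of the divergence are finite only on compact subsets of
  \<open>\<Omega>\<close>. Cutting by a density gives a finite measure with the same space and
  sigma-algebra, to which regularity and Radon-Nikodym apply.\<close>

definition cut_measure :: "'a set \<Rightarrow> 'a measure \<Rightarrow> 'a measure" where
  "cut_measure K M = density M (\<lambda>x. ennreal (indicat_real K x))"

lemma sets_cut_measure [simp, measurable_cong]: "sets (cut_measure K M) = sets M"
  by (simp add: cut_measure_def)

lemma emeasure_cut_measure:
  assumes "K \<in> sets M" "A \<in> sets M" shows "emeasure (cut_measure K M) A = emeasure M (K \<inter> A)"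
proof -
  have "(\<lambda>x. ennreal (indicat_real K x) * indicator A x) = indicator (K \<inter> A)"
    by (auto simp: indicator_def)
  then show ?thesis using assms by (simp add: cut_measure_def emeasure_density)
qed

lemma finite_cut_measure:
  assumes "K \<in> sets M" "emeasure M K < \<infinity>" shows "finite_measure (cut_measure K M)"
proof (rule finite_measureI)
  have "emeasure (cut_measure K M) (space M) = emeasure M (K \<inter> space M)"
    using assms by (intro emeasure_cut_measure) auto
  also have "\<dots> < \<infinity>" using assms sets.sets_into_space[OF assms(1)] by (simp add: Int_absorb2)
  finally show "emeasure (cut_measure K M) (space (cut_measure K M)) \<noteq> \<infinity>"
    by (simp add: cut_measure_def)
qed

lemma integral_cut_measure:
  fixes f :: "'a \<Rightarrow> real"
  assumes "K \<in> sets M" "f \<in> borel_measurable M" "\<And>x. x \<notin> K \<Longrightarrow> f x = 0"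
  shows "(LINT x|cut_measure K M. f x) = (LINT x|M. f x)"
proof -
  have "(\<lambda>x. indicator K x * f x) = f" using assms(3) by (auto simp: indicator_def fun_eq_iff)
  then show ?thesis unfolding cut_measure_def
    using assms by (subst integral_density) auto
qed

lemma integrable_on_finite_part:
  fixes f :: "'a \<Rightarrow> real"
  assumes "K \<in> sets M" "emeasure M K < \<infinity>" and [measurable]: "f \<in> borel_measurable M"
    and "\<And>x. x \<notin> K \<Longrightarrow> f x = 0" "\<And>x. \<bar>f x\<bar> \<le> B"
  shows "integrable M f"
proof (rule Bochner_Integration.integrable_bound[of _ "\<lambda>x. indicator K x * B"])
  show "integrable M (\<lambda>x. indicator K x * B)" using assms by simp
  show "AE x in M. norm (f x) \<le> norm (indicator K x * B)"
    using assms(4,5) by (auto intro!: AE_I2 simp: indicator_def intro: order_trans[OF assms(5) abs_ge_self])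
qed fact

text \<open>Used twice to build a measure that dominates both parts of the divergence and the
  perimeter.\<close>

lemma exists_sum_measure:
  fixes M N :: "'a::topological_space measure"
  assumes "sets M = sets borel" "sets N = sets borel"
  obtains S where "sets S = sets borel" "\<And>A. A \<in> sets borel \<Longrightarrow> emeasure S A = emeasure M A + emeasure N A"
proof -
  define f where "f A = emeasure M A + emeasure N A" for A
  define S where "S = measure_of UNIV (sets borel) f"
  have sS: "sets S = sets borel"
    unfolding S_def using sets.sets_measure_of_eq[of borel] by simp
  have "emeasure S A = f A" if "A \<in> sets borel" for A
  proof (rule emeasure_measure_of[OF S_def])
    show "countably_additive (sets S) f"
      unfolding countably_additive_def f_def sS
      using assms by (auto simp: suminf_add[symmetric] suminf_emeasure[symmetric] intro!: arg_cong2[where f = "(+)"])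
    show "positive (sets S) f" by (simp add: positive_def f_def)
  qed (use that sS in auto)
  then show ?thesis using that sS unfolding f_def by blast
qed

lemma absolutely_continuous_density:
  assumes "finite_measure T" "finite_measure N" "absolutely_continuous T N" "sets N = sets T"
  obtains D :: "'a \<Rightarrow> real" where "D \<in> borel_measurable T" "\<And>x. 0 \<le> D x" "N = density T (\<lambda>x. ennreal (D x))"
    "integrable T D"
proof -
  interpret T: finite_measure T by fact
  interpret N: finite_measure N by fact
  obtain D where D: "D \<in> borel_measurable T" "AE x in T. RN_deriv T N x = ennreal (D x)" "\<And>x. 0 \<le> D x"
    using T.real_RN_deriv[OF assms(2-4)] by metis
  have "N = density T (RN_deriv T N)" using T.density_RN_deriv[OF assms(3,4)] by simp
  also have "\<dots> = density T (\<lambda>x. ennreal (D x))"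
    using D by (intro density_cong) auto
  finally have N: "N = density T (\<lambda>x. ennreal (D x))" .
  have "integrable T D"
  proof (rule integrableI_bounded[OF D(1)])
    have "(\<integral>\<^sup>+x. ennreal (norm (D x)) \<partial>T) = emeasure N (space T)"
      unfolding N using D by (simp add: emeasure_density cong: nn_integral_cong)
    also have "\<dots> < \<infinity>" using N.emeasure_finite[of "space T"] by (simp add: less_top[symmetric])
    finally show "(\<integral>\<^sup>+x. ennreal (norm (D x)) \<partial>T) < \<infinity>" .
  qed
  then show ?thesis using that D N by blast
qed

section \<open>Regularity of finite Borel measures and compact neighbourhoods\<close>

lemma outer_open_approx:
  fixes M :: "'a::euclidean_space measure"
  assumes "finite_measure M" "sets M = sets borel" "B \<in> sets borel" "e > 0"
  obtains V where "open V" "B \<subseteq> V" "measure M V < measure M B + e"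
proof -
  interpret finite_measure M by fact
  have "(INF U \<in> {U. B \<subseteq> U \<and> open U}. emeasure M U) = emeasure M B"
    using outer_regular[OF assms(2) _ assms(3)] by simp
  also have "\<dots> < ennreal (measure M B + e)"
    using assms(4) by (simp add: emeasure_eq_measure ennreal_less_iff)
  finally obtain V where "B \<subseteq> V" "open V" "emeasure M V < ennreal (measure M B + e)"
    unfolding INF_less_iff by blast
  then show ?thesis using that by (auto simp: emeasure_eq_measure ennreal_less_iff)
qed

lemma inner_compact_approx:
  fixes M :: "'a::euclidean_space measure"
  assumes "finite_measure M" "sets M = sets borel" "B \<in> sets borel" "e > 0"
  obtains C where "compact C" "C \<subseteq> B" "measure M B - e < measure M C"
proof (cases "measure M B - e < 0")
  case True
  show ?thesis by (rule that[of "{}"]) (use True in auto)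
next
  case False
  interpret finite_measure M by fact
  have "ennreal (measure M B - e) < emeasure M B"
    using assms(4) False by (simp add: emeasure_eq_measure ennreal_less_iff)
  also have "\<dots> = (SUP K \<in> {K. K \<subseteq> B \<and> compact K}. emeasure M K)"
    using inner_regular[OF assms(2) _ assms(3)] by simp
  finally obtain C where "C \<subseteq> B" "compact C" "ennreal (measure M B - e) < emeasure M C"
    unfolding less_SUP_iff by blast
  then show ?thesis using that False by (auto simp: emeasure_eq_measure ennreal_less_iff)
qed

lemma compact_neighbourhood:
  fixes A :: "'a::euclidean_space set"
  assumes "compact A" "open W" "A \<subseteq> W"
  obtains V C where "open V" "A \<subseteq> V" "V \<subseteq> C" "compact C" "C \<subseteq> W"
proof -
  obtain e where e: "e > 0" "(\<Union>x\<in>A. ball x e) \<subseteq> W"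
    using compact_subset_open_imp_ball_epsilon_subset[OF assms] by blast
  define C where "C = {x + y |x y. x \<in> A \<and> y \<in> cball 0 (e / 2)}"
  have "compact C" unfolding C_def by (intro compact_sums assms compact_cball)
  moreover have "C \<subseteq> W"
  proof
    fix z assume "z \<in> C"
    then obtain x y where "x \<in> A" "norm y \<le> e / 2" "z = x + y" by (auto simp: C_def)
    then have "z \<in> ball x e" using e by (simp add: dist_norm)
    then show "z \<in> W" using e \<open>x \<in> A\<close> by blast
  qed
  moreover have "(\<Union>x\<in>A. ball x (e / 2)) \<subseteq> C"
  proof
    fix z assume "z \<in> (\<Union>x\<in>A. ball x (e / 2))"
    then obtain x where "x \<in> A" "dist x z < e / 2" by auto
    then show "z \<in> C" unfolding C_def mem_Collect_eq
      by (intro exI[of _ x] exI[of _ "z - x"]) (auto simp: dist_norm norm_minus_commute)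
  qed
  moreover have "A \<subseteq> (\<Union>x\<in>A. ball x (e / 2))" using e by auto
  moreover have "open (\<Union>x\<in>A. ball x (e / 2))" by blast
  ultimately show ?thesis using that by blast
qed

section \<open>The field extended by zero, and its divergence\<close>

locale dm_set = fp_set \<rho> E \<mu> \<sigma>
  for \<rho> :: "'a::euclidean_space \<Rightarrow> real" and E \<mu> \<sigma> +
  fixes \<Omega> :: "'a set" and F :: "'a \<Rightarrow> 'a" and \<mu>p \<mu>m :: "'a measure"
  assumes \<Omega>_open: "open \<Omega>" and DM: "DM_loc \<Omega> F \<mu>p \<mu>m"
begin

lemma sets_mup [simp, measurable_cong]: "sets \<mu>p = sets borel"
  and sets_mum [simp, measurable_cong]: "sets \<mu>m = sets borel"
  using DM by (auto simp: DM_loc_def)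

lemma space_mup [simp]: "space \<mu>p = UNIV" and space_mum [simp]: "space \<mu>m = UNIV"
  using sets_eq_imp_space_eq[OF sets_mup] sets_eq_imp_space_eq[OF sets_mum] by auto

lemma finite_on_compact:
  assumes "compact K" "K \<subseteq> \<Omega>"
  shows "emeasure \<mu>p K < \<infinity>" "emeasure \<mu>m K < \<infinity>"
  using DM assms by (auto simp: DM_loc_def)

text \<open>\<open>F\<close> is constrained only on \<open>\<Omega>\<close>. The extension by zero
  is measurable on the whole space, and its pairing with anything that vanishes off
  \<open>\<Omega>\<close> is that of \<open>F\<close>.\<close>

definition F0 :: "'a \<Rightarrow> 'a" where "F0 x = (if x \<in> \<Omega> then F x else 0)"

lemma F0_measurable [measurable]: "F0 \<in> borel_measurable lebesgue"
proof -
  have "F \<in> borel_measurable (lebesgue_on \<Omega>)" using DM by (simp add: DM_loc_def)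
  moreover have "\<Omega> \<in> sets lebesgue" using \<Omega>_open by simp
  ultimately show ?thesis unfolding F0_def
    by (simp add: measurable_restrict_space_iff[of \<Omega> lebesgue 0] )
qed

lemma F0_bound:
  assumes "compact K" "K \<subseteq> \<Omega>"
  obtains C where "C \<ge> 0" "AE x in lebesgue. x \<in> K \<longrightarrow> norm (F0 x) \<le> C"
proof -
  obtain C where C: "AE x in lebesgue. x \<in> K \<longrightarrow> norm (F x) \<le> C"
    using DM assms by (auto simp: DM_loc_def)
  have "AE x in lebesgue. x \<in> K \<longrightarrow> norm (F0 x) \<le> \<bar>C\<bar>"
    using C by eventually_elim (auto simp: F0_def)
  then show ?thesis using that[of "\<bar>C\<bar>"] by simp
qed

text \<open>Pairing with the signed measure \<open>div F\<close>. As a difference of two Bochner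
  integrals it is additive only for functions integrable against both parts, which bounded functions
  supported in a compact subset of \<open>\<Omega>\<close> are.\<close>

definition Dint :: "('a \<Rightarrow> real) \<Rightarrow> real" where
  "Dint f = (LINT x|\<mu>p. f x) - (LINT x|\<mu>m. f x)"

lemma F_inner_eq_F0:
  assumes "\<And>x. x \<notin> \<Omega> \<Longrightarrow> v x = 0" shows "F x \<bullet> v x = F0 x \<bullet> v x"
  using assms[of x] by (auto simp: F0_def)

lemma test_fun_grad_outside: "test_fun A \<psi> \<Longrightarrow> x \<notin> A \<Longrightarrow> grad \<psi> x = 0"
  using test_fun_grad_zero[of x \<psi>] by (auto simp: test_fun_def)

lemma DM_identity:
  assumes "test_fun \<Omega> \<psi>" shows "(LINT x|lebesgue. F0 x \<bullet> grad \<psi> x) = - Dint \<psi>"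
proof -
  have "(LINT x|lebesgue. F0 x \<bullet> grad \<psi> x) = (LINT x|lebesgue. F x \<bullet> grad \<psi> x)"
    using F_inner_eq_F0[of "grad \<psi>"] test_fun_grad_outside[OF assms] by simp
  then show ?thesis using DM assms by (simp add: DM_loc_def Dint_def)
qed

lemma integrable_compact:
  fixes f :: "'a \<Rightarrow> real"
  assumes "compact K" "K \<subseteq> \<Omega>" "f \<in> borel_measurable borel" "\<And>x. x \<notin> K \<Longrightarrow> f x = 0" "\<And>x. \<bar>f x\<bar> \<le> B"
  shows "integrable \<mu>p f" "integrable \<mu>m f"
  using assms finite_on_compact[OF assms(1,2)]
  by (auto intro!: integrable_on_finite_part[of K _ f B] borel_compact)

text \<open>The bound is the product of the essential supremum of the field and the
  \<open>L^1\<close> norm of \<open>v\<close>. If the integrand is not integrable, its integral is 0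
  by convention and the bound is trivial.\<close>

lemma flux_bound:
  assumes K: "compact K" and C: "C \<ge> 0" "AE x in lebesgue. x \<in> K \<longrightarrow> norm (F0 x) \<le> C"
    and [measurable]: "v \<in> borel_measurable borel" and v0: "\<And>x. x \<notin> K \<Longrightarrow> v x = 0"
    and R: "R \<ge> 0" "(\<integral>\<^sup>+x. ennreal (norm (v x)) \<partial>lborel) \<le> ennreal R"
  shows "\<bar>LINT x|lebesgue. F0 x \<bullet> v x\<bar> \<le> C * R"
proof (cases "integrable lebesgue (\<lambda>x. F0 x \<bullet> v x)")
  case True
  have [measurable]: "v \<in> borel_measurable lebesgue" by (rule measurable_completion) measurable
  have "ennreal \<bar>LINT x|lebesgue. F0 x \<bullet> v x\<bar> \<le> (\<integral>\<^sup>+x. ennreal (norm (F0 x \<bullet> v x)) \<partial>lebesgue)"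
    using integral_norm_bound_ennreal[OF True] by simp
  also have "\<dots> \<le> (\<integral>\<^sup>+x. ennreal C * ennreal (norm (v x)) \<partial>lebesgue)"
  proof (rule nn_integral_mono_AE)
    show "AE x in lebesgue. ennreal (norm (F0 x \<bullet> v x)) \<le> ennreal C * ennreal (norm (v x))"
      using C(2)
    proof eventually_elim
      case (elim x)
      have "norm (F0 x \<bullet> v x) \<le> C * norm (v x)"
      proof (cases "x \<in> K")
        case True
        have "norm (F0 x \<bullet> v x) \<le> norm (F0 x) * norm (v x)" by (simp add: Cauchy_Schwarz_ineq2)
        also have "\<dots> \<le> C * norm (v x)" using elim True by (intro mult_right_mono) auto
        finally show ?thesis .
      qed (simp add: v0)
      then show ?case using C(1) by (simp add: ennreal_mult[symmetric] ennreal_leI)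
    qed
  qed
  also have "\<dots> = ennreal C * (\<integral>\<^sup>+x. ennreal (norm (v x)) \<partial>lborel)"
    by (simp add: nn_integral_cmult nn_integral_completion)
  also have "\<dots> \<le> ennreal C * ennreal R" by (intro mult_left_mono R) auto
  also have "\<dots> = ennreal (C * R)" using C R by (simp add: ennreal_mult)
  finally show ?thesis using C(1) R(1) by (subst (asm) ennreal_le_iff) auto
qed (use C R in \<open>simp add: not_integrable_integral_eq\<close>)

text \<open>\<open>div F\<close> is tested with a cutoff that equals 1 on \<open>A\<close> and lives
  in a small neighbourhood \<open>W\<close>. Its gradient has mass at most a constant times
  \<open>measure \<mu> W\<close>, which is small because \<open>A\<close> is
  \<open>\<mu>\<close>-null; outer regularity makes the two integrals of the cutoff close to the
  masses of \<open>A\<close>.\<close>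

lemma Dint_null_compact:
  assumes A: "compact A" "A \<subseteq> \<Omega>" "A \<subseteq> mid_dens E c" and c: "c > 0" and A0: "measure \<mu> A = 0"
  shows "measure \<mu>p A = measure \<mu>m A"
proof -
  obtain V K where V: "open V" "A \<subseteq> V" "V \<subseteq> K" and K: "compact K" "K \<subseteq> \<Omega>"
    using compact_neighbourhood[OF A(1) \<Omega>_open A(2)] by blast
  have [measurable]: "K \<in> sets borel" "A \<in> sets borel" using K A by (auto intro: borel_compact)
  obtain C where C: "C \<ge> 0" "AE x in lebesgue. x \<in> K \<longrightarrow> norm (F0 x) \<le> C"
    using F0_bound[OF K] by blast
  obtain L where L: "L \<ge> 0" "\<And>(I::'a set) s. finite I \<Longrightarrow> (\<And>a. a \<in> I \<Longrightarrow> s a > 0) \<Longrightarrow>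
      \<exists>\<psi>. smooth \<psi> \<and> (\<forall>x. 0 \<le> \<psi> x \<and> \<psi> x \<le> 1) \<and>
      (\<forall>a\<in>I. \<forall>x\<in>ball a (s a). \<psi> x = 1) \<and> (\<forall>x. x \<notin> (\<Union>a\<in>I. cball a (3 * s a)) \<longrightarrow> \<psi> x = 0) \<and>
      (\<integral>\<^sup>+x. ennreal (norm (grad \<psi> x)) \<partial>lborel) \<le> ennreal (L * (\<Sum>a\<in>I. s a ^ (DIM('a) - 1)))"
    using union_cutoff by blast
  define Q where "Q = L * (10 ^ (DIM('a) - 1) * iso_const c)"
  have "iso_const c \<ge> 0" using omega_pos by (simp add: iso_const_def)
  then have Q: "Q \<ge> 0" using L(1) by (simp add: Q_def)
  have main: "\<bar>measure \<mu>p A - measure \<mu>m A\<bar> \<le> (C * Q + 2) * e" if e: "e > 0" for e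
  proof -
    note fc = finite_cut_measure[of K \<mu>p] finite_cut_measure[of K \<mu>m]
    have fin: "finite_measure (cut_measure K \<mu>p)" "finite_measure (cut_measure K \<mu>m)"
      using fc finite_on_compact[OF K] by auto
    obtain Vp where Vp: "open Vp" "A \<subseteq> Vp" "measure (cut_measure K \<mu>p) Vp < measure (cut_measure K \<mu>p) A + e"
      by (rule outer_open_approx[OF fin(1) _ _ e, of A]) auto
    obtain Vm where Vm: "open Vm" "A \<subseteq> Vm" "measure (cut_measure K \<mu>m) Vm < measure (cut_measure K \<mu>m) A + e"
      by (rule outer_open_approx[OF fin(2) _ _ e, of A]) auto
    obtain V0 where V0: "open V0" "A \<subseteq> V0" "measure \<mu> V0 < measure \<mu> A + e"
      by (rule outer_open_approx[OF finite_measure_axioms sets_mu _ e, of A]) auto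
    \<comment> \<open>One neighbourhood serves four purposes: \<open>V\<close> keeps it inside
      \<open>K\<close>, \<open>Vp\<close> and \<open>Vm\<close> limit the excess of the two parts of
      the divergence, and \<open>V0\<close> makes its perimeter small.\<close>
    define W where "W = V \<inter> Vp \<inter> Vm \<inter> V0"
    have W: "open W" "A \<subseteq> W" "W \<subseteq> K" using V Vp Vm V0 by (auto simp: W_def)
    have [measurable]: "W \<in> sets borel" using W by simp
    obtain I s where I: "finite I" "\<And>a. a \<in> I \<Longrightarrow> 0 < s a \<and> s a < 1 \<and> cball a (3 * s a) \<subseteq> W"
      "A \<subseteq> (\<Union>a\<in>I. ball a (s a))"
      "(\<Sum>a\<in>I. s a ^ (DIM('a) - 1)) \<le> 10 ^ (DIM('a) - 1) * iso_const c * measure \<mu> W"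
      by (rule cover_mid_dens[OF A(1,3) c W(1,2) zero_less_one], (rule that; assumption))
    from L(2)[of I s] I(1,2) obtain \<psi> where \<psi>: "smooth \<psi>" "\<And>x. 0 \<le> \<psi> x \<and> \<psi> x \<le> 1"
      "\<And>a x. a \<in> I \<Longrightarrow> x \<in> ball a (s a) \<Longrightarrow> \<psi> x = 1" "\<And>x. x \<notin> (\<Union>a\<in>I. cball a (3 * s a)) \<Longrightarrow> \<psi> x = 0"
      "(\<integral>\<^sup>+x. ennreal (norm (grad \<psi> x)) \<partial>lborel) \<le> ennreal (L * (\<Sum>a\<in>I. s a ^ (DIM('a) - 1)))"
      by auto
    note [measurable] = smooth_borel[OF \<psi>(1)]
    have Ic: "compact (\<Union>a\<in>I. cball a (3 * s a))" using I(1) by (intro compact_UN) auto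
    have IW: "(\<Union>a\<in>I. cball a (3 * s a)) \<subseteq> W" using I(2) by blast
    have \<psi>W: "\<psi> x = 0" if "x \<notin> W" for x using \<psi>(4) IW that by blast
    have \<psi>K: "\<psi> x = 0" if "x \<notin> K" for x using \<psi>W that W(3) by blast
    have \<psi>A: "\<psi> x = 1" if "x \<in> A" for x using \<psi>(3) I(3) that by blast
    have t: "test_fun \<Omega> \<psi>" by (rule test_funI[OF \<psi>(1) Ic _ \<psi>(4)]) (use IW W K in auto)
    have gK: "grad \<psi> x = 0" if xK: "x \<notin> K" for x
    proof (rule grad_zero_outside[OF compact_imp_closed[OF Ic] \<psi>(4)])
      have "x \<notin> W" using xK W(3) by blast
      then show "x \<notin> (\<Union>a\<in>I. cball a (3 * s a))" using IW by blast
    qed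
    have muW: "measure \<mu> W \<le> e"
    proof -
      have "measure \<mu> W \<le> measure \<mu> V0" using V0 by (intro finite_measure_mono) (auto simp: W_def)
      then show ?thesis using V0 A0 by simp
    qed
    have "L * (\<Sum>a\<in>I. s a ^ (DIM('a) - 1)) \<le> L * (10 ^ (DIM('a) - 1) * iso_const c * measure \<mu> W)"
      by (intro mult_left_mono I L)
    also have "\<dots> = Q * measure \<mu> W" by (simp add: Q_def mult_ac)
    also have "\<dots> \<le> Q * e" by (intro mult_left_mono muW Q)
    finally have Qe: "L * (\<Sum>a\<in>I. s a ^ (DIM('a) - 1)) \<le> Q * e" .
    have "\<bar>LINT x|lebesgue. F0 x \<bullet> grad \<psi> x\<bar> \<le> C * (Q * e)"
      by (rule flux_bound[OF K(1) C grad_borel[OF \<psi>(1)] gK]) (use Q e order_trans[OF \<psi>(5) ennreal_leI[OF Qe]] in auto)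
    then have D: "\<bar>Dint \<psi>\<bar> \<le> C * (Q * e)" using DM_identity[OF t] by simp
    have close: "measure M A \<le> (LINT x|M. \<psi> x) \<and> (LINT x|M. \<psi> x) \<le> measure M A + e"
      if sM [measurable_cong]: "sets M = sets borel" and fM: "emeasure M K < \<infinity>" and finM: "finite_measure (cut_measure K M)"
        and U: "open U" "A \<subseteq> U" "measure (cut_measure K M) U < measure (cut_measure K M) A + e" "W \<subseteq> U" for M U
    proof -
      interpret cM: finite_measure "cut_measure K M" by fact
      have fW: "emeasure M W < \<infinity>" "emeasure M A < \<infinity>"
        using W fM emeasure_mono[of W K M] emeasure_mono[OF order_trans[OF W(2,3)], of M] sM
        by (auto simp: order_le_less_trans)
      have ipsi: "integrable M \<psi>"
        by (rule integrable_on_finite_part[of K _ _ 1]) (use sM fM \<psi>(2) \<psi>K in \<open>auto simp: abs_of_nonneg\<close>)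
      have mc: "measure (cut_measure K M) B = measure M (K \<inter> B)" if "B \<in> sets borel" for B
        using emeasure_cut_measure[of K M B] that sM by (simp add: measure_def)
      have "measure M W \<le> measure (cut_measure K M) U"
      proof -
        have "measure (cut_measure K M) W \<le> measure (cut_measure K M) U"
          using U sM by (intro cM.finite_measure_mono) auto
        then show ?thesis using mc[of W] W by (simp add: Int_absorb1)
      qed
      also have "\<dots> < measure M A + e" using U(3) mc[of A] W by (simp add: Int_absorb1)
      finally have mW: "measure M W \<le> measure M A + e" by simp
      have iA: "integrable M (indicat_real A)" "integrable M (indicat_real W)" using fW sM by auto
      have "(LINT x|M. indicator A x) \<le> (LINT x|M. \<psi> x)"
        by (rule integral_mono[OF iA(1) ipsi]) (use \<psi>A \<psi>(2) in \<open>auto simp: indicator_def\<close>)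
      moreover have "(LINT x|M. \<psi> x) \<le> (LINT x|M. indicator W x)"
        by (rule integral_mono[OF ipsi iA(2)]) (use \<psi>W \<psi>(2) in \<open>auto simp: indicator_def\<close>)
      moreover have "space M = UNIV" using sets_eq_imp_space_eq[OF sM] by simp
      ultimately show ?thesis using mW by simp
    qed
    have "measure \<mu>p A \<le> (LINT x|\<mu>p. \<psi> x) \<and> (LINT x|\<mu>p. \<psi> x) \<le> measure \<mu>p A + e"
      by (rule close[OF sets_mup _ fin(1) Vp]) (use finite_on_compact[OF K] in \<open>auto simp: W_def\<close>)
    moreover have "measure \<mu>m A \<le> (LINT x|\<mu>m. \<psi> x) \<and> (LINT x|\<mu>m. \<psi> x) \<le> measure \<mu>m A + e"
      by (rule close[OF sets_mum _ fin(2) Vm]) (use finite_on_compact[OF K] in \<open>auto simp: W_def\<close>)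
    ultimately have "\<bar>measure \<mu>p A - measure \<mu>m A\<bar> \<le> C * (Q * e) + 2 * e"
      using D unfolding Dint_def by linarith
    then show ?thesis by (simp add: algebra_simps)
  qed
  define Z where "Z = C * Q + 2"
  have Z: "Z > 0" using C Q by (simp add: Z_def add_nonneg_pos)
  have "\<bar>measure \<mu>p A - measure \<mu>m A\<bar> \<le> 0"
  proof (rule field_le_epsilon)
    fix e :: real assume "e > 0"
    then show "\<bar>measure \<mu>p A - measure \<mu>m A\<bar> \<le> 0 + e"
      using main[of "e / Z"] Z by (simp add: Z_def[symmetric])
  qed
  then show ?thesis by simp
qed

text \<open>Inner regularity is applied to each part of the divergence separately. The union of the
  two compact sets is still compact and \<open>\<mu>\<close>-null, and it nearly exhausts
  \<open>A\<close> for both parts.\<close>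

lemma Dint_null_mid_dens:
  assumes K: "compact K" "K \<subseteq> \<Omega>" and [measurable]: "A \<in> sets borel" and AK: "A \<subseteq> K" "A \<subseteq> mid_dens E c"
    and c: "c > 0" and A0: "measure \<mu> A = 0"
  shows "measure \<mu>p A = measure \<mu>m A"
proof -
  have [measurable]: "K \<in> sets borel" using K by (auto intro: borel_compact)
  have fin: "finite_measure (cut_measure K \<mu>p)" "finite_measure (cut_measure K \<mu>m)"
    using finite_cut_measure[of K \<mu>p] finite_cut_measure[of K \<mu>m] finite_on_compact[OF K] by auto
  interpret P: finite_measure "cut_measure K \<mu>p" by fact
  interpret M: finite_measure "cut_measure K \<mu>m" by fact
  have mc: "measure (cut_measure K \<mu>p) B = measure \<mu>p B" "measure (cut_measure K \<mu>m) B = measure \<mu>m B"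
    if "B \<in> sets borel" "B \<subseteq> K" for B
    using emeasure_cut_measure[of K \<mu>p B] emeasure_cut_measure[of K \<mu>m B] that
    by (auto simp: measure_def Int_absorb1)
  have main: "\<bar>measure \<mu>p A - measure \<mu>m A\<bar> \<le> e" if e: "e > 0" for e
  proof -
    obtain C1 where C1: "compact C1" "C1 \<subseteq> A" "measure (cut_measure K \<mu>p) A - e < measure (cut_measure K \<mu>p) C1"
      by (rule inner_compact_approx[OF fin(1) _ _ e, of A]) auto
    obtain C2 where C2: "compact C2" "C2 \<subseteq> A" "measure (cut_measure K \<mu>m) A - e < measure (cut_measure K \<mu>m) C2"
      by (rule inner_compact_approx[OF fin(2) _ _ e, of A]) auto
    define C where "C = C1 \<union> C2"
    have C: "compact C" "C \<subseteq> A" using C1 C2 by (auto simp: C_def)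
    have [measurable]: "C \<in> sets borel" by (rule borel_compact[OF C(1)])
    have "measure \<mu> C \<le> measure \<mu> A" using C by (intro finite_measure_mono) auto
    then have "measure \<mu> C = 0" using A0 by (simp add: measure_le_0_iff)
    then have eq: "measure \<mu>p C = measure \<mu>m C"
      using C AK K by (intro Dint_null_compact[OF C(1) _ _ c]) auto
    have "measure (cut_measure K \<mu>p) C1 \<le> measure (cut_measure K \<mu>p) C"
      by (intro P.finite_measure_mono) (auto simp: C_def borel_compact C1(1) C2(1))
    moreover have "measure (cut_measure K \<mu>p) C \<le> measure (cut_measure K \<mu>p) A"
      using C by (intro P.finite_measure_mono) auto
    moreover have "measure (cut_measure K \<mu>m) C2 \<le> measure (cut_measure K \<mu>m) C"
      by (intro M.finite_measure_mono) (auto simp: C_def borel_compact C1(1) C2(1))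
    moreover have "measure (cut_measure K \<mu>m) C \<le> measure (cut_measure K \<mu>m) A"
      using C by (intro M.finite_measure_mono) auto
    moreover have "C \<subseteq> K" using C AK by blast
    ultimately show ?thesis using C1(3) C2(3) eq mc[of C] mc[of A] AK by (simp add: abs_le_iff)
  qed
  have "\<bar>measure \<mu>p A - measure \<mu>m A\<bar> \<le> 0"
    by (rule field_le_epsilon) (use main in simp)
  then show ?thesis by simp
qed

text \<open>The sets \<open>mid_dens E c\<close> grow as \<open>c\<close> decreases and exhaust the
  boundary, so continuity of the measures from below suffices.\<close>

lemma Dint_null:
  assumes K: "compact K" "K \<subseteq> \<Omega>" and [measurable]: "A \<in> sets borel" and AK: "A \<subseteq> K" "A \<subseteq> meas_boundary E"
    and A0: "measure \<mu> A = 0"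
  shows "measure \<mu>p A = measure \<mu>m A"
proof -
  define G where "G n = mid_dens E (1 / real (Suc n))" for n
  define X where "X n = A \<inter> G n" for n
  have Xb [measurable]: "X n \<in> sets borel" for n
    unfolding X_def G_def using mid_dens_borel[OF E_lebesgue] by auto
  have "G m \<subseteq> G n" if "m \<le> n" for m n
  proof -
    have "1 / real (Suc n) \<le> 1 / real (Suc m)" using that by (simp add: field_simps)
    then show ?thesis unfolding G_def mid_dens_def by force
  qed
  then have inc: "incseq X" unfolding X_def incseq_def by blast
  have UX: "(\<Union>n. X n) = A"
    using AK(2) meas_boundary_subset_mid_dens[OF E_lebesgue] unfolding X_def G_def by blast
  have eq: "measure \<mu>p (X n) = measure \<mu>m (X n)" for n
  proof (rule Dint_null_mid_dens[OF K Xb])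
    show "X n \<subseteq> K" "X n \<subseteq> mid_dens E (1 / real (Suc n))" using AK by (auto simp: X_def G_def)
    have "measure \<mu> (X n) \<le> measure \<mu> A" by (intro finite_measure_mono) (auto simp: X_def)
    then show "measure \<mu> (X n) = 0" using A0 by (simp add: measure_le_0_iff)
  qed simp
  have fin: "emeasure \<mu>p A \<noteq> \<infinity>" "emeasure \<mu>m A \<noteq> \<infinity>"
    using emeasure_mono[OF AK(1), of \<mu>p] emeasure_mono[OF AK(1), of \<mu>m] finite_on_compact[OF K] borel_compact[OF K(1)]
    by (auto simp: top_unique)
  have "range X \<subseteq> sets borel" using Xb by blast
  then have "(\<lambda>n. measure \<mu>p (X n)) \<longlonglongrightarrow> measure \<mu>p A" "(\<lambda>n. measure \<mu>m (X n)) \<longlonglongrightarrow> measure \<mu>m A"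
    using Lim_measure_incseq[OF _ inc, of \<mu>p] Lim_measure_incseq[OF _ inc, of \<mu>m] fin UX by auto
  then show ?thesis unfolding eq by (rule LIMSEQ_unique)
qed


lemma Bd_borel [measurable]: "meas_boundary E \<in> sets borel"
  by (rule meas_boundary_borel[OF E_lebesgue])

lemma E1_borel [measurable]: "dens_set E 1 \<in> sets borel"
  by (rule dens_set_borel[OF E_lebesgue])

text \<open>On the measure-theoretic boundary \<open>div F\<close> has a density with respect to \<open>\<mu>\<close>, although
  \<open>\<mu>p\<close> and \<open>\<mu>m\<close> separately need not; hence densities are taken with respect to a measure
  dominating all three.\<close>

lemma Dint_half:
  assumes K: "compact K" "K \<subseteq> \<Omega>" and fm [measurable]: "f \<in> borel_measurable borel"
    and fB: "\<And>x. \<bar>f x\<bar> \<le> B" and f0: "\<And>x. x \<notin> K \<inter> meas_boundary E \<Longrightarrow> f x = 0"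
  shows "(\<lambda>k. Dint (\<lambda>x. f x * U k x)) \<longlonglongrightarrow> Dint f / 2"
proof -
  have [measurable]: "K \<in> sets borel" using K by (auto intro: borel_compact)
  define Mp where "Mp = cut_measure K \<mu>p"
  define Mm where "Mm = cut_measure K \<mu>m"
  have sM [measurable_cong, simp]: "sets Mp = sets borel" "sets Mm = sets borel" by (auto simp: Mp_def Mm_def)
  have finp: "finite_measure Mp" and finm: "finite_measure Mm"
    unfolding Mp_def Mm_def using finite_on_compact[OF K] by (auto intro!: finite_cut_measure)
  interpret Mp: finite_measure Mp by fact
  interpret Mm: finite_measure Mm by fact
  have mc: "measure Mp A = measure \<mu>p (K \<inter> A)" "measure Mm A = measure \<mu>m (K \<inter> A)" if "A \<in> sets borel" for A
    using emeasure_cut_measure[of K \<mu>p A] emeasure_cut_measure[of K \<mu>m A] that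
    by (auto simp: measure_def Mp_def Mm_def)
  obtain S where S: "sets S = sets borel" "\<And>A. A \<in> sets borel \<Longrightarrow> emeasure S A = emeasure Mp A + emeasure Mm A"
    by (rule exists_sum_measure[OF sM(1,2)], (rule that; assumption))
  obtain T where T [measurable_cong, simp]: "sets T = sets borel" and T2: "\<And>A. A \<in> sets borel \<Longrightarrow> emeasure T A = emeasure S A + emeasure \<mu> A"
    by (rule exists_sum_measure[OF S(1) sets_mu], (rule that; assumption))
  have eT: "emeasure T A = emeasure Mp A + emeasure Mm A + emeasure \<mu> A" if "A \<in> sets borel" for A
    using T2[OF that] S(2)[OF that] by simp
  have finT: "finite_measure T"
    by (rule finite_measureI) (simp add: eT sets_eq_imp_space_eq[OF T])
  have ac: "absolutely_continuous T Mp" "absolutely_continuous T Mm" "absolutely_continuous T \<mu>"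
    unfolding absolutely_continuous_def null_sets_def by (auto simp: eT)
  obtain p where p [measurable]: "p \<in> borel_measurable T" and p0: "\<And>x. 0 \<le> p x"
    and Mpd: "Mp = density T (\<lambda>x. ennreal (p x))" and pint: "integrable T p"
    by (rule absolutely_continuous_density[OF finT finp ac(1)]) auto
  obtain q where q [measurable]: "q \<in> borel_measurable T" and q0: "\<And>x. 0 \<le> q x"
    and Mmd: "Mm = density T (\<lambda>x. ennreal (q x))" and qint: "integrable T q"
    by (rule absolutely_continuous_density[OF finT finm ac(2)]) auto
  obtain s where s [measurable]: "s \<in> borel_measurable T" and s0: "\<And>x. 0 \<le> s x"
    and mud: "\<mu> = density T (\<lambda>x. ennreal (s x))" and sint: "integrable T s"
    by (rule absolutely_continuous_density[OF finT finite_measure_axioms ac(3)]) auto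
  have pb [measurable]: "p \<in> borel_measurable borel" "q \<in> borel_measurable borel" "s \<in> borel_measurable borel"
    using p q s by (simp_all cong: measurable_cong_sets)
  have intp: "measure Mp A = (LINT x|T. p x * indicator A x)" "measure Mm A = (LINT x|T. q x * indicator A x)"
    "measure \<mu> A = (LINT x|T. s x * indicator A x)" if [measurable]: "A \<in> sets borel" for A
  proof -
    have "measure (density T (\<lambda>x. ennreal (h x))) A = (LINT x|T. h x * indicator A x)"
      if [measurable]: "h \<in> borel_measurable borel" and h: "\<And>x. 0 \<le> h x" for h
    proof -
      have "measure (density T (\<lambda>x. ennreal (h x))) A = (LINT x|density T (\<lambda>x. ennreal (h x)). indicator A x)"
        using sets_eq_imp_space_eq[OF T] by simp
      also have "\<dots> = (LINT x|T. h x * indicator A x)" using h by (subst integral_density) auto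
      finally show ?thesis .
    qed
    then show "measure Mp A = (LINT x|T. p x * indicator A x)" "measure Mm A = (LINT x|T. q x * indicator A x)"
      "measure \<mu> A = (LINT x|T. s x * indicator A x)"
      using pb p0 q0 s0 Mpd Mmd mud by metis+
  qed
  \<comment> \<open>\<open>\<mu>\<close> vanishes where its density \<open>s\<close> does, so both
    parts of the divergence give equal mass to such sets. A fixed sign of \<open>p - q\<close>
    upgrades this equality of integrals to equality almost everywhere.\<close>
  have zero: "AE x in T. indicator A x * (p x - q x) = 0"
    if [measurable]: "A \<in> sets borel" and A: "A \<subseteq> meas_boundary E" "\<And>x. x \<in> A \<Longrightarrow> s x = 0" and sgn: "\<And>x. x \<in> A \<Longrightarrow> c * (p x - q x) \<ge> 0" and "c = 1 \<or> c = -1" for A c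
  proof -
    have "(\<lambda>x. s x * indicator A x) = (\<lambda>x. 0)" using A(2) by (auto simp: fun_eq_iff indicator_def)
    then have "measure \<mu> A = 0" by (simp add: intp)
    moreover have "measure \<mu> (K \<inter> A) \<le> measure \<mu> A" by (intro finite_measure_mono) auto
    ultimately have "measure \<mu> (K \<inter> A) = 0" by (simp add: measure_le_0_iff)
    then have "measure \<mu>p (K \<inter> A) = measure \<mu>m (K \<inter> A)"
      using A(1) by (intro Dint_null[OF K]) auto
    then have "measure Mp A = measure Mm A" by (simp add: mc)
    then have eq: "(LINT x|T. p x * indicator A x) = (LINT x|T. q x * indicator A x)" by (simp add: intp)
    have i: "integrable T (\<lambda>x. p x * indicator A x)" "integrable T (\<lambda>x. q x * indicator A x)"
      using integrable_mult_bounded[OF pint, of "indicat_real A" 1] integrable_mult_bounded[OF qint, of "indicat_real A" 1]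
      by (auto simp: indicator_def)
    define g where "g x = c * (p x * indicator A x - q x * indicator A x)" for x
    have gi: "integrable T g" unfolding g_def using i by auto
    have "(LINT x|T. g x) = c * ((LINT x|T. p x * indicator A x) - (LINT x|T. q x * indicator A x))"
      unfolding g_def using i by simp
    then have "(LINT x|T. g x) = 0" using eq by simp
    moreover have "0 \<le> g x" for x using sgn[of x] by (auto simp: g_def indicator_def)
    ultimately have "AE x in T. g x = 0" using integral_nonneg_eq_0_iff_AE[OF gi] by simp
    then show ?thesis by eventually_elim (use that(5) in \<open>auto simp: g_def indicator_def\<close>)
  qed
  define Z where "Z = {x. s x = 0} \<inter> meas_boundary E"
  have Zm: "Z \<inter> {x. p x > q x} \<in> sets borel" "Z \<inter> {x. p x < q x} \<in> sets borel"
    unfolding Z_def by measurable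
  have "AE x in T. indicator (Z \<inter> {x. p x > q x}) x * (p x - q x) = 0"
    by (rule zero[OF Zm(1), of 1]) (auto simp: Z_def)
  moreover have "AE x in T. indicator (Z \<inter> {x. p x < q x}) x * (p x - q x) = 0"
    by (rule zero[OF Zm(2), of "-1"]) (auto simp: Z_def)
  ultimately have Zeq: "AE x in T. x \<in> Z \<longrightarrow> p x = q x"
  proof eventually_elim
    case (elim x)
    then show ?case by (cases "p x < q x"; cases "q x < p x") (auto simp: indicator_def)
  qed
  \<comment> \<open>This is the density of \<open>f div F\<close> with respect to
    \<open>\<mu>\<close>. Where \<open>s\<close> vanishes the value 0 is correct almost everywhere,
    since \<open>p = q\<close> there on the boundary and \<open>f\<close> vanishes off it.\<close>
  define g where "g x = (if s x = 0 then 0 else f x * (p x - q x) / s x)" for x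
  have [measurable]: "g \<in> borel_measurable borel" unfolding g_def by measurable
  have sg: "AE x in T. s x * (g x * h x) = f x * h x * (p x - q x)" for h
    using Zeq
  proof eventually_elim
    case (elim x)
    show ?case
    proof (cases "s x = 0")
      case True
      then have "f x * (p x - q x) = 0" using elim f0[of x] by (cases "x \<in> meas_boundary E") (auto simp: Z_def)
      then show ?thesis using True by (auto simp: g_def)
    qed (simp add: g_def)
  qed
  have ip: "integrable T (\<lambda>x. f x * h x * (p x - q x))" if [measurable]: "h \<in> borel_measurable borel" and "\<And>x. \<bar>h x\<bar> \<le> 1" for h
  proof -
    have "\<bar>f x * h x\<bar> \<le> B" for x
    proof -
      have "\<bar>f x * h x\<bar> \<le> \<bar>f x\<bar> * 1" unfolding abs_mult using that(2)[of x] by (intro mult_left_mono) auto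
      then show ?thesis using fB[of x] by simp
    qed
    then show ?thesis
      using integrable_mult_bounded[of T "\<lambda>x. p x - q x" "\<lambda>x. f x * h x" B] pint qint by (simp add: mult.commute)
  qed
  have eqg: "(LINT x|\<mu>. g x * h x) = Dint (\<lambda>x. f x * h x)" "integrable \<mu> (\<lambda>x. g x * h x)"
    if [measurable]: "h \<in> borel_measurable borel" and h: "\<And>x. \<bar>h x\<bar> \<le> 1" for h
  proof -
    have AEi: "integrable T (\<lambda>x. s x * (g x * h x))"
      using integrable_cong_AE[THEN iffD2, OF _ _ sg ip[OF that]] by simp
    then show "integrable \<mu> (\<lambda>x. g x * h x)"
      unfolding mud using s0 by (subst integrable_density) auto
    have "(LINT x|\<mu>. g x * h x) = (LINT x|T. s x * (g x * h x))"
      by (subst mud, subst integral_density) (use s0 in auto)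
    also have "\<dots> = (LINT x|T. f x * h x * (p x - q x))"
      by (rule integral_cong_AE[OF _ _ sg]) auto
    also have "\<dots> = (LINT x|T. p x * (f x * h x)) - (LINT x|T. q x * (f x * h x))"
    proof -
      have b: "\<bar>f x * h x\<bar> \<le> B" for x
      proof -
        have "\<bar>f x * h x\<bar> \<le> \<bar>f x\<bar> * 1" unfolding abs_mult using h[of x] by (intro mult_left_mono) auto
        then show ?thesis using fB[of x] by simp
      qed
      have "integrable T (\<lambda>x. p x * (f x * h x))" "integrable T (\<lambda>x. q x * (f x * h x))"
        using integrable_mult_bounded[OF pint, of "\<lambda>x. f x * h x" B] integrable_mult_bounded[OF qint, of "\<lambda>x. f x * h x" B] b by auto
      then show ?thesis by (subst Bochner_Integration.integral_diff[symmetric]) (auto simp: algebra_simps)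
    qed
    also have "(LINT x|T. p x * (f x * h x)) = (LINT x|Mp. f x * h x)"
      by (subst Mpd, subst integral_density) (use p0 in auto)
    also have "(LINT x|T. q x * (f x * h x)) = (LINT x|Mm. f x * h x)"
      by (subst Mmd, subst integral_density) (use q0 in auto)
    also have "(LINT x|Mp. f x * h x) = (LINT x|\<mu>p. f x * h x)"
      unfolding Mp_def by (rule integral_cut_measure) (use f0 in auto)
    also have "(LINT x|Mm. f x * h x) = (LINT x|\<mu>m. f x * h x)"
      unfolding Mm_def by (rule integral_cut_measure) (use f0 in auto)
    finally show "(LINT x|\<mu>. g x * h x) = Dint (\<lambda>x. f x * h x)" by (simp add: Dint_def)
  qed
  have "integrable \<mu> g" using eqg(2)[of "\<lambda>x. 1"] by simp
  from U_half[OF this] show ?thesis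
    using eqg(1)[of "\<lambda>x. 1"] eqg(1)[OF U_borel U_abs_le] by simp
qed

section \<open>Limits of the fluxes\<close>

definition Rlim :: "('a \<Rightarrow> real) \<Rightarrow> real" where
  "Rlim f = Dint (\<lambda>x. indicator (dens_set E 1) x * f x) + Dint (\<lambda>x. indicator (meas_boundary E) x * f x) / 2"

lemma Dint_add:
  assumes "integrable \<mu>p f" "integrable \<mu>m f" "integrable \<mu>p g" "integrable \<mu>m g"
  shows "Dint (\<lambda>x. f x + g x) = Dint f + Dint g"
  unfolding Dint_def using assms by simp

text \<open>Off the boundary every point has density 0 or 1, so \<open>U k\<close> converges
  pointwise and dominated convergence applies to each part of the divergence. On the boundary only
  the weak limit 1/2 from \<open>Dint_half\<close> is available.\<close>

lemma Dint_U_lim: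
  assumes K: "compact K" "K \<subseteq> \<Omega>" and [measurable]: "f \<in> borel_measurable borel"
    and fB: "\<And>x. \<bar>f x\<bar> \<le> B" and f0: "\<And>x. x \<notin> K \<Longrightarrow> f x = 0"
  shows "(\<lambda>k. Dint (\<lambda>x. f x * U k x)) \<longlonglongrightarrow> Rlim f"
proof -
  define fb where "fb x = indicator (meas_boundary E) x * f x" for x
  define fi where "fi x = indicator (- meas_boundary E) x * f x" for x
  have [measurable]: "fb \<in> borel_measurable borel" "fi \<in> borel_measurable borel" unfolding fb_def fi_def by measurable
  have fbB: "\<bar>fb x\<bar> \<le> \<bar>B\<bar>" "\<bar>fi x\<bar> \<le> \<bar>B\<bar>" for x using fB[of x] by (auto simp: fb_def fi_def indicator_def)
  have fUB: "\<bar>fb x * U k x\<bar> \<le> \<bar>B\<bar>" "\<bar>fi x * U k x\<bar> \<le> \<bar>B\<bar>" for x k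
    using mult_mono[OF fbB(1)[of x] U_abs_le[of k x]] mult_mono[OF fbB(2)[of x] U_abs_le[of k x]] by (auto simp: abs_mult)
  have 0: "fb x = 0" "fi x = 0" if "x \<notin> K" for x using f0[OF that] by (auto simp: fb_def fi_def)
  have "(\<lambda>k. Dint (\<lambda>x. fb x * U k x)) \<longlonglongrightarrow> Dint fb / 2"
    by (rule Dint_half[OF K _ fbB(1)]) (use 0 in \<open>auto simp: fb_def\<close>)
  moreover have "(\<lambda>k. Dint (\<lambda>x. fi x * U k x)) \<longlonglongrightarrow> Dint (\<lambda>x. indicator (dens_set E 1) x * f x)"
  proof -
    have pt: "(\<lambda>k. fi x * U k x) \<longlonglongrightarrow> indicator (dens_set E 1) x * f x" for x
    proof -
      consider "x \<in> dens_set E 1" | "x \<in> dens_set E 0" "x \<notin> dens_set E 1" | "x \<in> meas_boundary E"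
        by (auto simp: meas_boundary_def)
      then show ?thesis
      proof cases
        case 1
        then have "x \<notin> meas_boundary E" by (auto simp: meas_boundary_def)
        then show ?thesis using 1 tendsto_mult_left[OF U_tendsto_one[OF 1], of "f x"] by (simp add: fi_def)
      next
        case 2
        then have "x \<notin> meas_boundary E" by (auto simp: meas_boundary_def)
        then show ?thesis using 2 tendsto_mult_left[OF U_tendsto_zero[OF 2(1)], of "f x"] by (simp add: fi_def)
      next
        case 3
        then have "x \<notin> dens_set E 1" by (auto simp: meas_boundary_def)
        then show ?thesis using 3 by (simp add: fi_def)
      qed
    qed
    have "(\<lambda>k. LINT x|M. fi x * U k x) \<longlonglongrightarrow> (LINT x|M. indicator (dens_set E 1) x * f x)"
      if sM [measurable_cong]: "sets M = sets borel" and fM: "emeasure M K < \<infinity>" for M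
    proof (rule integral_dominated_convergence[where w = "\<lambda>x. indicator K x * \<bar>B\<bar>"])
      show "integrable M (\<lambda>x. indicator K x * \<bar>B\<bar>)" using fM sM borel_compact[OF K(1)] by simp
      show "AE x in M. norm (fi x * U k x) \<le> indicator K x * \<bar>B\<bar>" for k
        using fUB(2)[of _ k] 0 by (auto simp: indicator_def)
    qed (use pt in auto)
    then show ?thesis unfolding Dint_def
      using finite_on_compact[OF K] by (intro tendsto_diff) auto
  qed
  ultimately have "(\<lambda>k. Dint (\<lambda>x. fi x * U k x) + Dint (\<lambda>x. fb x * U k x)) \<longlonglongrightarrow> Rlim f"
    unfolding Rlim_def fb_def[abs_def] by (intro tendsto_add) auto
  moreover have "Dint (\<lambda>x. fi x * U k x) + Dint (\<lambda>x. fb x * U k x) = Dint (\<lambda>x. f x * U k x)" for k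
  proof -
    have "Dint (\<lambda>x. fi x * U k x + fb x * U k x) = Dint (\<lambda>x. fi x * U k x) + Dint (\<lambda>x. fb x * U k x)"
      by (intro Dint_add integrable_compact[OF K, of _ "\<bar>B\<bar>"]) (use 0 fUB in auto)
    moreover have "fi x * U k x + fb x * U k x = f x * U k x" for x
      by (auto simp: fi_def fb_def indicator_def)
    ultimately show ?thesis by simp
  qed
  ultimately show ?thesis by simp
qed

text \<open>The limit of the fluxes of \<open>\<nabla>u_k\<close> is defined by its value, so that
  linearity can be read off; that it is the limit is \<open>flux_limit\<close>.\<close>

definition Mlim :: "('a \<Rightarrow> real) \<Rightarrow> real" where
  "Mlim \<psi> = - (LINT x|lebesgue. indicator E x * (F0 x \<bullet> grad \<psi> x)) - Rlim \<psi>"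

lemma flux_integrable:
  assumes K: "compact K" "K \<subseteq> \<Omega>" and [measurable]: "v \<in> borel_measurable borel"
    and v0: "\<And>x. x \<notin> K \<Longrightarrow> v x = 0" and vB: "\<And>x. norm (v x) \<le> B"
  obtains C where "AE x in lebesgue. \<bar>F0 x \<bullet> v x\<bar> \<le> C" "integrable lebesgue (\<lambda>x. F0 x \<bullet> v x)"
proof -
  obtain C where C: "C \<ge> 0" "AE x in lebesgue. x \<in> K \<longrightarrow> norm (F0 x) \<le> C" using F0_bound[OF K] by blast
  have [measurable]: "v \<in> borel_measurable lebesgue" by (rule measurable_completion) measurable
  have B: "B \<ge> 0" using order_trans[OF norm_ge_zero vB] .
  have b: "AE x in lebesgue. \<bar>F0 x \<bullet> v x\<bar> \<le> indicator K x * (C * B)"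
    using C(2)
  proof eventually_elim
    case (elim x)
    show ?case
    proof (cases "x \<in> K")
      case True
      have "\<bar>F0 x \<bullet> v x\<bar> \<le> norm (F0 x) * norm (v x)" by (rule Cauchy_Schwarz_ineq2)
      also have "\<dots> \<le> C * B" using elim True vB C(1) by (intro mult_mono) auto
      finally show ?thesis using True by simp
    qed (simp add: v0)
  qed
  have "integrable lebesgue (\<lambda>x. F0 x \<bullet> v x)"
  proof (rule Bochner_Integration.integrable_bound[of _ "\<lambda>x. indicator K x * (C * B)"])
    show "integrable lebesgue (\<lambda>x. indicator K x * (C * B))"
      using emeasure_bounded_finite[OF compact_imp_bounded[OF K(1)]] borel_compact[OF K(1)] by simp
    show "AE x in lebesgue. norm (F0 x \<bullet> v x) \<le> norm (indicator K x * (C * B))"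
      using b by eventually_elim auto
  qed measurable
  moreover have "AE x in lebesgue. \<bar>F0 x \<bullet> v x\<bar> \<le> C * B"
    using b
  proof eventually_elim
    case (elim x) then show ?case using C(1) B by (cases "x \<in> K") auto
  qed
  ultimately show ?thesis using that by blast
qed

lemma test_flux_integrable:
  assumes t: "test_fun \<Omega> \<psi>"
  obtains C where "AE x in lebesgue. \<bar>F0 x \<bullet> grad \<psi> x\<bar> \<le> C" "integrable lebesgue (\<lambda>x. F0 x \<bullet> grad \<psi> x)"
proof -
  have K: "compact (tsupport \<psi>)" "tsupport \<psi> \<subseteq> \<Omega>" using t by (auto simp: test_fun_def)
  obtain B where B: "\<And>x. norm (grad \<psi> x) \<le> B"
    using compact_support_bounded[OF grad_continuous[OF test_fun_smooth[OF t]] K(1) test_fun_grad_zero[of _ \<psi>]] by blast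
  show ?thesis
    by (rule flux_integrable[OF K grad_borel[OF test_fun_smooth[OF t]] test_fun_grad_zero B that])
qed

lemma E_flux_integrable:
  assumes t: "test_fun \<Omega> \<psi>" and [measurable]: "h \<in> borel_measurable borel" and h: "\<And>x. \<bar>h x\<bar> \<le> 1"
  shows "integrable lebesgue (\<lambda>x. h x * (F0 x \<bullet> grad \<psi> x))"
proof -
  have "integrable lebesgue (\<lambda>x. F0 x \<bullet> grad \<psi> x)" using test_flux_integrable[OF t] by blast
  moreover have "h \<in> borel_measurable lebesgue" by (rule measurable_completion) measurable
  ultimately show ?thesis using integrable_mult_bounded[of lebesgue _ h 1] h by (simp add: mult.commute[of "h _"])
qed

lemma grad_U_mult_integrable:
  assumes t: "test_fun \<Omega> \<psi>" and sv: "smooth v"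
  shows "integrable lebesgue (\<lambda>x. \<psi> x * (F0 x \<bullet> grad v x))"
proof -
  have K: "compact (tsupport \<psi>)" "tsupport \<psi> \<subseteq> \<Omega>" using t by (auto simp: test_fun_def)
  note sm = test_fun_smooth[OF t]
  have c: "continuous_on UNIV (\<lambda>x. \<psi> x *\<^sub>R grad v x)"
    by (intro continuous_intros smooth_continuous[OF sm] grad_continuous[OF sv])
  have z: "\<psi> x *\<^sub>R grad v x = 0" if "x \<notin> tsupport \<psi>" for x using tsupport_zero[OF that] by simp
  obtain B where B: "\<And>x. norm (\<psi> x *\<^sub>R grad v x) \<le> B" using compact_support_bounded[OF c K(1) z] by blast
  show ?thesis
    by (rule flux_integrable[OF K borel_measurable_continuous_onI[OF c] z B]) simp_all
qed

lemma U_flux_lim: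
  assumes t: "test_fun \<Omega> \<psi>"
  shows "(\<lambda>k. LINT x|lebesgue. F0 x \<bullet> grad \<psi> x * U k x) \<longlonglongrightarrow> (LINT x|lebesgue. indicator E x * (F0 x \<bullet> grad \<psi> x))"
proof -
  obtain C where C: "AE x in lebesgue. \<bar>F0 x \<bullet> grad \<psi> x\<bar> \<le> C" and i: "integrable lebesgue (\<lambda>x. F0 x \<bullet> grad \<psi> x)"
    using test_flux_integrable[OF t] by blast
  have "(\<lambda>x. F0 x \<bullet> grad \<psi> x) \<in> borel_measurable lebesgue" using i by auto
  from U_L1_weak[OF this C i] show ?thesis by (simp add: mult.commute)
qed

lemma flux_limit:
  assumes t: "test_fun \<Omega> \<psi>"
  shows "(\<lambda>k. LINT x|lebesgue. \<psi> x * (F0 x \<bullet> grad (U k) x)) \<longlonglongrightarrow> Mlim \<psi>"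
proof -
  have K: "compact (tsupport \<psi>)" "tsupport \<psi> \<subseteq> \<Omega>" using t by (auto simp: test_fun_def)
  note sm = test_fun_smooth[OF t]
  obtain B where B: "\<And>x. \<bar>\<psi> x\<bar> \<le> B" using test_fun_bounded[OF t] by blast
  have id: "(LINT x|lebesgue. \<psi> x * (F0 x \<bullet> grad (U k) x)) =
      - (LINT x|lebesgue. F0 x \<bullet> grad \<psi> x * U k x) - Dint (\<lambda>x. \<psi> x * U k x)" for k
  proof -
    have tk: "test_fun \<Omega> (\<lambda>x. \<psi> x * U k x)" by (rule test_fun_mult_smooth[OF t U_smooth])
    have "F0 x \<bullet> grad (\<lambda>x. \<psi> x * U k x) x = \<psi> x * (F0 x \<bullet> grad (U k) x) + F0 x \<bullet> grad \<psi> x * U k x" for x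
      by (simp add: grad_mult[OF sm U_smooth] inner_add_right)
    then have "- Dint (\<lambda>x. \<psi> x * U k x) = (LINT x|lebesgue. \<psi> x * (F0 x \<bullet> grad (U k) x) + F0 x \<bullet> grad \<psi> x * U k x)"
      using DM_identity[OF tk] by simp
    also have "\<dots> = (LINT x|lebesgue. \<psi> x * (F0 x \<bullet> grad (U k) x)) + (LINT x|lebesgue. F0 x \<bullet> grad \<psi> x * U k x)"
      using grad_U_mult_integrable[OF t U_smooth] E_flux_integrable[OF t U_borel U_abs_le]
      by (intro Bochner_Integration.integral_add) (simp_all add: mult.commute)
    finally show ?thesis by simp
  qed
  show ?thesis
    unfolding id Mlim_def
    by (intro tendsto_intros U_flux_lim[OF t] Dint_U_lim[OF K smooth_borel[OF sm] B tsupport_zero[of _ \<psi>]])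
qed

text \<open>The formula for \<open>Mlim\<close> does not show this bound; it is inherited from the
  approximating integrals, since \<open>|\<nabla>u_k|\<close> is a mollification of at most
  \<open>\<mu>\<close>. Displacing mass changes \<open>\<psi>\<close> by less than \<open>d\<close>,
  which is then sent to 0. The constant depends only on the field over \<open>K\<close>.\<close>

lemma Mlim_bound:
  assumes K: "compact K" "K \<subseteq> \<Omega>"
  obtains C where "C \<ge> 0" "\<And>\<psi>. test_fun \<Omega> \<psi> \<Longrightarrow> (\<And>x. x \<notin> K \<Longrightarrow> \<psi> x = 0) \<Longrightarrow> \<bar>Mlim \<psi>\<bar> \<le> C * (LINT x|\<mu>. \<bar>\<psi> x\<bar>)"
proof -
  obtain C where C: "C \<ge> 0" "AE x in lebesgue. x \<in> K \<longrightarrow> norm (F0 x) \<le> C" using F0_bound[OF K] by blast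
  show ?thesis
  proof (rule that[OF C(1)])
    fix \<psi> assume t: "test_fun \<Omega> \<psi>" and z: "\<And>x. x \<notin> K \<Longrightarrow> \<psi> x = 0"
    note sm = test_fun_smooth[OF t]
    note [measurable] = smooth_borel[OF sm]
    obtain B where B: "\<And>x. \<bar>\<psi> x\<bar> \<le> B" using test_fun_bounded[OF t] by blast
    have ip: "integrable \<mu> \<psi>" by (rule integrable_bounded_mu[of _ B]) (use B in auto)
    define m where "m = measure \<mu> UNIV"
    have m: "m \<ge> 0" by (simp add: m_def)
    define J where "J = (LINT x|\<mu>. \<bar>\<psi> x\<bar>)"
    have J: "J \<ge> 0" by (simp add: J_def)
    have le: "\<bar>Mlim \<psi>\<bar> \<le> C * (J + d * m)" if d: "d > 0" for d
    proof -
      obtain r where r: "r > 0" "\<And>x y. dist x y < r \<Longrightarrow> dist (\<psi> x) (\<psi> y) < d"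
        using compact_support_uniformly_continuous[OF smooth_continuous[OF sm] K(1) z d] by blast
      have "\<forall>\<^sub>F k in sequentially. \<bar>LINT x|lebesgue. \<psi> x * (F0 x \<bullet> grad (U k) x)\<bar> \<le> C * (J + d * m)"
        using eventually_inverse_Suc[OF r(1)]
      proof eventually_elim
        case (elim k)
        have "(\<integral>\<^sup>+x. ennreal \<bar>\<psi> x\<bar> * ennreal (norm (grad (U k) x)) \<partial>lborel) \<le> (\<integral>\<^sup>+y. ennreal (\<bar>\<psi> y\<bar> + d) \<partial>\<mu>)"
          unfolding U_def
        proof (rule grad_mass)
          fix x y :: 'a assume "dist x y < 1 / real (Suc k)"
          then have "dist (\<psi> x) (\<psi> y) < d" using r(2) elim by (meson less_trans)
          then show "ennreal \<bar>\<psi> x\<bar> \<le> ennreal (\<bar>\<psi> y\<bar> + d)" by (intro ennreal_leI) (simp add: dist_real_def)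
        qed auto
        also have "\<dots> = ennreal (LINT y|\<mu>. \<bar>\<psi> y\<bar> + d)"
          using ip d by (intro nn_integral_eq_integral) auto
        also have "(LINT y|\<mu>. \<bar>\<psi> y\<bar> + d) = J + d * m"
          using ip by (simp add: J_def m_def mult.commute)
        finally have nn: "(\<integral>\<^sup>+x. ennreal (norm (\<psi> x *\<^sub>R grad (U k) x)) \<partial>lborel) \<le> ennreal (J + d * m)"
          by (simp add: ennreal_mult)
        have "\<bar>LINT x|lebesgue. F0 x \<bullet> (\<psi> x *\<^sub>R grad (U k) x)\<bar> \<le> C * (J + d * m)"
          by (rule flux_bound[OF K(1) C _ _ _ nn]) (use z J d m grad_borel[OF U_smooth] in auto)
        then show ?case by simp
      qed
      moreover have "(\<lambda>k. \<bar>LINT x|lebesgue. \<psi> x * (F0 x \<bullet> grad (U k) x)\<bar>) \<longlonglongrightarrow> \<bar>Mlim \<psi>\<bar>"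
        by (intro tendsto_rabs flux_limit t)
      ultimately show ?thesis by (intro tendsto_upperbound[OF _ _ sequentially_bot])
    qed
    show "\<bar>Mlim \<psi>\<bar> \<le> C * (LINT x|\<mu>. \<bar>\<psi> x\<bar>)"
      unfolding J_def[symmetric]
    proof (rule field_le_epsilon)
      fix e :: real assume e: "e > 0"
      define d where "d = e / (C * m + 1)"
      have Cm: "C * m \<ge> 0" using C m by simp
      have "d > 0" using e Cm by (simp add: d_def add_nonneg_pos)
      have "C * (d * m) = e * (C * m / (C * m + 1))" by (simp add: d_def)
      also have "\<dots> \<le> e * 1" using e Cm by (intro mult_left_mono) auto
      finally show "\<bar>Mlim \<psi>\<bar> \<le> C * J + e" using le[OF \<open>d > 0\<close>] by (simp add: distrib_left)
    qed
  qed
qed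

section \<open>Linearity of the limit functional\<close>

lemma Dint_lin:
  assumes "integrable \<mu>p f" "integrable \<mu>m f" "integrable \<mu>p g" "integrable \<mu>m g"
  shows "Dint (\<lambda>x. f x + c * g x) = Dint f + c * Dint g"
  unfolding Dint_def using assms by (simp add: algebra_simps)

lemma Mlim_lin:
  assumes s: "test_fun \<Omega> f" and t: "test_fun \<Omega> g" 
  shows "Mlim (\<lambda>x. f x + c * g x) = Mlim f + c * Mlim g"
proof -
  define K where "K = tsupport f \<union> tsupport g"
  have K: "compact K" "K \<subseteq> \<Omega>" using s t by (auto simp: test_fun_def K_def)
  have [measurable]: "f \<in> borel_measurable borel" "g \<in> borel_measurable borel"
    using s t smooth_borel test_fun_smooth by blast+
  have z: "f x = 0" "g x = 0" if "x \<notin> K" for x using that tsupport_zero by (auto simp: K_def)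
  obtain B where B: "\<And>x. \<bar>f x\<bar> \<le> B" using test_fun_bounded[OF s] by blast
  obtain B' where B': "\<And>x. \<bar>g x\<bar> \<le> B'" using test_fun_bounded[OF t] by blast
  have D: "Dint (\<lambda>x. indicator A x * (f x + c * g x)) = Dint (\<lambda>x. indicator A x * f x) + c * Dint (\<lambda>x. indicator A x * g x)"
    if [measurable]: "A \<in> sets borel" for A
  proof -
    have i: "integrable \<mu>p (\<lambda>x. indicator A x * f x)" "integrable \<mu>m (\<lambda>x. indicator A x * f x)"
      by (rule integrable_compact[OF K, of _ "\<bar>B\<bar>"]; use z B in \<open>auto simp: indicator_def intro: order_trans[OF B]\<close>)+
    have j: "integrable \<mu>p (\<lambda>x. indicator A x * g x)" "integrable \<mu>m (\<lambda>x. indicator A x * g x)"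
      by (rule integrable_compact[OF K, of _ "\<bar>B'\<bar>"]; use z B' in \<open>auto simp: indicator_def intro: order_trans[OF B']\<close>)+
    show ?thesis using Dint_lin[OF i j, of c] by (simp add: algebra_simps)
  qed
  have "grad (\<lambda>x. f x + c * g x) x = grad f x + c *\<^sub>R grad g x" for x
  proof -
    have "grad (\<lambda>x. c * g x) x = c *\<^sub>R grad g x"
      using grad_mult[OF smooth_const[of c] test_fun_smooth[OF t], of x] grad_eqI[of "\<lambda>x. c" 0 x] by simp
    then show ?thesis
      using grad_add[OF test_fun_smooth[OF s] smooth_mult[OF smooth_const[of c] test_fun_smooth[OF t]], of x] by simp
  qed
  then have eq: "indicator E x * (F0 x \<bullet> grad (\<lambda>x. f x + c * g x) x)
      = indicator E x * (F0 x \<bullet> grad f x) + c * (indicator E x * (F0 x \<bullet> grad g x))" for x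
    by (simp add: inner_add_right algebra_simps)
  have "integrable lebesgue (\<lambda>x. indicator E x * (F0 x \<bullet> grad f x))" "integrable lebesgue (\<lambda>x. indicator E x * (F0 x \<bullet> grad g x))"
    by (intro E_flux_integrable s t; simp add: indicator_def)+
  then have "(LINT x|lebesgue. indicator E x * (F0 x \<bullet> grad (\<lambda>x. f x + c * g x) x))
      = (LINT x|lebesgue. indicator E x * (F0 x \<bullet> grad f x)) + c * (LINT x|lebesgue. indicator E x * (F0 x \<bullet> grad g x))"
    unfolding eq by simp
  then show ?thesis unfolding Mlim_def Rlim_def D[OF E1_borel] D[OF Bd_borel] by (simp add: algebra_simps)
qed


lemma Mlim_zero: "Mlim (\<lambda>x. 0) = 0"
proof -
  have "test_fun \<Omega> (\<lambda>x::'a. 0)" by (rule test_funI[of _ "{}"]) (auto simp: smooth_const)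
  from Mlim_lin[OF this this, of "-1"] show ?thesis by simp
qed

lemma test_fun_add:
  assumes "test_fun A f" "test_fun A g" shows "test_fun A (\<lambda>x. f x + g x)"
proof (rule test_funI[of _ "tsupport f \<union> tsupport g"])
  show "smooth (\<lambda>x. f x + g x)" using assms by (intro smooth_add) (auto simp: test_fun_def)
  show "compact (tsupport f \<union> tsupport g)" "tsupport f \<union> tsupport g \<subseteq> A" using assms by (auto simp: test_fun_def)
  show "f x + g x = 0" if "x \<notin> tsupport f \<union> tsupport g" for x
    using that tsupport_zero[of x f] tsupport_zero[of x g] by simp
qed

lemma Mlim_sum:
  assumes "finite I" "\<And>i. i \<in> I \<Longrightarrow> test_fun \<Omega> (f i)"
  shows "test_fun \<Omega> (\<lambda>x. \<Sum>i\<in>I. f i x) \<and> Mlim (\<lambda>x. \<Sum>i\<in>I. f i x) = (\<Sum>i\<in>I. Mlim (f i))"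
  using assms
proof (induction I rule: finite_induct)
  case empty
  have "test_fun \<Omega> (\<lambda>x::'a. 0)" by (rule test_funI[of _ "{}"]) (auto simp: smooth_const)
  then show ?case by (simp add: Mlim_zero)
next
  case (insert i I)
  then show ?case
    using Mlim_lin[of "f i" "\<lambda>x. \<Sum>i\<in>I. f i x" 1] test_fun_add[of \<Omega> "f i" "\<lambda>x. \<Sum>i\<in>I. f i x"] by simp
qed

text \<open>A Banach--Saks argument: if \<open>|Mlim|\<close> stayed above \<open>\<epsilon>\<close> on infinitely many of the functions
  \<open>\<phi> (u_k - 1/2)\<close>, which tend weakly to \<open>0\<close>, then sums of \<open>n\<close> of them could be chosen almost
  orthogonal in \<open>L^2(\<mu>)\<close>, with norm of order \<open>sqrt n\<close>, although \<open>|Mlim|\<close> is at least \<open>n \<epsilon>\<close> there.\<close>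

lemma Mlim_half:
  assumes t: "test_fun \<Omega> \<phi>"
  shows "(\<lambda>k. Mlim (\<lambda>x. \<phi> x * U k x)) \<longlonglongrightarrow> Mlim \<phi> / 2"
proof -
  \<comment> \<open>This is \<open>\<phi> (u_k - 1/2)\<close>, spelled as a linear combination of
    two test functions to fit \<open>Mlim_lin\<close>.\<close>
  define v where "v k x = \<phi> x * U k x + (- 1 / 2) * \<phi> x" for k x
  have tU: "test_fun \<Omega> (\<lambda>x. \<phi> x * U k x)" for k by (rule test_fun_mult_smooth[OF t U_smooth])
  have tc: "test_fun \<Omega> (\<lambda>x. \<phi> x * c)" for c by (rule test_fun_mult_smooth[OF t smooth_const])
  have tv: "test_fun \<Omega> (v k)" for k
    using test_fun_add[OF tU[of k] tc[of "- 1 / 2"]] unfolding v_def by (simp add: mult.commute)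
  define d where "d k = Mlim (v k)" for k
  have Md: "Mlim (\<lambda>x. \<phi> x * U k x) = d k + Mlim \<phi> / 2" for k
    unfolding d_def v_def[abs_def] using Mlim_lin[OF tU[of k] t, of "- 1 / 2"] by simp
  have K: "compact (tsupport \<phi>)" "tsupport \<phi> \<subseteq> \<Omega>" using t by (auto simp: test_fun_def)
  obtain C where C: "C \<ge> 0" "\<And>\<psi>. test_fun \<Omega> \<psi> \<Longrightarrow> (\<And>x. x \<notin> tsupport \<phi> \<Longrightarrow> \<psi> x = 0) \<Longrightarrow> \<bar>Mlim \<psi>\<bar> \<le> C * (LINT x|\<mu>. \<bar>\<psi> x\<bar>)"
    using Mlim_bound[OF K] by metis
  obtain B where B: "B > 0" "\<And>x. \<bar>\<phi> x\<bar> \<le> B" using test_fun_bounded[OF t] by blast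
  note [measurable] = smooth_borel[OF test_fun_smooth[OF t]]
  have vm [measurable]: "v k \<in> borel_measurable borel" for k by (rule smooth_borel[OF test_fun_smooth[OF tv]])
  have vB: "\<bar>v k x\<bar> \<le> B" for k x
  proof -
    have "v k x = \<phi> x * (U k x - 1 / 2)" by (simp add: v_def algebra_simps)
    moreover have "\<bar>U k x - 1 / 2\<bar> \<le> 1" using u_bounds[of "1 / real (Suc k)" x] by (auto simp: U_def abs_le_iff simp del: of_nat_Suc)
    ultimately have "\<bar>v k x\<bar> \<le> B * 1" unfolding abs_mult using B by (simp only: abs_mult) (intro mult_mono, auto)
    then show ?thesis by simp
  qed
  define m where "m = measure \<mu> UNIV"
  have m: "m \<ge> 0" by (simp add: m_def)
  \<comment> \<open>The growth allowed per summand of a selected sum: at most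
    \<open>B\<^sup>2 * m\<close> from the square of the new term and at most 1 from twice the cross
    term, which is below 1/2 for all late indices.\<close>
  define Q where "Q = B\<^sup>2 * m + 1"
  have Q: "Q > 0" using m by (simp add: Q_def add_nonneg_pos)
  have v2: "(LINT x|\<mu>. (v k x)\<^sup>2) \<le> B\<^sup>2 * m" for k
  proof -
    have le: "(v k x)\<^sup>2 \<le> B\<^sup>2" for x using power_mono[OF vB[of k x] abs_ge_zero, of 2] by simp
    have "(LINT x|\<mu>. (v k x)\<^sup>2) \<le> (LINT x|\<mu>. B\<^sup>2)"
      by (rule integral_mono) (use le in \<open>auto intro!: integrable_bounded_mu[of _ "B\<^sup>2"]\<close>)
    then show ?thesis by (simp add: m_def mult.commute)
  qed
  have wB: "\<exists>D. \<forall>x. \<bar>\<Sum>k\<in>I. v k x\<bar> \<le> D" for I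
  proof (intro exI allI)
    fix x have "\<bar>\<Sum>k\<in>I. v k x\<bar> \<le> (\<Sum>k\<in>I. \<bar>v k x\<bar>)" by (rule sum_abs)
    also have "\<dots> \<le> (\<Sum>k\<in>I. B)" by (intro sum_mono vB)
    finally show "\<bar>\<Sum>k\<in>I. v k x\<bar> \<le> (\<Sum>k\<in>I. B)" .
  qed
  have weak: "(\<lambda>k. LINT x|\<mu>. w x * v k x) \<longlonglongrightarrow> 0"
    if [measurable]: "w \<in> borel_measurable borel" and D: "\<And>x. \<bar>w x\<bar> \<le> D" for w D
  proof -
    have "\<bar>w x * \<phi> x\<bar> \<le> D * B" for x
      unfolding abs_mult using D[of x] B by (intro mult_mono) (auto intro: order_trans[OF abs_ge_zero])
    then have i: "integrable \<mu> (\<lambda>x. w x * \<phi> x)" by (intro integrable_bounded_mu[of _ "D * B"]) auto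
    have iU: "integrable \<mu> (\<lambda>x. w x * \<phi> x * U k x)" for k
      using integrable_mult_bounded[OF i, of "U k" 1] U_abs_le by simp
    have "(LINT x|\<mu>. w x * v k x) = (LINT x|\<mu>. w x * \<phi> x * U k x) - (LINT x|\<mu>. w x * \<phi> x) / 2" for k
    proof -
      have "(LINT x|\<mu>. w x * v k x) = (LINT x|\<mu>. w x * \<phi> x * U k x - w x * \<phi> x / 2)"
        by (intro Bochner_Integration.integral_cong) (auto simp: v_def algebra_simps)
      then show ?thesis using iU[of k] i by simp
    qed
    moreover have "(\<lambda>k. (LINT x|\<mu>. w x * \<phi> x * U k x) - (LINT x|\<mu>. w x * \<phi> x) / 2) \<longlonglongrightarrow> (LINT x|\<mu>. w x * \<phi> x) / 2 - (LINT x|\<mu>. w x * \<phi> x) / 2"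
      by (intro tendsto_diff U_half[OF i] tendsto_const)
    ultimately show ?thesis by simp
  qed
  \<comment> \<open>Fixing the sign \<open>s\<close> ensures that the values of \<open>Mlim\<close>
    on the selected functions add up instead of cancelling.\<close>
  have no: False if "e > 0" and freq: "\<exists>\<^sub>F k in sequentially. s * d k \<ge> e" and s: "s = 1 \<or> s = -1" for e s
  proof -
    have "\<exists>I. finite I \<and> card I = n \<and> (\<forall>k\<in>I. s * d k \<ge> e) \<and> (LINT x|\<mu>. (\<Sum>k\<in>I. v k x)\<^sup>2) \<le> real n * Q" for n
    proof (induction n)
      case 0 show ?case by (intro exI[of _ "{}"]) simp
    next
      case (Suc n)
      then obtain I where I: "finite I" "card I = n" "\<forall>k\<in>I. s * d k \<ge> e" "(LINT x|\<mu>. (\<Sum>k\<in>I. v k x)\<^sup>2) \<le> real n * Q" by blast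
      define w where "w x = (\<Sum>k\<in>I. v k x)" for x
      have [measurable]: "w \<in> borel_measurable borel" unfolding w_def by measurable
      obtain D where D: "\<And>x. \<bar>w x\<bar> \<le> D" using wB[of I] unfolding w_def by blast
      have D0: "D \<ge> 0" using order_trans[OF abs_ge_zero D] .
      have "\<forall>\<^sub>F k in sequentially. (LINT x|\<mu>. w x * v k x) < 1 / 2"
      proof (rule order_tendstoD(2))
        show "(\<lambda>k. LINT x|\<mu>. w x * v k x) \<longlonglongrightarrow> 0" by (rule weak[OF _ D]) measurable
      qed simp
      moreover have "\<forall>\<^sub>F k in sequentially. k \<notin> I"
        using eventually_gt_at_top[of "Max (insert 0 I)"]
      proof eventually_elim
        case (elim k)
        then show ?case using I(1) by (auto dest: Max_ge[of "insert 0 I" k, rotated])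
      qed
      ultimately have "\<forall>\<^sub>F k in sequentially. (LINT x|\<mu>. w x * v k x) < 1 / 2 \<and> k \<notin> I"
        by (rule eventually_conj)
      then have "\<exists>\<^sub>F k in sequentially. ((LINT x|\<mu>. w x * v k x) < 1 / 2 \<and> k \<notin> I) \<and> s * d k \<ge> e"
        by (rule frequently_eventually_conj[OF freq])
      then obtain k where k: "s * d k \<ge> e" "(LINT x|\<mu>. w x * v k x) < 1 / 2" "k \<notin> I"
        by (auto dest: frequently_ex)
      have i: "integrable \<mu> (\<lambda>x. (w x)\<^sup>2)" "integrable \<mu> (\<lambda>x. w x * v k x)" "integrable \<mu> (\<lambda>x. (v k x)\<^sup>2)"
      proof -
        have "norm ((w x)\<^sup>2) \<le> D\<^sup>2" for x using power_mono[OF D[of x] abs_ge_zero, of 2] by simp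
        then show "integrable \<mu> (\<lambda>x. (w x)\<^sup>2)" by (rule integrable_bounded_mu[rotated]) measurable
        have "norm (w x * v k x) \<le> D * B" for x
          unfolding real_norm_def abs_mult using D0 by (intro mult_mono D vB) auto
        then show "integrable \<mu> (\<lambda>x. w x * v k x)" by (rule integrable_bounded_mu[rotated]) measurable
        have "norm ((v k x)\<^sup>2) \<le> B\<^sup>2" for x using power_mono[OF vB[of k x] abs_ge_zero, of 2] by simp
        then show "integrable \<mu> (\<lambda>x. (v k x)\<^sup>2)" by (rule integrable_bounded_mu[rotated]) measurable
      qed
      have "(LINT x|\<mu>. (\<Sum>j\<in>insert k I. v j x)\<^sup>2) = (LINT x|\<mu>. (w x)\<^sup>2 + 2 * (w x * v k x) + (v k x)\<^sup>2)"
        using I(1) k(3) by (intro Bochner_Integration.integral_cong) (auto simp: w_def power2_eq_square algebra_simps)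
      also have "\<dots> = (LINT x|\<mu>. (w x)\<^sup>2) + 2 * (LINT x|\<mu>. w x * v k x) + (LINT x|\<mu>. (v k x)\<^sup>2)"
        using i by simp
      also have "\<dots> \<le> real n * Q + 1 + B\<^sup>2 * m"
        using I(4) k(2) v2[of k] by (simp add: w_def)
      also have "\<dots> = real (Suc n) * Q" by (simp add: Q_def algebra_simps)
      finally show ?case using I k by (intro exI[of _ "insert k I"]) auto
    qed
    then have "\<forall>n. \<exists>I. finite I \<and> card I = n \<and> (\<forall>k\<in>I. s * d k \<ge> e) \<and> (LINT x|\<mu>. (\<Sum>k\<in>I. v k x)\<^sup>2) \<le> real n * Q" by blast
    note sums = this
    \<comment> \<open>With \<open>|w| \<le> (\<delta> w\<^sup>2 + 1 / \<delta>) / 2\<close>, this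
      choice gives \<open>C * \<delta> * Q \<le> e\<close>, so the quadratic term absorbs at most
      half of \<open>n * e\<close>. What remains bounds \<open>n * e\<close> independently of
      \<open>n\<close>.\<close>
    define \<delta> where "\<delta> = e / ((C + 1) * Q)"
    have \<delta>: "\<delta> > 0" using \<open>e > 0\<close> C(1) Q by (simp add: \<delta>_def add_nonneg_pos)
    have le: "real n * e \<le> C * (m / \<delta>)" for n
    proof -
      obtain I where I: "finite I" "card I = n" "\<And>k. k \<in> I \<Longrightarrow> s * d k \<ge> e" "(LINT x|\<mu>. (\<Sum>k\<in>I. v k x)\<^sup>2) \<le> real n * Q"
        using sums by blast
      define w where "w x = (\<Sum>k\<in>I. v k x)" for x
      have [measurable]: "w \<in> borel_measurable borel" unfolding w_def by measurable
      obtain D where D: "\<And>x. \<bar>w x\<bar> \<le> D" using wB[of I] unfolding w_def by blast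
      have tw: "test_fun \<Omega> w" and Mw: "Mlim w = (\<Sum>k\<in>I. d k)"
        using Mlim_sum[OF I(1), of v] tv unfolding w_def[abs_def] d_def by auto
      have z: "w x = 0" if "x \<notin> tsupport \<phi>" for x using tsupport_zero[OF that] by (simp add: w_def v_def)
      have iw: "integrable \<mu> (\<lambda>x. \<bar>w x\<bar>)" by (rule integrable_bounded_mu[of _ D]) (use D in auto)
      have "norm ((w x)\<^sup>2) \<le> D\<^sup>2" for x using power_mono[OF D[of x] abs_ge_zero, of 2] by simp
      then have iw2: "integrable \<mu> (\<lambda>x. (w x)\<^sup>2)" by (rule integrable_bounded_mu[rotated]) measurable
      have pt: "\<bar>w x\<bar> \<le> (\<delta> * (w x)\<^sup>2 + 1 / \<delta>) / 2" for x
      proof -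
        have "0 \<le> (\<delta> * \<bar>w x\<bar> - 1)\<^sup>2 / \<delta>" using \<delta> by simp
        also have "\<dots> = \<delta> * (w x)\<^sup>2 + 1 / \<delta> - 2 * \<bar>w x\<bar>"
          using \<delta> by (simp add: power2_eq_square field_simps)
        finally show ?thesis by simp
      qed
      have "(LINT x|\<mu>. \<bar>w x\<bar>) \<le> (LINT x|\<mu>. (\<delta> * (w x)\<^sup>2 + 1 / \<delta>) / 2)"
        using iw iw2 pt by (intro integral_mono) auto
      also have "\<dots> = (\<delta> * (LINT x|\<mu>. (w x)\<^sup>2) + m / \<delta>) / 2"
        using iw2 by (simp add: m_def)
      also have "\<dots> \<le> (\<delta> * (real n * Q) + m / \<delta>) / 2"
        using I(4) \<delta> by (intro divide_right_mono add_right_mono mult_left_mono) (auto simp: w_def)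
      finally have L1: "(LINT x|\<mu>. \<bar>w x\<bar>) \<le> (\<delta> * (real n * Q) + m / \<delta>) / 2" .
      have "real n * e = (\<Sum>k\<in>I. e)" using I(2) by simp
      also have "\<dots> \<le> (\<Sum>k\<in>I. s * d k)" by (intro sum_mono I(3))
      also have "\<dots> = s * Mlim w" by (simp add: Mw sum_distrib_left)
      also have "\<dots> \<le> \<bar>Mlim w\<bar>" using s by auto
      also have "\<dots> \<le> C * (LINT x|\<mu>. \<bar>w x\<bar>)" by (rule C(2)[OF tw z])
      also have "\<dots> \<le> C * ((\<delta> * (real n * Q) + m / \<delta>) / 2)" by (intro mult_left_mono L1 C)
      also have "\<dots> = (C * \<delta> * Q) * real n / 2 + C * (m / \<delta>) / 2" by (simp add: algebra_simps add_divide_distrib)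
      also have "C * \<delta> * Q = e * (C / (C + 1))" using Q by (simp add: \<delta>_def)
      also have "e * (C / (C + 1)) * real n / 2 \<le> e * real n / 2"
      proof -
        have "C / (C + 1) \<le> 1" using C(1) by (simp add: divide_le_eq_1)
        then have "e * (C / (C + 1)) \<le> e * 1" using \<open>e > 0\<close> by (intro mult_left_mono) auto
        then show ?thesis by (intro divide_right_mono mult_right_mono) auto
      qed
      finally show ?thesis by (simp add: mult.commute)
    qed
    obtain n where "real n > C * (m / \<delta>) / e" using reals_Archimedean2 by blast
    then have "C * (m / \<delta>) < real n * e" using \<open>e > 0\<close> by (simp only: pos_divide_less_eq)
    then show False using le[of n] by simp
  qed
  have "d \<longlonglongrightarrow> 0"
  proof (rule ccontr)
    assume "\<not> d \<longlonglongrightarrow> 0"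
    then obtain e where e: "e > 0" "\<not> (\<forall>\<^sub>F k in sequentially. dist (d k) 0 < e)" unfolding tendsto_iff by blast
    then have "\<exists>\<^sub>F k in sequentially. 1 * d k \<ge> e \<or> (-1) * d k \<ge> e"
      unfolding not_eventually by (elim frequently_elim1) (auto simp: abs_if split: if_splits)
    then show False using no[OF e(1), of 1] no[OF e(1), of "-1"] by (auto simp: frequently_disj_iff)
  qed
  then have "(\<lambda>k. d k + Mlim \<phi> / 2) \<longlonglongrightarrow> 0 + Mlim \<phi> / 2" by (intro tendsto_intros)
  then show ?thesis by (simp add: Md)
qed

section \<open>The flux of the mollified gradients through \<open>E\<close> and the trace
  formula\<close>

lemma interior_flux_limit:
  assumes t: "test_fun \<Omega> \<phi>"
  shows "(\<lambda>k. LINT x|lebesgue. indicator E x * (\<phi> x * (F0 x \<bullet> grad (U k) x))) \<longlonglongrightarrow>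
    - (Dint (\<lambda>x. indicator (dens_set E 1) x * \<phi> x) + (LINT x|lebesgue. indicator E x * (F0 x \<bullet> grad \<phi> x))) / 2"
proof -
  define A where "A = (LINT x|lebesgue. indicator E x * (F0 x \<bullet> grad \<phi> x))"
  define f1 where "f1 x = indicator (dens_set E 1) x * \<phi> x" for x
  define f2 where "f2 x = indicator (meas_boundary E) x * \<phi> x" for x
  note sm = test_fun_smooth[OF t]
  note [measurable] = smooth_borel[OF sm]
  have [measurable]: "f1 \<in> borel_measurable borel" "f2 \<in> borel_measurable borel" unfolding f1_def f2_def by measurable
  have K: "compact (tsupport \<phi>)" "tsupport \<phi> \<subseteq> \<Omega>" using t by (auto simp: test_fun_def)
  obtain B where B: "B > 0" "\<And>x. \<bar>\<phi> x\<bar> \<le> B" using test_fun_bounded[OF t] by blast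
  have fB: "\<bar>f1 x\<bar> \<le> B" "\<bar>f2 x\<bar> \<le> B" for x using B by (auto simp: f1_def f2_def indicator_def less_imp_le)
  have f0: "f1 x = 0" "f2 x = 0" if "x \<notin> tsupport \<phi>" for x using tsupport_zero[OF that] by (auto simp: f1_def f2_def)
  have disj: "dens_set E 1 \<inter> meas_boundary E = {}" by (auto simp: meas_boundary_def)
  have Dz: "Dint (\<lambda>x. 0) = 0" by (simp add: Dint_def)
  have R1: "Rlim f1 = Dint f1"
  proof -
    have "(\<lambda>x. indicator (dens_set E 1) x * f1 x) = f1" "(\<lambda>x. indicator (meas_boundary E) x * f1 x) = (\<lambda>x. 0)"
      using disj by (auto simp: f1_def indicator_def fun_eq_iff)
    then show ?thesis by (simp add: Rlim_def Dz)
  qed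
  have R2: "Rlim f2 = Dint f2 / 2"
  proof -
    have "(\<lambda>x. indicator (dens_set E 1) x * f2 x) = (\<lambda>x. 0)" "(\<lambda>x. indicator (meas_boundary E) x * f2 x) = f2"
      using disj by (auto simp: f2_def indicator_def fun_eq_iff)
    then show ?thesis by (simp add: Rlim_def Dz)
  qed
  have Rphi: "Rlim \<phi> = Dint f1 + Dint f2 / 2" by (simp add: Rlim_def f1_def[abs_def] f2_def[abs_def])
  \<comment> \<open>The boundary part is halved twice, once by its weight in \<open>Rlim\<close> and
    once by the weak limit of \<open>U k\<close>. In \<open>- Mlim \<phi> / 2\<close> it reappears
    with the same factor 1/4 and the opposite sign.\<close>
  have lim1: "(\<lambda>k. Rlim (\<lambda>x. \<phi> x * U k x)) \<longlonglongrightarrow> Dint f1 + Dint f2 / 2 / 2"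
  proof -
    have "Rlim (\<lambda>x. \<phi> x * U k x) = Dint (\<lambda>x. f1 x * U k x) + Dint (\<lambda>x. f2 x * U k x) / 2" for k
      by (simp add: Rlim_def f1_def f2_def mult.assoc)
    moreover have "(\<lambda>k. Dint (\<lambda>x. f1 x * U k x) + Dint (\<lambda>x. f2 x * U k x) / 2) \<longlonglongrightarrow> Rlim f1 + Rlim f2 / 2"
      by (intro tendsto_intros Dint_U_lim[OF K _ fB(1) f0(1)] Dint_U_lim[OF K _ fB(2) f0(2)]) auto
    ultimately show ?thesis by (simp add: R1 R2)
  qed
  have iE: "\<bar>indicat_real E x\<bar> \<le> 1" for x by (simp add: indicator_def)
  have lim2: "(\<lambda>k. LINT x|lebesgue. indicator E x * (F0 x \<bullet> grad \<phi> x) * U k x) \<longlonglongrightarrow> A"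
  proof -
    obtain C where C: "AE x in lebesgue. \<bar>F0 x \<bullet> grad \<phi> x\<bar> \<le> C" using test_flux_integrable[OF t] by blast
    have i: "integrable lebesgue (\<lambda>x. indicator E x * (F0 x \<bullet> grad \<phi> x))"
      by (rule E_flux_integrable[OF t _ iE]) measurable
    have "AE x in lebesgue. \<bar>indicator E x * (F0 x \<bullet> grad \<phi> x)\<bar> \<le> C"
      using C
    proof eventually_elim
      case (elim x) then show ?case using order_trans[OF abs_ge_zero elim] by (cases "x \<in> E") auto
    qed
    moreover have "(\<lambda>x. indicator E x * (F0 x \<bullet> grad \<phi> x)) \<in> borel_measurable lebesgue" using i by auto
    moreover have "(LINT x|lebesgue. indicator E x * (F0 x \<bullet> grad \<phi> x) * indicator E x) = A"
      unfolding A_def by (intro Bochner_Integration.integral_cong) (auto simp: indicator_def)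
    ultimately show ?thesis using U_L1_weak[OF _ _ i] by metis
  qed
  have id: "(LINT x|lebesgue. indicator E x * (\<phi> x * (F0 x \<bullet> grad (U k) x)))
     = - Mlim (\<lambda>x. \<phi> x * U k x) - (LINT x|lebesgue. indicator E x * (F0 x \<bullet> grad \<phi> x) * U k x) - Rlim (\<lambda>x. \<phi> x * U k x)" for k
  proof -
    have eq: "indicator E x * (F0 x \<bullet> grad (\<lambda>x. \<phi> x * U k x) x)
       = indicator E x * (\<phi> x * (F0 x \<bullet> grad (U k) x)) + indicator E x * (F0 x \<bullet> grad \<phi> x) * U k x" for x
      by (simp add: grad_mult[OF sm U_smooth] inner_add_right algebra_simps)
    have Em: "indicat_real E \<in> borel_measurable lebesgue" by (rule measurable_completion) measurable
    have i1: "integrable lebesgue (\<lambda>x. indicator E x * (\<phi> x * (F0 x \<bullet> grad (U k) x)))"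
      using integrable_mult_bounded[OF grad_U_mult_integrable[OF t U_smooth[of k]] Em, of 1] iE
      by (simp add: mult.commute[of "indicator E _"])
    have i2: "integrable lebesgue (\<lambda>x. (indicator E x * U k x) * (F0 x \<bullet> grad \<phi> x))"
    proof (rule E_flux_integrable[OF t])
      show "\<bar>indicator E x * U k x\<bar> \<le> 1" for x using U_abs_le[of k x] by (auto simp: indicator_def)
    qed measurable
    then have i3: "integrable lebesgue (\<lambda>x. indicator E x * (F0 x \<bullet> grad \<phi> x) * U k x)"
      by (simp add: mult_ac)
    have "(LINT x|lebesgue. indicator E x * (F0 x \<bullet> grad (\<lambda>x. \<phi> x * U k x) x))
       = (LINT x|lebesgue. indicator E x * (\<phi> x * (F0 x \<bullet> grad (U k) x))) + (LINT x|lebesgue. indicator E x * (F0 x \<bullet> grad \<phi> x) * U k x)"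
      unfolding eq by (rule Bochner_Integration.integral_add[OF i1 i3])
    then show ?thesis unfolding Mlim_def by simp
  qed
  have "(\<lambda>k. - Mlim (\<lambda>x. \<phi> x * U k x) - (LINT x|lebesgue. indicator E x * (F0 x \<bullet> grad \<phi> x) * U k x) - Rlim (\<lambda>x. \<phi> x * U k x))
     \<longlonglongrightarrow> - (Mlim \<phi> / 2) - A - (Dint f1 + Dint f2 / 2 / 2)"
    by (intro tendsto_intros Mlim_half[OF t] lim1 lim2)
  moreover have "- (Mlim \<phi> / 2) - A - (Dint f1 + Dint f2 / 2 / 2) = - (Dint f1 + A) / 2"
    by (simp add: Mlim_def A_def[symmetric] Rphi field_simps)
  ultimately show ?thesis unfolding id A_def[symmetric] f1_def[abs_def, symmetric] by (simp only:)
qed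

text \<open>By the convention on \<open>E\<close> the two sets differ only within the
  measure-theoretic boundary, whose nullity was obtained by covering and takes the place of
  Lebesgue's density theorem.\<close>

lemma E_ae_eq_E1:
  assumes "E = dens_set E 1 \<union> meas_boundary E"
  shows "AE x in lebesgue. indicat_real E x = indicator (dens_set E 1) x"
proof -
  have "AE x in lebesgue. x \<notin> meas_boundary E" by (rule AE_not_in[OF meas_boundary_null])
  then show ?thesis
  proof eventually_elim
    case (elim x) then show ?case using assms by (auto simp: indicator_def)
  qed
qed

end

theorem theorem5p3:
  fixes \<Omega> E :: "'a::euclidean_space set"
    and F :: "'a \<Rightarrow> 'a"
    and \<mu>p \<mu>m \<mu> :: "'a measure"
    and \<sigma> :: "'a \<Rightarrow> 'a"
    and \<rho> g \<phi> :: "'a \<Rightarrow> real"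
  assumes "open \<Omega>"
    and "DM_loc \<Omega> F \<mu>p \<mu>m"
    and "finite_perimeter E"
    and "E = dens_set E 1 \<union> meas_boundary E"
    and "bounded E" and "closure E \<subseteq> \<Omega>"
    and "gauss_green E \<mu> \<sigma>"
    and "mollifier \<rho>"
    and "interior_normal_trace \<Omega> E F \<rho> \<mu> \<sigma> g"
    and "test_fun \<Omega> \<phi>"
  shows "((LINT y:dens_set E 1|\<mu>p. \<phi> y) - (LINT y:dens_set E 1|\<mu>m. \<phi> y))
           + (LINT y:dens_set E 1|lebesgue. F y \<bullet> grad \<phi> y)
         = - (LINT y:reduced_boundary \<mu> \<sigma>|hausdorff (real DIM('a) - 1). \<phi> y * g y)"
proof -
  have "E \<in> sets lebesgue" using assms(3) by (simp add: finite_perimeter_def)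
  then have "E \<in> sets borel"
    using assms(4) dens_set_borel[of E 1] meas_boundary_borel[of E] by (metis sets.Un)
  then interpret dm_set \<rho> E \<mu> \<sigma> \<Omega> F \<mu>p \<mu>m
    by unfold_locales (use assms in auto)
  define T where "T = (LINT y:reduced_boundary \<mu> \<sigma>|hausdorff (real DIM('a) - 1). \<phi> y * g y)"
  define A where "A = (LINT x|lebesgue. indicator E x * (F0 x \<bullet> grad \<phi> x))"
  define D where "D = Dint (\<lambda>x. indicator (dens_set E 1) x * \<phi> x)"
  note t = \<open>test_fun \<Omega> \<phi>\<close>
  have "cc_fun \<Omega> \<phi>" using t by (simp add: cc_fun_def test_fun_def smooth_continuous)
  then have "(\<lambda>k. LINT x|lebesgue. \<phi> x * (2 * indicator E x * (F x \<bullet> grad (moll_char \<rho> E (Suc k)) x))) \<longlonglongrightarrow> T"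
    using assms(9) unfolding interior_normal_trace_def T_def by blast
  moreover have "(LINT x|lebesgue. \<phi> x * (2 * indicator E x * (F x \<bullet> grad (moll_char \<rho> E (Suc k)) x)))
      = 2 * (LINT x|lebesgue. indicator E x * (\<phi> x * (F0 x \<bullet> grad (U k) x)))" for k
  proof -
    \<comment> \<open>Off \<open>\<Omega>\<close> the values of \<open>F\<close> are arbitrary, but
      \<open>\<phi>\<close> vanishes there, so the integrands with \<open>F\<close> and
      \<open>F0\<close> agree everywhere.\<close>
    have "\<phi> x = 0" if "x \<notin> \<Omega>" for x using t that tsupport_zero[of x \<phi>] by (auto simp: test_fun_def)
    then have "\<phi> x * (2 * indicator E x * (F x \<bullet> grad (moll_char \<rho> E (Suc k)) x))
      = 2 * (indicator E x * (\<phi> x * (F0 x \<bullet> grad (U k) x)))" for x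
      unfolding moll_char_eq_u U_def[symmetric] by (cases "x \<in> \<Omega>") (auto simp: F0_def)
    then show ?thesis by (simp only: integral_mult_right_zero)
  qed
  \<comment> \<open>The factor 2 built into the trace undoes the factor 1/2 in
    \<open>interior_flux_limit\<close>.\<close>
  moreover have "(\<lambda>k. 2 * (LINT x|lebesgue. indicator E x * (\<phi> x * (F0 x \<bullet> grad (U k) x)))) \<longlonglongrightarrow> 2 * (- (D + A) / 2)"
    unfolding A_def D_def by (intro tendsto_mult tendsto_const interior_flux_limit t)
  ultimately have "T = - (D + A)" using LIMSEQ_unique by fastforce
  moreover have "(LINT y:dens_set E 1|\<mu>p. \<phi> y) - (LINT y:dens_set E 1|\<mu>m. \<phi> y) = D"
    by (simp add: D_def Dint_def set_lebesgue_integral_def)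
  moreover have "(LINT y:dens_set E 1|lebesgue. F y \<bullet> grad \<phi> y) = A"
  proof -
    have "(LINT y:dens_set E 1|lebesgue. F y \<bullet> grad \<phi> y) = (LINT x|lebesgue. indicator (dens_set E 1) x * (F0 x \<bullet> grad \<phi> x))"
      unfolding set_lebesgue_integral_def using F_inner_eq_F0[of "grad \<phi>"] test_fun_grad_outside[OF t] by simp
    also have "\<dots> = A"
      unfolding A_def
    proof (rule integral_cong_AE)
      show "(\<lambda>x. indicator (dens_set E 1) x * (F0 x \<bullet> grad \<phi> x)) \<in> borel_measurable lebesgue"
        "(\<lambda>x. indicator E x * (F0 x \<bullet> grad \<phi> x)) \<in> borel_measurable lebesgue"
        using E_flux_integrable[OF t, of "indicat_real (dens_set E 1)"] E_flux_integrable[OF t, of "indicat_real E"]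
        by (auto intro: borel_measurable_integrable)
      show "AE x in lebesgue. indicator (dens_set E 1) x * (F0 x \<bullet> grad \<phi> x) = indicator E x * (F0 x \<bullet> grad \<phi> x)"
        using E_ae_eq_E1[OF assms(4)] by eventually_elim simp
    qed
    finally show ?thesis .
  qed
  ultimately show ?thesis by (simp add: T_def)
qed

end
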